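(* For any $n\geq 3$, the area function $D_0\colon\mathcal{AC}_n\to(0,\infty)$ extends continuously to the closure $\overline{\mathcal{AC}}_n$ of $\mathcal{AC}_n$ in $[0,\infty)^n$, satisfying $D_0\circ\phi_I=D_0$ for any $I\in\mathcal{I}_{m,n}$ with $2<m<n$ (the left-hand $D_0$ being the extension on $\overline{\mathcal{AC}}_n$, the right-hand $D_0$ the function on $\mathcal{AC}_m\cup\mathcal{HC}_m$), and $D_0\equiv0$ on $\phi_I(\Delta)$ for any $I\in\mathcal{I}_{2,n}$.
   Context: For $n\ge 3$ define $$\mathcal{AC}_n=\Big\{(d_0,\ldots,d_{n-1})\in(0,\infty)^n : \sinh(d_i/2)<\sum_{j\neq i}\sinh(d_j/2)\text{ for each } i\Big\},$$ $$\mathcal{HC}_n=\Big\{(d_0,\ldots,d_{n-1})\in(0,\infty)^n : \sinh(d_{i_0}/2)=\sum_{i\neq i_0}\sinh(d_i/2),\text{ where } d_{i_0}=\max_i d_i\Big\}.$$ A cyclic $n$-gon in the hyperbolic plane $\mathbb{H}^2$ with side length collection $(d_0,\ldots,d_{n-1})$ is a set $\{x_0,\ldots,x_{n-1}\}$ of points on a hyperbolic metric circle, cyclically ordered counterclockwise (for each $i$ with $1\le i\le n-1$, the counterclockwise half-open arc $(x_{i-1},x_i]$ contains no $x_j$ with $j\neq i$), such that $\mathrm{dist}(x_{i-1},x_i)=d_i$ for $i>0$ and $\mathrm{dist}(x_{n-1},x_0)=d_0$. The set $\mathcal{AC}_n$ is exactly the set of side length collections of cyclic $n$-gons, which are determined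 up to isometry by side length collection; for $\mathbf{d}\in\mathcal{AC}_n$, $D_0(\mathbf{d})$ is the hyperbolic area of the convex hull of a cyclic $n$-gon with side length collection $\mathbf{d}$. For $(d_0,\ldots,d_{n-1})\in\mathcal{HC}_n$ with maximal entry $d_{i_0}$, $$D_0(d_0,\ldots,d_{n-1})=(n-2)\pi+2\Big[\sin^{-1}\Big(\tfrac{1}{\cosh(d_{i_0}/2)}\Big)-\sum_{i\neq i_0}\sin^{-1}\Big(\tfrac{1}{\cosh(d_i/2)}\Big)\Big].$$ For $0<m<n$ let $\mathcal{I}_{m,n}$ be the collection of $I=(i_0,\ldots,i_{m-1})$ of integers with $0\leq i_0<i_1<\cdots<i_{m-1}\leq n-1$. For such $I$ define $\phi_I\colon\mathbb{R}^m\to\mathbb{R}^n$ by $\phi_I(x_0,\ldots,x_{m-1})=(y_0,\ldots,y_{n-1})$, where $y_i=x_j$ if $i=i_j$ for some $0\leq j\leq m-1$, and $y_i=0$ otherwise. Let $\Delta=\{(r,r) : r\geq0\}$. *)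

theory Defs
  imports "HOL-Analysis.Analysis"
begin

text \<open>The hyperbolic plane is the Poincare disk with the metric of curvature \<open>-1\<close>.
  \<open>mob c\<close> is an orientation-preserving isometry of the disk taking \<open>c\<close> to \<open>0\<close>.\<close>

definition hyp_plane :: "complex set" where
  "hyp_plane = {z. cmod z < 1}"

definition mob :: "complex \<Rightarrow> complex \<Rightarrow> complex" where
  "mob c z = (z - c) / (1 - cnj c * z)"

definition hdist :: "complex \<Rightarrow> complex \<Rightarrow> real" where
  "hdist z w = 2 * artanh (cmod (mob z w))"

definition harea :: "complex set \<Rightarrow> real" where
  "harea A = (LINT z:A|lebesgue. 4 / (1 - (cmod z)\<^sup>2)\<^sup>2)"

text \<open>Geodesic segments are described by metric betweenness.\<close>

definition hsegment :: "complex \<Rightarrow> complex \<Rightarrow> complex set" where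
  "hsegment a b = {z \<in> hyp_plane. hdist a z + hdist z b = hdist a b}"

definition hconvex :: "complex set \<Rightarrow> bool" where
  "hconvex S \<longleftrightarrow> S \<subseteq> hyp_plane \<and> (\<forall>a\<in>S. \<forall>b\<in>S. hsegment a b \<subseteq> S)"

definition hconvex_hull :: "complex set \<Rightarrow> complex set" where
  "hconvex_hull S = hconvex hull S"

definition hcircle :: "complex \<Rightarrow> real \<Rightarrow> complex set" where
  "hcircle c r = {z \<in> hyp_plane. hdist c z = r}"

text \<open>The counterclockwise half-open arc \<open>(a, b]\<close> of the hyperbolic circle with centre \<open>c\<close> and
  radius \<open>r\<close>, for points \<open>a\<close>, \<open>b\<close> of that circle. The isometry \<open>mob c\<close> carries the circle to a
  Euclidean circle about \<open>0\<close>, so \<open>Arg2pi (mob c z / mob c a)\<close> is the angle in \<open>[0, 2\<pi>)\<close>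
  through which \<open>a\<close> must be turned counterclockwise about \<open>c\<close> to reach \<open>z\<close>.\<close>

definition ccw_arc :: "complex \<Rightarrow> real \<Rightarrow> complex \<Rightarrow> complex \<Rightarrow> complex set" where
  "ccw_arc c r a b =
     {z \<in> hcircle c r. 0 < Arg2pi (mob c z / mob c a) \<and>
        Arg2pi (mob c z / mob c a) \<le> Arg2pi (mob c b / mob c a)}"

text \<open>\<open>x 0, \<dots>, x (n - 1)\<close> are the vertices of a cyclic \<open>n\<close>-gon with side length
  collection \<open>(d 0, \<dots>, d (n - 1))\<close>.\<close>

definition cyclic_ngon :: "nat \<Rightarrow> (nat \<Rightarrow> complex) \<Rightarrow> (nat \<Rightarrow> real) \<Rightarrow> bool" where
  "cyclic_ngon n x d \<longleftrightarrow>
     (\<exists>c\<in>hyp_plane. \<exists>r>0.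
        (\<forall>i<n. x i \<in> hcircle c r) \<and>
        (\<forall>i\<in>{1..<n}. \<forall>j<n. j \<noteq> i \<longrightarrow> x j \<notin> ccw_arc c r (x (i - 1)) (x i))) \<and>
     (\<forall>i\<in>{1..<n}. hdist (x (i - 1)) (x i) = d i) \<and>
     hdist (x (n - 1)) (x 0) = d 0"

text \<open>As in \<^const>\<open>Euclidean_space\<close>, a point of \<open>\<real>\<^sup>n\<close> is a function on
  \<^typ>\<open>nat\<close> that vanishes from \<open>n\<close> onwards, and the topology is the product topology.\<close>

definition nonneg_orthant :: "nat \<Rightarrow> (nat \<Rightarrow> real) topology" where
  "nonneg_orthant n = subtopology (Euclidean_space n) {d. \<forall>i<n. 0 \<le> d i}"

definition pos_orthant :: "nat \<Rightarrow> (nat \<Rightarrow> real) set" where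
  "pos_orthant n = {d \<in> topspace (Euclidean_space n). \<forall>i<n. 0 < d i}"

definition AC :: "nat \<Rightarrow> (nat \<Rightarrow> real) set" where
  "AC n = {d \<in> pos_orthant n. \<forall>i<n. sinh (d i / 2) < (\<Sum>j\<in>{..<n} - {i}. sinh (d j / 2))}"

definition HC :: "nat \<Rightarrow> (nat \<Rightarrow> real) set" where
  "HC n = {d \<in> pos_orthant n. \<exists>i0<n. d i0 = Max (d ` {..<n}) \<and>
             sinh (d i0 / 2) = (\<Sum>i\<in>{..<n} - {i0}. sinh (d i / 2))}"

definition cyclic_area :: "nat \<Rightarrow> (nat \<Rightarrow> real) \<Rightarrow> real" where
  "cyclic_area n d = (THE a. \<exists>x. cyclic_ngon n x d \<and> a = harea (hconvex_hull (x ` {..<n})))"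

text \<open>On \<open>HC n\<close> with \<open>n \<ge> 3\<close> the index of a maximal entry is unique.\<close>

definition horocyclic_area :: "nat \<Rightarrow> (nat \<Rightarrow> real) \<Rightarrow> real" where
  "horocyclic_area n d =
     (let i0 = (THE i. i < n \<and> d i = Max (d ` {..<n}))
      in (real n - 2) * pi +
         2 * (arcsin (1 / cosh (d i0 / 2)) - (\<Sum>i\<in>{..<n} - {i0}. arcsin (1 / cosh (d i / 2)))))"

definition D0 :: "nat \<Rightarrow> (nat \<Rightarrow> real) \<Rightarrow> real" where
  "D0 n d = (if d \<in> AC n then cyclic_area n d else horocyclic_area n d)"

text \<open>\<open>\<I>\<^sub>m\<^sub>,\<^sub>n\<close>: the tuple \<open>(i\<^sub>0, \<dots>, i\<^sub>m\<^sub>-\<^sub>1)\<close> is a list.\<close>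

definition Idx :: "nat \<Rightarrow> nat \<Rightarrow> nat list set" where
  "Idx m n = {I. length I = m \<and> sorted_wrt (<) I \<and> (\<forall>i\<in>set I. i < n)}"

definition phi :: "nat list \<Rightarrow> (nat \<Rightarrow> real) \<Rightarrow> nat \<Rightarrow> real" where
  "phi I x = (\<lambda>i. if i \<in> set I then x (THE j. j < length I \<and> I ! j = i) else 0)"

definition Delta :: "(nat \<Rightarrow> real) set" where
  "Delta = {x \<in> topspace (Euclidean_space 2). 0 \<le> x 0 \<and> x 1 = x 0}"

end

theory Submission
  imports Defs
begin

text \<open>A polygon inscribed in a hyperbolic circle becomes, in the Klein model centred at the
  circumcentre, a Euclidean convex hull of points on a circle about the origin. That circle's disk
  is the polygon together with the circular caps cut off by its sides, and the area of a cap is an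
  explicit integral. If side \<open>i\<close> subtends the angle \<open>2 \<theta> i\<close> at the
  circumcentre, so that the \<open>\<theta> i\<close> add up to \<open>\<pi>\<close> and
  \<open>sinh (d i / 2) = \<rho> sin (\<theta> i)\<close>, the caps give the area
  \<open>2 \<Sum> arccos (cos (\<theta> i) / cosh (d i / 2)) - 2 \<pi>\<close>.
  This formula makes sense for every tuple of angles with sines proportional to the numbers
  \<open>sinh (d i / 2)\<close>, including a factor of proportionality \<open>0\<close>, which is the
  horocyclic case, and including sides of length \<open>0\<close>. Over the closure such tuples
  exist, they form a closed subset of a compact set, and the area does not depend on the choice of
  the tuple; hence it is a continuous function of \<open>d\<close>.\<close>

section \<open>Change of variables in the complex plane\<close>

text \<open>Why the formula survives the passage to a horocycle: with hyperbolic circumradius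
  \<open>r\<close> and Klein radius \<open>R = tanh r\<close>, a cap has area
  \<open>2 * \<theta> * cosh r\<close> minus an angle term that involves only \<theta> and the side.
  The \<theta> add up to \<pi>, so the terms that grow with \<open>r\<close> cancel against the disk
  area \<open>2 * pi * (cosh r - 1)\<close>, and nothing diverges as \<open>r\<close> tends to
  infinity. The obstacle is the boundary. The angles are not determined by the sides there: for
  sides \<open>l, l, 0, ..., 0\<close> every pair \<theta>, \<open>pi - \<theta>\<close> is
  admissible, and if all sides vanish every tuple with sum \<pi> is. So the angles cannot be
  followed continuously, and continuity has to be proved for the area alone, by a closed graph
  argument. Conversely, once all sines vanish, proportionality by itself would accept the angle
  \<pi> at any index and the area would no longer be well defined; an inequality that is stable
  under limits has to single out the long side.\<close>

definition complex_of_vec :: "real^2 \<Rightarrow> complex" where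
  "complex_of_vec v = Complex (v $ 1) (v $ 2)"

definition vec_of_complex :: "complex \<Rightarrow> real^2" where
  "vec_of_complex z = vector [Re z, Im z]"

lemma complex_of_vec_inverse [simp]:
  "complex_of_vec (vec_of_complex z) = z" "vec_of_complex (complex_of_vec v) = v"
  by (auto simp: complex_of_vec_def vec_of_complex_def vec_eq_iff forall_2)

lemma bounded_linear_complex_of_vec: "bounded_linear complex_of_vec"
  by (rule linear_conv_bounded_linear[THEN iffD1], rule linearI)
     (auto simp: complex_of_vec_def complex_eq_iff)

lemma bounded_linear_vec_of_complex: "bounded_linear vec_of_complex"
  by (rule linear_conv_bounded_linear[THEN iffD1], rule linearI)
     (auto simp: vec_of_complex_def vec_eq_iff forall_2)

lemma continuous_complex_of_vec: "continuous_on S complex_of_vec"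
  by (simp add: bounded_linear.linear[OF bounded_linear_complex_of_vec] linear_continuous_on bounded_linear_complex_of_vec)

lemma complex_of_vec_measurable [measurable]: "complex_of_vec \<in> borel_measurable borel"
  using continuous_complex_of_vec borel_measurable_continuous_onI by blast

text \<open>The two bases correspond, so boxes go to boxes with the same side lengths. This moves
  integrals over \<open>complex\<close> to \<open>real^2\<close>, where the change of variables
  theorem is stated.\<close>

lemma distr_complex_of_vec: "distr lborel borel complex_of_vec = lborel"
proof (rule lborel_eqI[symmetric])
  fix l u :: complex
  assume lu: "\<And>b. b \<in> Basis \<Longrightarrow> l \<bullet> b \<le> u \<bullet> b"
  have "complex_of_vec -` box l u = box (vec_of_complex l) (vec_of_complex u)"
    by (auto simp: mem_box_cart mem_box Basis_complex_def complex_of_vec_def vec_of_complex_def forall_2)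
  moreover have B: "(Basis :: (real^2) set) = {axis 1 1, axis 2 1}"
    by (auto simp: Basis_vec_def UNIV_2)
  moreover have "emeasure lborel (box (vec_of_complex l) (vec_of_complex u)) = (\<Prod>b\<in>Basis. (vec_of_complex u - vec_of_complex l) \<bullet> b)"
    using lu[of 1] lu[of \<i>]
    by (intro emeasure_lborel_box) (auto simp: B Basis_complex_def inner_axis vec_of_complex_def)
  moreover have "(\<Prod>b\<in>Basis. (vec_of_complex u - vec_of_complex l) \<bullet> b) = (\<Prod>b\<in>Basis. (u - l) \<bullet> b)"
    unfolding B by (simp add: axis_eq_axis Basis_complex_def inner_axis vec_of_complex_def)
  ultimately show "emeasure (distr lborel borel complex_of_vec) (box l u) = ennreal (\<Prod>b\<in>Basis. (u - l) \<bullet> b)"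
    by (subst emeasure_distr) auto
qed auto

lemma absolutely_integrable_complex_of_vec:
  fixes F :: "complex \<Rightarrow> real"
  assumes [measurable]: "S \<in> sets borel" "F \<in> borel_measurable borel"
  shows "F absolutely_integrable_on S \<longleftrightarrow> (\<lambda>v. F (complex_of_vec v)) absolutely_integrable_on (complex_of_vec -` S)"
    and "(LINT z:S|lebesgue. F z) = (LINT v:complex_of_vec -` S|lebesgue. F (complex_of_vec v))"
proof -
  have [measurable]: "complex_of_vec -` S \<in> sets borel"
    using measurable_sets[OF complex_of_vec_measurable assms(1)] by simp
  have "F absolutely_integrable_on S \<longleftrightarrow> integrable (distr lborel borel complex_of_vec) (\<lambda>x. indicator S x *\<^sub>R F x)"
    unfolding set_integrable_def distr_complex_of_vec by (rule integrable_completion) measurable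
  also have "\<dots> \<longleftrightarrow> integrable lborel (\<lambda>v. indicator S (complex_of_vec v) *\<^sub>R F (complex_of_vec v))"
    by (rule integrable_distr_eq) measurable
  also have "\<dots> \<longleftrightarrow> (\<lambda>v. F (complex_of_vec v)) absolutely_integrable_on (complex_of_vec -` S)"
    unfolding set_integrable_def
    by (subst integrable_completion) (measurable, simp add: indicator_vimage[unfolded o_def, symmetric])
  finally show "F absolutely_integrable_on S \<longleftrightarrow> (\<lambda>v. F (complex_of_vec v)) absolutely_integrable_on (complex_of_vec -` S)" .
  have "(LINT z:S|lebesgue. F z) = integral\<^sup>L (distr lborel borel complex_of_vec) (\<lambda>x. indicator S x *\<^sub>R F x)"
    unfolding set_lebesgue_integral_def distr_complex_of_vec by (rule integral_completion) measurable
  also have "\<dots> = integral\<^sup>L lborel (\<lambda>v. indicator S (complex_of_vec v) *\<^sub>R F (complex_of_vec v))"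
    by (rule integral_distr) measurable
  also have "\<dots> = (LINT v:complex_of_vec -` S|lebesgue. F (complex_of_vec v))"
    unfolding set_lebesgue_integral_def
    by (subst integral_completion) (measurable, simp add: indicator_vimage[unfolded o_def, symmetric])
  finally show "(LINT z:S|lebesgue. F z) = (LINT v:complex_of_vec -` S|lebesgue. F (complex_of_vec v))" .
qed

text \<open>Every real-linear map of the plane has the form \<open>a * v + b * cnj v\<close>, with
  determinant the difference of the squared moduli. In these Wirtinger coordinates the Jacobian of a
  Moebius map followed by \<open>klein\<close> can be found without matrices.\<close>

proposition complex_change_of_variables:
  fixes g :: "complex \<Rightarrow> complex" and f F :: "complex \<Rightarrow> real"
  assumes S: "S \<in> sets borel" and gS: "g ` S \<in> sets borel"
    and der: "\<And>z. z \<in> S \<Longrightarrow> (g has_derivative (\<lambda>v. a z * v + b z * cnj v)) (at z)"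
    and inj: "inj_on g S"
    and meas: "f \<in> borel_measurable borel" "F \<in> borel_measurable borel"
    and F: "\<And>z. z \<in> S \<Longrightarrow> F z = \<bar>(cmod (a z))\<^sup>2 - (cmod (b z))\<^sup>2\<bar> * f (g z)"
    and int: "f absolutely_integrable_on (g ` S)"
  shows "F absolutely_integrable_on S" "(LINT z:S|lebesgue. F z) = integral (g ` S) f"
proof -
  let ?c = complex_of_vec and ?v = vec_of_complex
  define G where "G = ?v \<circ> g \<circ> ?c"
  define D where "D x v = ?v (a (?c x) * ?c v + b (?c x) * cnj (?c v))" for x v
  let ?S = "?c -` S"
  have S': "?S \<in> sets lebesgue"
    using measurable_sets[OF complex_of_vec_measurable S] by simp
  have derG: "(G has_derivative D x) (at x within ?S)" if "x \<in> ?S" for x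
  proof -
    have "(g has_derivative (\<lambda>v. a (?c x) * v + b (?c x) * cnj v)) (at (?c x))"
      using der that by auto
    then have "((\<lambda>x. g (?c x)) has_derivative (\<lambda>v. a (?c x) * ?c v + b (?c x) * cnj (?c v))) (at x)"
      using has_derivative_compose[OF bounded_linear.has_derivative[OF bounded_linear_complex_of_vec has_derivative_ident]]
      by blast
    then show ?thesis
      unfolding G_def D_def o_def
      by (intro bounded_linear.has_derivative[OF bounded_linear_vec_of_complex]) (rule has_derivative_at_withinI)
  qed
  have injG: "inj_on G ?S"
    using inj unfolding G_def inj_on_def o_def
    by (metis complex_of_vec_inverse vimage_eq)
  have GS: "G ` ?S = ?c -` (g ` S)"
  proof -
    have "x \<in> G ` ?S" if "?c x = g z" "z \<in> S" for x z
      using that by (intro image_eqI[of _ _ "?v z"]) (auto simp: G_def simp flip: that(1))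
    then show ?thesis by (auto simp: G_def)
  qed
  have det: "\<bar>det (matrix (D x))\<bar> = \<bar>(cmod (a (?c x)))\<^sup>2 - (cmod (b (?c x)))\<^sup>2\<bar>" for x
  proof -
    have "det (matrix (D x)) = (cmod (a (?c x)))\<^sup>2 - (cmod (b (?c x)))\<^sup>2"
      unfolding det_2 matrix_def D_def
      by (simp add: complex_of_vec_def vec_of_complex_def axis_def cmod_power2)
         (simp add: power2_eq_square algebra_simps)
    then show ?thesis by simp
  qed
  \<comment> \<open>The theorem applied in \<open>main\<close> takes vector-valued integrands, hence
    the detour through \<open>real^1\<close>.\<close>
  define f' :: "real^2 \<Rightarrow> real^1" where "f' v = vec (f (?c v))" for v
  have vec1: "((\<lambda>x. vec (h x) :: real^1) absolutely_integrable_on T) \<longleftrightarrow> h absolutely_integrable_on T"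
     for h :: "real^2 \<Rightarrow> real" and T
    by (subst absolutely_integrable_componentwise_iff) (auto simp: Basis_vec_def inner_axis)
  have ivec1: "integral T (\<lambda>x. vec (h x) :: real^1) = vec (integral T h)"
     if "h absolutely_integrable_on T" for h :: "real^2 \<Rightarrow> real" and T
  proof -
    have "(h has_integral integral T h) T"
      using that absolutely_integrable_on_def by blast
    have "bounded_linear (vec :: real \<Rightarrow> real^1)"
      by (rule linear_conv_bounded_linear[THEN iffD1], rule linear_vec)
    from has_integral_linear[OF \<open>(h has_integral _) T\<close> this]
    show ?thesis by (simp add: o_def integral_unique)
  qed
  have int1: "(\<lambda>v. f (?c v)) absolutely_integrable_on (?c -` (g ` S))"
    using absolutely_integrable_complex_of_vec(1)[OF gS meas(1)] int by blast
  have int2: "f' absolutely_integrable_on (G ` ?S)"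
    using int1 unfolding f'_def GS vec1 .
  have main: "(\<lambda>x. \<bar>det (matrix (D x))\<bar> *\<^sub>R f' (G x)) absolutely_integrable_on ?S \<and>
      integral ?S (\<lambda>x. \<bar>det (matrix (D x))\<bar> *\<^sub>R f' (G x)) = integral (G ` ?S) f'"
    using has_absolute_integral_change_of_variables[OF S' derG injG] int2 by blast
  have eq: "\<bar>det (matrix (D x))\<bar> *\<^sub>R f' (G x) = vec (F (?c x))" if "x \<in> ?S" for x
    using F that by (simp add: det f'_def G_def vec_eq_iff)
  have A: "(\<lambda>x. vec (F (?c x)) :: real^1) absolutely_integrable_on ?S"
  proof -
    have "(\<lambda>x. \<bar>det (matrix (D x))\<bar> *\<^sub>R f' (G x)) absolutely_integrable_on ?S \<longleftrightarrow> (\<lambda>x. vec (F (?c x)) :: real^1) absolutely_integrable_on ?S"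
      by (rule set_integrable_cong) (use eq in auto)
    with main show ?thesis by simp
  qed
  then have A': "(\<lambda>x. F (?c x)) absolutely_integrable_on ?S"
    by (simp only: vec1)
  then show F_int: "F absolutely_integrable_on S"
    using absolutely_integrable_complex_of_vec(1)[OF S meas(2)] by blast
  have "vec (integral ?S (\<lambda>x. F (?c x))) = integral ?S (\<lambda>x. vec (F (?c x)) :: real^1)"
    using ivec1[OF A'] by simp
  also have "\<dots> = integral (G ` ?S) f'"
  proof -
    have "integral ?S (\<lambda>x. \<bar>det (matrix (D x))\<bar> *\<^sub>R f' (G x)) = integral ?S (\<lambda>x. vec (F (?c x)) :: real^1)"
      by (rule integral_cong) (use eq in auto)
    with main show ?thesis by simp
  qed
  also have "\<dots> = vec (integral (?c -` (g ` S)) (\<lambda>v. f (?c v)))"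
    unfolding f'_def GS using ivec1[OF int1] .
  finally have "integral ?S (\<lambda>x. F (?c x)) = integral (?c -` (g ` S)) (\<lambda>v. f (?c v))"
    by (simp add: vec_eq_iff)
  moreover have "integral ?S (\<lambda>x. F (?c x)) = (LINT z:S|lebesgue. F z)"
    using set_lebesgue_integral_eq_integral(2)[OF A'] absolutely_integrable_complex_of_vec(2)[OF S meas(2)] by simp
  moreover have "integral (?c -` (g ` S)) (\<lambda>v. f (?c v)) = integral (g ` S) f"
    using set_lebesgue_integral_eq_integral(2)[OF int1] absolutely_integrable_complex_of_vec(2)[OF gS meas(1)]
      set_lebesgue_integral_eq_integral(2)[OF int] by simp
  ultimately show "(LINT z:S|lebesgue. F z) = integral (g ` S) f" by simp
qed

section \<open>From the Poincare disk to the Klein disk\<close>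

text \<open>A radial map taking modulus \<open>tanh (r / 2)\<close> to \<open>tanh r\<close>:
  circles about the origin stay such circles, while geodesics become Euclidean segments.\<close>

definition klein :: "complex \<Rightarrow> complex" where
  "klein z = (2 / (1 + (cmod z)\<^sup>2)) *\<^sub>R z"

definition klein_inv :: "complex \<Rightarrow> complex" where
  "klein_inv w = (1 / (1 + sqrt (1 - (cmod w)\<^sup>2))) *\<^sub>R w"

lemma one_minus_klein:
  "1 - (cmod (klein z))\<^sup>2 = ((1 - (cmod z)\<^sup>2) / (1 + (cmod z)\<^sup>2))\<^sup>2"
proof -
  have "1 + (cmod z)\<^sup>2 \<noteq> 0"
    by (metis add_nonneg_eq_0_iff zero_le_one zero_le_power2 zero_neq_one)
  moreover have "(cmod (klein z))\<^sup>2 = 4 * (cmod z)\<^sup>2 / (1 + (cmod z)\<^sup>2)\<^sup>2"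
    by (simp add: klein_def power_mult_distrib power_divide)
  moreover have "1 - 4 * q / (1 + q)\<^sup>2 = ((1 - q) / (1 + q))\<^sup>2" if "1 + q \<noteq> 0" for q :: real
    using that by (simp add: power_divide divide_simps) (simp add: power2_eq_square algebra_simps)
  ultimately show ?thesis by simp
qed

lemma klein_norm_less:
  assumes "cmod z < 1" shows "cmod (klein z) < 1"
proof -
  have "(cmod z)\<^sup>2 < 1" using assms by (simp add: abs_square_less_1)
  then have "0 < (1 - (cmod z)\<^sup>2) / (1 + (cmod z)\<^sup>2)"
    by (intro divide_pos_pos add_pos_nonneg) auto
  then have "0 < 1 - (cmod (klein z))\<^sup>2"
    unfolding one_minus_klein by (rule zero_less_power)
  then show ?thesis
    by (simp add: abs_square_less_1)
qed

lemma sqrt_one_minus_klein: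
  assumes "cmod z < 1"
  shows "sqrt (1 - (cmod (klein z))\<^sup>2) = (1 - (cmod z)\<^sup>2) / (1 + (cmod z)\<^sup>2)"
proof -
  have "(cmod z)\<^sup>2 < 1" using assms by (simp add: abs_square_less_1)
  then show ?thesis
    unfolding one_minus_klein by (simp add: real_sqrt_abs add_nonneg_nonneg)
qed

lemma klein_inv_klein:
  assumes "cmod z < 1" shows "klein_inv (klein z) = z"
proof -
  have "1 + (cmod z)\<^sup>2 > 0" by (simp add: add_pos_nonneg)
  then have "1 / (1 + (1 - (cmod z)\<^sup>2) / (1 + (cmod z)\<^sup>2)) * (2 / (1 + (cmod z)\<^sup>2)) = 1"
    by (simp add: field_simps)
  then show ?thesis
    unfolding klein_inv_def sqrt_one_minus_klein[OF assms] by (simp add: klein_def)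
qed

lemma klein_klein_inv:
  assumes "cmod w < 1"
  shows "cmod (klein_inv w) < 1" "klein (klein_inv w) = w"
proof -
  define s where "s = sqrt (1 - (cmod w)\<^sup>2)"
  have w: "(cmod w)\<^sup>2 < 1" using assms by (simp add: abs_square_less_1)
  then have s: "s > 0" "s\<^sup>2 = 1 - (cmod w)\<^sup>2" by (auto simp: s_def)
  have n: "(cmod (klein_inv w))\<^sup>2 = (1 - s) / (1 + s)"
  proof -
    have "(cmod (klein_inv w))\<^sup>2 = (1 - s\<^sup>2) / (1 + s)\<^sup>2"
      using s by (simp add: klein_inv_def s_def[symmetric] power_mult_distrib power_divide)
    also have "1 - s\<^sup>2 = (1 - s) * (1 + s)"
      by (simp add: power2_eq_square algebra_simps)
    also have "(1 - s) * (1 + s) / (1 + s)\<^sup>2 = (1 - s) / (1 + s)"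
      using s(1) by (simp add: power2_eq_square)
    finally show ?thesis .
  qed
  have "(1 - s) / (1 + s) < 1" using s by (simp add: field_simps)
  then show "cmod (klein_inv w) < 1" using abs_square_less_1[of "cmod (klein_inv w)"] by (simp add: n)
  have "2 / (1 + (1 - s) / (1 + s)) * (1 / (1 + s)) = 1" using s by (simp add: field_simps)
  then show "klein (klein_inv w) = w"
    unfolding klein_def n by (simp add: klein_inv_def flip: s_def)
qed

section \<open>Moebius isometries, hyperbolic distance and geodesic segments\<close>

lemma mob_denom: "cmod c < 1 \<Longrightarrow> cmod z < 1 \<Longrightarrow> 1 - cnj c * z \<noteq> 0"
  by (metis complex_mod_cnj eq_iff_diff_eq_0 mult_strict_mono' norm_ge_zero norm_mult norm_one mult.right_neutral order.irrefl)

lemma norm_mob_denom: "(cmod (1 - cnj c * z))\<^sup>2 - (cmod (z - c))\<^sup>2 = (1 - (cmod c)\<^sup>2) * (1 - (cmod z)\<^sup>2)"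
  by (simp add: cmod_power2) (simp add: algebra_simps power2_eq_square)

lemma one_minus_mob:
  assumes "cmod c < 1" "cmod z < 1"
  shows "1 - (cmod (mob c z))\<^sup>2 = (1 - (cmod c)\<^sup>2) * (1 - (cmod z)\<^sup>2) / (cmod (1 - cnj c * z))\<^sup>2"
proof -
  have "cmod (1 - cnj c * z) \<noteq> 0" using mob_denom[OF assms] by simp
  then show ?thesis
    unfolding norm_mob_denom[symmetric] mob_def
    by (simp only: norm_divide power_divide) (simp add: divide_simps)
qed

lemma mob_norm_less:
  assumes "cmod c < 1" "cmod z < 1" shows "cmod (mob c z) < 1"
proof -
  have "(cmod c)\<^sup>2 < 1" "(cmod z)\<^sup>2 < 1" using assms by (auto simp: abs_square_less_1)
  then have "0 < 1 - (cmod (mob c z))\<^sup>2"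
    unfolding one_minus_mob[OF assms] using mob_denom[OF assms] by simp
  then show ?thesis by (simp add: abs_square_less_1)
qed

lemma mob_mob_minus:
  assumes "cmod c < 1" "cmod z < 1" shows "mob c (mob (-c) z) = z"
proof -
  have d: "1 + cnj c * z \<noteq> 0" using mob_denom[of "-c" z] assms by simp
  have "1 - cnj c * c \<noteq> 0" using mob_denom[of c c] assms by simp
  have "mob c (mob (-c) z) = ((z + c) - c * (1 + cnj c * z)) / ((1 + cnj c * z) - cnj c * (z + c))"
    using d unfolding mob_def by (simp add: divide_simps)
  also have "\<dots> = (z * (1 - cnj c * c)) / (1 - cnj c * c)"
    by (simp add: algebra_simps)
  finally show ?thesis using \<open>1 - cnj c * c \<noteq> 0\<close> by simp
qed

text \<open>The numerator and the denominator of the outer quotient acquire factors of equal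
  modulus, which differ only by a conjugation of \<open>1 - cnj c * z\<close>.\<close>

lemma norm_mob_mob:
  assumes "cmod c < 1" "cmod z < 1" "cmod w < 1"
  shows "cmod (mob (mob c z) (mob c w)) = cmod (mob z w)"
proof -
  have 1: "(cmod (mob (mob c z) (mob c w)))\<^sup>2 = (cmod (mob z w))\<^sup>2"
  proof -
    let ?Z = "1 - cnj c * z" and ?W = "1 - cnj c * w"
    have d: "?Z \<noteq> 0" "?W \<noteq> 0" "1 - cnj z * w \<noteq> 0" "1 - cnj c * c \<noteq> 0"
      using assms mob_denom by auto
    have cd: "1 - c * cnj z \<noteq> 0" "1 - c * cnj c \<noteq> 0" using d by (metis complex_cnj_cnj complex_cnj_diff complex_cnj_mult complex_cnj_one complex_cnj_zero_iff)+
    have A: "mob c w - mob c z = (1 - cnj c * c) * (w - z) / (?Z * ?W)"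
      unfolding mob_def using d by (simp add: divide_simps) (simp add: algebra_simps)
    have B: "1 - cnj (mob c z) * mob c w = (1 - cnj c * c) * (1 - cnj z * w) / (cnj ?Z * ?W)"
      unfolding mob_def using d cd by (simp add: divide_simps) (simp add: algebra_simps)
    have "cmod (mob (mob c z) (mob c w)) = cmod (mob c w - mob c z) / cmod (1 - cnj (mob c z) * mob c w)"
      by (simp add: mob_def norm_divide)
    also have "\<dots> = cmod (w - z) / cmod (1 - cnj z * w)"
      unfolding A B norm_mult norm_divide complex_mod_cnj using d by (simp add: divide_simps)
    also have "\<dots> = cmod (mob z w)" by (simp add: mob_def norm_divide)
    finally show ?thesis by simp
  qed
  then show ?thesis by simp
qed

lemma cosh_two_artanh:
  fixes m :: real
  assumes "\<bar>m\<bar> < 1" shows "cosh (2 * artanh m) = (1 + m\<^sup>2) / (1 - m\<^sup>2)"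
proof -
  have m: "1 + m > 0" "1 - m > 0" using assms by auto
  have "m * m < 1" using assms by (metis abs_square_less_1 power2_eq_square)
  then have "cosh (ln ((1 + m) / (1 - m))) = (1 + m\<^sup>2) / (1 - m\<^sup>2)"
    using m by (subst cosh_ln_real) (auto simp: field_simps power2_eq_square)
  then show ?thesis by (simp add: artanh_def)
qed

lemma hdist_nonneg:
  assumes "cmod z < 1" "cmod w < 1" shows "0 \<le> hdist z w"
proof -
  let ?m = "cmod (mob z w)"
  have "?m < 1" using mob_norm_less assms by blast
  then have "(1 + ?m) / (1 - ?m) \<ge> 1" by (simp add: field_simps)
  then show ?thesis unfolding hdist_def artanh_def by (simp add: ln_ge_zero)
qed

text \<open>A Klein point \<open>w\<close> lifts to \<open>(1, w) / sqrt (1 - |w|^2)\<close> on the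
  hyperboloid; the right-hand side is the Minkowski product of two lifts.\<close>

lemma cosh_hdist:
  assumes "cmod z < 1" "cmod w < 1"
  shows "cosh (hdist z w) = (1 - klein z \<bullet> klein w) /
    (sqrt (1 - (cmod (klein z))\<^sup>2) * sqrt (1 - (cmod (klein w))\<^sup>2))"
proof -
  define p q where "p = (cmod z)\<^sup>2" and "q = (cmod w)\<^sup>2"
  have pq: "0 \<le> p" "p < 1" "0 \<le> q" "q < 1" using assms by (auto simp: p_def q_def abs_square_less_1)
  define D N where "D = (cmod (1 - cnj z * w))\<^sup>2" and "N = (cmod (w - z))\<^sup>2"
  have D: "D > 0" using mob_denom assms by (simp add: D_def)
  have DN: "D - N = (1 - p) * (1 - q)" unfolding D_def N_def p_def q_def by (rule norm_mob_denom)
  have DN2: "D + N = (1 + p) * (1 + q) - 4 * (z \<bullet> w)"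
    unfolding D_def N_def p_def q_def
    by (simp add: cmod_power2 inner_complex_def) (simp add: algebra_simps power2_eq_square)
  have m: "(cmod (mob z w))\<^sup>2 = N / D" by (simp add: mob_def D_def N_def norm_divide power_divide)
  have "cosh (hdist z w) = (1 + N / D) / (1 - N / D)"
    unfolding hdist_def using cosh_two_artanh[of "cmod (mob z w)"] mob_norm_less[OF assms] m by simp
  also have "\<dots> = ((D + N) / D) / ((D - N) / D)" using D by (simp add: add_divide_distrib diff_divide_distrib)
  also have "\<dots> = (D + N) / (D - N)" using D by simp
  also have "\<dots> = (1 - 4 * (z \<bullet> w) / ((1 + p) * (1 + q))) / ((1 - p) / (1 + p) * ((1 - q) / (1 + q)))"
    unfolding DN DN2 using pq by (simp add: divide_simps) 
  also have "4 * (z \<bullet> w) / ((1 + p) * (1 + q)) = klein z \<bullet> klein w"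
    by (simp add: klein_def p_def q_def)
  finally show ?thesis
    unfolding sqrt_one_minus_klein[OF assms(1)] sqrt_one_minus_klein[OF assms(2)] p_def q_def .
qed

text \<open>To be read on the hyperboloid: \<open>Z = l A + m B\<close> has Minkowski norm 1, and
  the assumptions are its products with \<open>A\<close>, with \<open>B\<close> and with itself.
  They force \<open>sinh \<alpha> = m * sinh \<gamma>\<close> and
  \<open>sinh \<beta> = l * sinh \<gamma>\<close>, and the addition formula does the rest.\<close>

lemma add_eq_of_cosh:
  fixes \<alpha> \<beta> \<gamma> l m :: real
  assumes "0 \<le> \<alpha>" "0 \<le> \<beta>" "0 \<le> \<gamma>" "0 \<le> l" "0 \<le> m"
    and a: "cosh \<alpha> = l + m * cosh \<gamma>" and b: "cosh \<beta> = l * cosh \<gamma> + m"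
    and n: "l\<^sup>2 + m\<^sup>2 + 2 * l * m * cosh \<gamma> = 1"
  shows "\<alpha> + \<beta> = \<gamma>"
proof -
  have s: "(sinh \<gamma>)\<^sup>2 = (cosh \<gamma>)\<^sup>2 - 1" using cosh_square_eq[of \<gamma>] by simp
  have "(sinh \<alpha>)\<^sup>2 = (l + m * cosh \<gamma>)\<^sup>2 - (l\<^sup>2 + m\<^sup>2 + 2 * l * m * cosh \<gamma>)"
    using cosh_square_eq[of \<alpha>] a n by simp
  also have "\<dots> = (m * sinh \<gamma>)\<^sup>2" unfolding power_mult_distrib s by (simp add: algebra_simps power2_eq_square)
  finally have sa: "sinh \<alpha> = m * sinh \<gamma>"
    by (rule power2_eq_imp_eq) (simp_all add: assms(1,3,5))
  have "(sinh \<beta>)\<^sup>2 = (l * cosh \<gamma> + m)\<^sup>2 - (l\<^sup>2 + m\<^sup>2 + 2 * l * m * cosh \<gamma>)"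
    using cosh_square_eq[of \<beta>] b n by simp
  also have "\<dots> = (l * sinh \<gamma>)\<^sup>2" unfolding power_mult_distrib s by (simp add: algebra_simps power2_eq_square)
  finally have sb: "sinh \<beta> = l * sinh \<gamma>"
    by (rule power2_eq_imp_eq) (simp_all add: assms(2,3,4))
  have "cosh (\<alpha> + \<beta>) = (l + m * cosh \<gamma>) * (l * cosh \<gamma> + m) + l * m * (sinh \<gamma>)\<^sup>2"
    unfolding cosh_add a b sa sb by (simp add: power2_eq_square)
  also have "\<dots> = cosh \<gamma> * (l\<^sup>2 + m\<^sup>2 + 2 * l * m * cosh \<gamma>)"
    unfolding s by (simp add: algebra_simps power2_eq_square)
  finally have "cosh (\<alpha> + \<beta>) = cosh \<gamma>" using n by simp
  then have "arcosh (cosh (\<alpha> + \<beta>)) = arcosh (cosh \<gamma>)" by (rule arg_cong)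
  then show ?thesis by (simp add: arcosh_cosh_real assms(1-3))
qed

text \<open>The equality case of the reversed Cauchy-Schwarz inequality for the Minkowski form: the
  defect is at least \<open>(1 - |x|^2) * |y - x|^2\<close>.\<close>

lemma klein_form_eq_imp_eq:
  fixes x y :: complex
  assumes "cmod x < 1" "cmod y < 1" "(1 - x \<bullet> y)\<^sup>2 = (1 - (cmod x)\<^sup>2) * (1 - (cmod y)\<^sup>2)"
  shows "x = y"
proof -
  have "(x \<bullet> (y - x))\<^sup>2 \<le> (cmod x)\<^sup>2 * (cmod (y - x))\<^sup>2"
    using Cauchy_Schwarz_ineq[of x "y - x"] by (simp add: power2_norm_eq_inner)
  moreover have "(1 - x \<bullet> y)\<^sup>2 - (1 - (cmod x)\<^sup>2) * (1 - (cmod y)\<^sup>2) =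
     (cmod (y - x))\<^sup>2 - ((cmod x)\<^sup>2 * (cmod (y - x))\<^sup>2 - (x \<bullet> (y - x))\<^sup>2)"
    unfolding power2_norm_eq_inner by (simp add: algebra_simps inner_commute power2_eq_square)
  ultimately have "(1 - (cmod x)\<^sup>2) * (cmod (y - x))\<^sup>2 \<le> 0" using assms(3) by (simp add: algebra_simps)
  moreover have "1 - (cmod x)\<^sup>2 > 0" using assms by (simp add: abs_square_less_1)
  ultimately have "(cmod (y - x))\<^sup>2 \<le> 0" by (simp add: mult_le_0_iff)
  then show ?thesis by simp
qed

lemma hdist_eq_0D:
  assumes "cmod z < 1" "cmod w < 1" "hdist z w = 0" shows "z = w"
proof -
  have "0 < sqrt (1 - (cmod (klein z))\<^sup>2) * sqrt (1 - (cmod (klein w))\<^sup>2)"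
    using klein_norm_less assms by (simp add: abs_square_less_1)
  then have "1 - klein z \<bullet> klein w = sqrt (1 - (cmod (klein z))\<^sup>2) * sqrt (1 - (cmod (klein w))\<^sup>2)"
    using cosh_hdist[OF assms(1,2)] assms(3) by simp
  then have "(1 - klein z \<bullet> klein w)\<^sup>2 = (1 - (cmod (klein z))\<^sup>2) * (1 - (cmod (klein w))\<^sup>2)"
    using klein_norm_less assms by (simp add: power_mult_distrib less_imp_le abs_square_le_1)
  then show ?thesis
    using klein_form_eq_imp_eq klein_norm_less assms klein_inv_klein by metis
qed

text \<open>A point of the hyperboloid is a nonnegative combination \<open>l A + m B\<close> of two others exactly
  when it lies on the geodesic segment between them; \<open>l\<close> and \<open>m\<close> are the ratios of hyperbolic
  sines.\<close>

lemma hsegment_klein_iff: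
  assumes "cmod a < 1" "cmod b < 1" "cmod z < 1"
  shows "hdist a z + hdist z b = hdist a b \<longleftrightarrow> klein z \<in> closed_segment (klein a) (klein b)"
proof -
  define u v w where "u = klein a" and "v = klein b" and "w = klein z"
  define A B Z where "A = sqrt (1 - (cmod u)\<^sup>2)" and "B = sqrt (1 - (cmod v)\<^sup>2)" and "Z = sqrt (1 - (cmod w)\<^sup>2)"
  have lt: "cmod u < 1" "cmod v < 1" "cmod w < 1"
    unfolding u_def v_def w_def using assms klein_norm_less by auto
  then have lt2: "(cmod u)\<^sup>2 < 1" "(cmod v)\<^sup>2 < 1" "(cmod w)\<^sup>2 < 1" by (auto simp: abs_square_less_1)
  then have pos: "A > 0" "B > 0" "Z > 0" by (auto simp: A_def B_def Z_def)
  have sq: "A\<^sup>2 = 1 - u \<bullet> u" "B\<^sup>2 = 1 - v \<bullet> v" "Z\<^sup>2 = 1 - w \<bullet> w"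
    using lt2 by (auto simp: A_def B_def Z_def dot_square_norm)
  define \<alpha> \<beta> \<gamma> where "\<alpha> = hdist a z" and "\<beta> = hdist z b" and "\<gamma> = hdist a b"
  have nn: "0 \<le> \<alpha>" "0 \<le> \<beta>" "0 \<le> \<gamma>" unfolding \<alpha>_def \<beta>_def \<gamma>_def using assms hdist_nonneg by auto
  have c\<alpha>: "cosh \<alpha> = (1 - u \<bullet> w) / (A * Z)" and c\<beta>: "cosh \<beta> = (1 - w \<bullet> v) / (Z * B)"
    and c\<gamma>: "cosh \<gamma> = (1 - u \<bullet> v) / (A * B)"
    unfolding \<alpha>_def \<beta>_def \<gamma>_def u_def v_def w_def A_def B_def Z_def using assms cosh_hdist by auto
  show ?thesis unfolding \<alpha>_def[symmetric] \<beta>_def[symmetric] \<gamma>_def[symmetric] u_def[symmetric] v_def[symmetric] w_def[symmetric]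
  proof
    assume "w \<in> closed_segment u v"
    then obtain s where s: "0 \<le> s" "s \<le> 1" "w = (1 - s) *\<^sub>R u + s *\<^sub>R v"
      by (auto simp: closed_segment_def)
    \<comment> \<open>The weights of the Klein convex combination, rescaled by the heights
      \<open>1 / A\<close>, \<open>1 / B\<close>, \<open>1 / Z\<close> of the hyperboloid
      lifts.\<close>
    define l m where "l = (1 - s) * A / Z" and "m = s * B / Z"
    show "\<alpha> + \<beta> = \<gamma>"
    proof (rule add_eq_of_cosh[OF nn])
      show "0 \<le> l" "0 \<le> m" using s(1,2) pos by (auto simp: l_def m_def)
      have "1 - u \<bullet> w = (1 - s) * A\<^sup>2 + s * (1 - u \<bullet> v)"
        unfolding sq s(3) by (simp add: inner_add_right algebra_simps)
      then show "cosh \<alpha> = l + m * cosh \<gamma>"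
        unfolding c\<alpha> c\<gamma> l_def m_def using pos by (simp add: divide_simps) (simp add: power2_eq_square algebra_simps)
      have "1 - w \<bullet> v = (1 - s) * (1 - u \<bullet> v) + s * B\<^sup>2"
        unfolding sq s(3) by (simp add: inner_add_left algebra_simps)
      then show "cosh \<beta> = l * cosh \<gamma> + m"
        unfolding c\<beta> c\<gamma> l_def m_def using pos by (simp add: divide_simps) (simp add: power2_eq_square algebra_simps)
      have "Z\<^sup>2 = (1 - s)\<^sup>2 * A\<^sup>2 + s\<^sup>2 * B\<^sup>2 + 2 * s * (1 - s) * (1 - u \<bullet> v)"
        unfolding sq s(3) by (simp add: inner_add_left inner_add_right algebra_simps power2_eq_square inner_commute)
      moreover have "l\<^sup>2 + m\<^sup>2 + 2 * l * m * cosh \<gamma> =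
        ((1 - s)\<^sup>2 * A\<^sup>2 + s\<^sup>2 * B\<^sup>2 + 2 * s * (1 - s) * (1 - u \<bullet> v)) / Z\<^sup>2"
        unfolding c\<gamma> l_def m_def using pos by (simp add: field_simps power2_eq_square)
      ultimately show "l\<^sup>2 + m\<^sup>2 + 2 * l * m * cosh \<gamma> = 1"
        using pos(3) by (metis divide_self less_numeral_extra(3) zero_less_power)
    qed
  next
    assume eq: "\<alpha> + \<beta> = \<gamma>"
    show "w \<in> closed_segment u v"
    proof (cases "\<gamma> = 0")
      case True
      then have "\<alpha> = 0" using eq nn by simp
      then have "a = z" using hdist_eq_0D assms unfolding \<alpha>_def by blast
      then show ?thesis by (simp add: u_def w_def)
    next
      case False
      then have sg: "sinh \<gamma> > 0" using nn by simp
      define l m where "l = sinh \<beta> / sinh \<gamma>" and "m = sinh \<alpha> / sinh \<gamma>"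
      have lm: "0 \<le> l" "0 \<le> m" using nn sg by (auto simp: l_def m_def)
      have n: "l\<^sup>2 + m\<^sup>2 + 2 * l * m * cosh \<gamma> = 1"
      proof -
        have "(sinh \<gamma>)\<^sup>2 = (sinh \<beta>)\<^sup>2 + (sinh \<alpha>)\<^sup>2 + 2 * sinh \<beta> * sinh \<alpha> * cosh \<gamma>"
        proof -
          have "(sinh \<gamma>)\<^sup>2 = (sinh \<alpha>)\<^sup>2 * (cosh \<beta>)\<^sup>2 + (cosh \<alpha>)\<^sup>2 * (sinh \<beta>)\<^sup>2 + 2 * sinh \<alpha> * sinh \<beta> * cosh \<alpha> * cosh \<beta>"
            unfolding eq[symmetric] sinh_add by (simp add: power2_eq_square algebra_simps)
          then show ?thesis unfolding eq[symmetric] cosh_add cosh_square_eq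
            by (simp add: power2_eq_square algebra_simps)
        qed
        moreover have "l\<^sup>2 + m\<^sup>2 + 2 * l * m * cosh \<gamma> = ((sinh \<beta>)\<^sup>2 + (sinh \<alpha>)\<^sup>2 + 2 * sinh \<beta> * sinh \<alpha> * cosh \<gamma>) / (sinh \<gamma>)\<^sup>2"
          unfolding l_def m_def using sg by (simp add: field_simps power2_eq_square)
        ultimately show ?thesis using sg by (metis divide_self less_numeral_extra(3) zero_less_power)
      qed
      have "l > 0 \<or> m > 0"
        using lm n by (cases "l = 0"; cases "m = 0") auto
      then have T: "l / A + m / B > 0" using lm pos
        by (metis add_nonneg_pos add_pos_nonneg divide_nonneg_pos divide_pos_pos)
      define t where "t = l / A + m / B"
      have t: "t > 0" "l / A = t - m / B" using T by (auto simp: t_def)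
      define s where "s = (m / B) / t"
      have s1: "1 - s = (l / A) / t" using t by (simp add: s_def diff_divide_distrib)
      have "0 \<le> (l / A) / t" "0 \<le> (m / B) / t" using t(1) lm pos by simp_all
      then have s: "0 \<le> s" "s \<le> 1" unfolding s1[symmetric] by (auto simp: s_def)
      \<comment> \<open>The Klein point of the combination \<open>l A + m B\<close>, whose height on
        the hyperboloid is \<open>t\<close>. The Minkowski product of its lift with the lift of
        \<open>w\<close> comes out as 1, and equality in the reversed Cauchy-Schwarz inequality then
        gives \<open>w = x\<close>.\<close>
      define x where "x = (1 - s) *\<^sub>R u + s *\<^sub>R v"
      have xseg: "x \<in> closed_segment u v" using s by (auto simp: x_def closed_segment_def)
      have st: "s * t = m / B" "(1 - s) * t = l / A" using t(1) unfolding s1 by (auto simp: s_def)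
      have "t\<^sup>2 * (1 - x \<bullet> x) = ((1 - s) * t)\<^sup>2 * (1 - u \<bullet> u) + (s * t)\<^sup>2 * (1 - v \<bullet> v) + 2 * (s * t) * ((1 - s) * t) * (1 - u \<bullet> v)"
        unfolding x_def by (simp add: inner_add_left inner_add_right algebra_simps power2_eq_square inner_commute)
      also have "\<dots> = l\<^sup>2 + m\<^sup>2 + 2 * l * m * cosh \<gamma>"
        unfolding st sq[symmetric] c\<gamma> using pos by (simp add: power_divide mult.commute)
      finally have tx: "t\<^sup>2 * (1 - x \<bullet> x) = 1" using n by simp
      then have "0 < 1 - x \<bullet> x"
        by (metis zero_less_mult_iff zero_less_one not_less zero_le_power2)
      then have x1: "cmod x < 1" by (simp add: dot_square_norm abs_square_less_1)
      have "t * (1 - w \<bullet> x) / Z = ((1 - s) * t) * (1 - u \<bullet> w) / Z + (s * t) * (1 - w \<bullet> v) / Z"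
      proof -
        have e: "1 - w \<bullet> x = (1 - s) * (1 - u \<bullet> w) + s * (1 - w \<bullet> v)"
          unfolding x_def by (simp add: inner_add_right inner_commute algebra_simps)
        have "t * (1 - w \<bullet> x) = ((1 - s) * t) * (1 - u \<bullet> w) + (s * t) * (1 - w \<bullet> v)"
          unfolding e by (simp add: algebra_simps)
        then show ?thesis by (simp only: add_divide_distrib)
      qed
      also have "\<dots> = l * cosh \<alpha> + m * cosh \<beta>"
        unfolding st c\<alpha> c\<beta> by (simp add: mult.commute)
      also have "\<dots> = (sinh \<alpha> * cosh \<beta> + cosh \<alpha> * sinh \<beta>) / sinh \<gamma>"
        by (simp add: l_def m_def add_divide_distrib)
      also have "\<dots> = 1" unfolding sinh_add[symmetric] eq using sg by simp
      finally have "t * (1 - w \<bullet> x) = Z" using pos by (simp add: field_simps)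
      then have "t\<^sup>2 * (1 - w \<bullet> x)\<^sup>2 = Z\<^sup>2 * (t\<^sup>2 * (1 - x \<bullet> x))" using tx
        by (metis mult.right_neutral power_mult_distrib)
      then have "(1 - w \<bullet> x)\<^sup>2 = (1 - (cmod w)\<^sup>2) * (1 - (cmod x)\<^sup>2)"
        using t(1) unfolding sq by (simp add: dot_square_norm)
      then have "w = x" using klein_form_eq_imp_eq lt x1 by blast
      then show ?thesis using xseg by simp
    qed
  qed
qed

section \<open>Convex hulls and area in the Klein model centred at a given point\<close>

definition kmap :: "complex \<Rightarrow> complex \<Rightarrow> complex" where
  "kmap c z = klein (mob c z)"

text \<open>The hyperbolic area density of the Klein disk.\<close>

definition kdens :: "complex \<Rightarrow> real" where
  "kdens w = 1 / sqrt (1 - (cmod w)\<^sup>2) ^ 3"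

lemma kdens_measurable [measurable]: "kdens \<in> borel_measurable borel"
  unfolding kdens_def by measurable

lemma kdens_absolutely_integrable:
  assumes "compact S" "S \<subseteq> ball 0 1" shows "kdens absolutely_integrable_on S"
proof -
  have "continuous_on S kdens"
    unfolding kdens_def using assms(2)
    by (intro continuous_intros) (fastforce simp: abs_square_eq_1 dest: less_imp_neq)
  then have "set_integrable lborel S kdens"
    unfolding set_integrable_def by (rule borel_integrable_compact[OF assms(1)])
  moreover have "(\<lambda>w. indicator S w *\<^sub>R kdens w) \<in> borel_measurable borel"
    using borel_compact[OF assms(1)] by measurable
  ultimately show ?thesis
    unfolding set_integrable_def by (simp add: integrable_completion)
qed

lemma bij_betw_kmap:
  assumes "c \<in> hyp_plane" shows "bij_betw (kmap c) hyp_plane (ball 0 1)"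
proof (rule bij_betw_byWitness[where f' = "mob (-c) \<circ> klein_inv"])
  have c: "cmod c < 1" "cmod (-c) < 1" using assms by (auto simp: hyp_plane_def)
  show "\<forall>z\<in>hyp_plane. (mob (-c) \<circ> klein_inv) (kmap c z) = z"
    using c mob_mob_minus[of "-c"] by (auto simp: kmap_def hyp_plane_def klein_inv_klein mob_norm_less)
  show "\<forall>w\<in>ball 0 1. kmap c ((mob (-c) \<circ> klein_inv) w) = w"
    using c by (auto simp: kmap_def mob_mob_minus klein_klein_inv)
  show "kmap c ` hyp_plane \<subseteq> ball 0 1"
    using c by (auto simp: kmap_def hyp_plane_def klein_norm_less mob_norm_less)
  show "(mob (-c) \<circ> klein_inv) ` ball 0 1 \<subseteq> hyp_plane"
    using c by (auto simp: hyp_plane_def mob_norm_less klein_klein_inv)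
qed

lemma hdist_mob:
  assumes "c \<in> hyp_plane" "z \<in> hyp_plane" "w \<in> hyp_plane"
  shows "hdist (mob c z) (mob c w) = hdist z w"
  using norm_mob_mob assms by (simp add: hdist_def hyp_plane_def)

lemma cosh_hdist_kmap:
  assumes "c \<in> hyp_plane" "z \<in> hyp_plane" "w \<in> hyp_plane"
  shows "cosh (hdist z w) = (1 - kmap c z \<bullet> kmap c w) /
    (sqrt (1 - (cmod (kmap c z))\<^sup>2) * sqrt (1 - (cmod (kmap c w))\<^sup>2))"
  using cosh_hdist[of "mob c z" "mob c w"] hdist_mob[OF assms] assms mob_norm_less
  by (simp add: kmap_def hyp_plane_def)

lemma hsegment_kmap:
  assumes "c \<in> hyp_plane" "a \<in> hyp_plane" "b \<in> hyp_plane"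
  shows "hsegment a b = {z \<in> hyp_plane. kmap c z \<in> closed_segment (kmap c a) (kmap c b)}"
proof -
  have "hdist a z + hdist z b = hdist a b \<longleftrightarrow> kmap c z \<in> closed_segment (kmap c a) (kmap c b)"
    if "z \<in> hyp_plane" for z
    using hsegment_klein_iff[of "mob c a" "mob c b" "mob c z"] hdist_mob[OF assms(1)] assms that mob_norm_less
    by (simp add: kmap_def hyp_plane_def)
  then show ?thesis by (auto simp: hsegment_def)
qed

lemma hconvex_kmap_iff:
  assumes c: "c \<in> hyp_plane" and S: "S \<subseteq> hyp_plane"
  shows "hconvex S \<longleftrightarrow> convex (kmap c ` S)"
proof
  assume hc: "hconvex S"
  show "convex (kmap c ` S)"
    unfolding convex_contains_segment
  proof (intro ballI subsetI)
    fix u v w assume "u \<in> kmap c ` S" "v \<in> kmap c ` S" and w: "w \<in> closed_segment u v"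
    then obtain a b where ab: "a \<in> S" "b \<in> S" "u = kmap c a" "v = kmap c b" by auto
    have "u \<in> ball 0 1" "v \<in> ball 0 1"
      using ab S bij_betwE[OF bij_betw_kmap[OF c]] by blast+
    then have "w \<in> ball 0 1"
      using w convex_contains_segment[of "ball (0::complex) 1"] convex_ball by blast
    then obtain z where z: "z \<in> hyp_plane" "w = kmap c z"
      using bij_betw_imp_surj_on[OF bij_betw_kmap[OF c]] by blast
    then have "z \<in> hsegment a b"
      using hsegment_kmap[of c a b] c ab S w by auto
    then show "w \<in> kmap c ` S"
      using hc ab z unfolding hconvex_def by blast
  qed
next
  assume "convex (kmap c ` S)"
  then have "kmap c z \<in> kmap c ` S" if "a \<in> S" "b \<in> S" "z \<in> hsegment a b" for a b z
    using that hsegment_kmap[of c a b] c S unfolding convex_contains_segment by blast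
  moreover have "z \<in> hyp_plane" if "z \<in> hsegment a b" for a b z
    using that by (simp add: hsegment_def)
  ultimately show "hconvex S"
    using S inj_on_image_mem_iff[OF bij_betw_imp_inj_on[OF bij_betw_kmap[OF c]] _ S]
    unfolding hconvex_def by blast
qed

text \<open>\<open>kmap c\<close> is a bijection onto the open disk that preserves convexity in both
  directions, so it commutes with the formation of hulls. From here on polygons are
  Euclidean.\<close>

lemma kmap_hconvex_hull:
  assumes c: "c \<in> hyp_plane" and S: "S \<subseteq> hyp_plane"
  shows "hconvex_hull S = {z \<in> hyp_plane. kmap c z \<in> convex hull (kmap c ` S)}"
    and "kmap c ` hconvex_hull S = convex hull (kmap c ` S)"
proof -
  let ?H = "{z \<in> hyp_plane. kmap c z \<in> convex hull (kmap c ` S)}"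
  have sub: "convex hull (kmap c ` S) \<subseteq> ball 0 1"
    using S bij_betw_kmap[OF c] by (intro hull_minimal convex_ball) (auto simp: bij_betw_def)
  have im: "kmap c ` ?H = convex hull (kmap c ` S)"
  proof
    show "convex hull (kmap c ` S) \<subseteq> kmap c ` ?H"
    proof
      fix w assume w: "w \<in> convex hull (kmap c ` S)"
      then have "w \<in> kmap c ` hyp_plane" using sub bij_betw_kmap[OF c] by (auto simp: bij_betw_def)
      then show "w \<in> kmap c ` ?H" using w by auto
    qed
  qed auto
  have "hconvex_hull S = ?H"
    unfolding hconvex_hull_def
  proof (rule hull_unique)
    show "S \<subseteq> ?H" using S by (auto intro: hull_inc)
    show "hconvex ?H" using hconvex_kmap_iff[OF c, of ?H] im convex_convex_hull by auto
    fix T assume T: "S \<subseteq> T" "hconvex T"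
    then have TH: "T \<subseteq> hyp_plane" by (simp add: hconvex_def)
    then have "convex (kmap c ` T)" using hconvex_kmap_iff[OF c] T by blast
    then have "convex hull (kmap c ` S) \<subseteq> kmap c ` T" using T by (intro hull_minimal) auto
    then show "?H \<subseteq> T"
      using inj_on_image_mem_iff[OF bij_betw_imp_inj_on[OF bij_betw_kmap[OF c]] _ TH] by blast
  qed
  then show "hconvex_hull S = ?H" "kmap c ` hconvex_hull S = convex hull (kmap c ` S)"
    using im by auto
qed

lemma has_derivative_mob:
  assumes "cmod c < 1" "cmod z < 1"
  shows "(mob c has_derivative (\<lambda>v. of_real (1 - (cmod c)\<^sup>2) / (1 - cnj c * z)\<^sup>2 * v)) (at z)"
proof -
  have d: "1 - cnj c * z \<noteq> 0" using mob_denom assms by blast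
  have n: "of_real (1 - (cmod c)\<^sup>2) = 1 - c * cnj c"
    using complex_norm_square[of c] by simp
  have "((\<lambda>z. (z - c) / (1 - cnj c * z)) has_field_derivative
      (1 * (1 - cnj c * z) - (z - c) * (- cnj c)) / ((1 - cnj c * z) * (1 - cnj c * z))) (at z)"
    using d by (intro DERIV_divide) (auto intro!: derivative_eq_intros)
  moreover have "1 * (1 - cnj c * z) - (z - c) * (- cnj c) = of_real (1 - (cmod c)\<^sup>2)"
    unfolding n by (simp add: algebra_simps)
  ultimately have "(mob c has_field_derivative of_real (1 - (cmod c)\<^sup>2) / (1 - cnj c * z)\<^sup>2) (at z)"
    unfolding mob_def by (simp only: power2_eq_square)
  then show ?thesis by (simp only: has_field_derivative_def)
qed

text \<open>The scalar factor depends on the modulus of \<open>z\<close>, so the map is not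
  holomorphic: \<open>2 * (z \<bullet> v) = z * cnj v + cnj z * v\<close> produces the term in
  \<open>cnj v\<close>.\<close>

lemma has_derivative_klein:
  fixes z :: complex
  defines "q \<equiv> (cmod z)\<^sup>2"
  shows "(klein has_derivative (\<lambda>v. of_real (2 / (1 + q)\<^sup>2) * v + (- 2 * z\<^sup>2 / of_real ((1 + q)\<^sup>2)) * cnj v)) (at z)"
proof -
  have q: "1 + q > 0" by (simp add: q_def add_pos_nonneg)
  have D: "((\<lambda>z. (cmod z)\<^sup>2) has_derivative (\<lambda>v. 2 * (z \<bullet> v))) (at z)"
    unfolding power2_norm_eq_inner
    by (auto intro!: derivative_eq_intros simp: inner_commute)
  have "(klein has_derivative (\<lambda>v. (2 / (1 + q)) *\<^sub>R v - (4 * (z \<bullet> v) / (1 + q)\<^sup>2) *\<^sub>R z)) (at z)"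
  proof -
    have "((\<lambda>t::real. 2 / (1 + t)) has_field_derivative (- 2 / (1 + q)\<^sup>2)) (at q)"
      using q by (auto intro!: derivative_eq_intros simp: power2_eq_square)
    then have "((\<lambda>t::real. 2 / (1 + t)) has_derivative (\<lambda>h. - 2 / (1 + q)\<^sup>2 * h)) (at ((cmod z)\<^sup>2))"
      by (simp only: has_field_derivative_def q_def)
    from has_derivative_scaleR[OF has_derivative_compose[OF D this] has_derivative_ident]
    show ?thesis unfolding klein_def by (rule has_derivative_eq_rhs) (simp add: q_def fun_eq_iff)
  qed
  then show ?thesis
  proof (rule has_derivative_eq_rhs, intro ext)
    fix v
    show "(2 / (1 + q)) *\<^sub>R v - (4 * (z \<bullet> v) / (1 + q)\<^sup>2) *\<^sub>R z =
      of_real (2 / (1 + q)\<^sup>2) * v + (- 2 * z\<^sup>2 / of_real ((1 + q)\<^sup>2)) * cnj v"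
    proof -
    have zv: "of_real (2 * (z \<bullet> v)) = z * cnj v + cnj z * v"
      by (auto simp: complex_eq_iff inner_complex_def algebra_simps)
    have zz: "z * cnj z = of_real q" unfolding q_def by (rule complex_norm_square[symmetric])
    have "(2 / (1 + q)) *\<^sub>R v - (4 * (z \<bullet> v) / (1 + q)\<^sup>2) *\<^sub>R z =
      (2 * of_real (1 + q) * v - 2 * (z * cnj v + cnj z * v) * z) / of_real ((1 + q)\<^sup>2)"
      unfolding zv[symmetric] using q
      by (simp add: scaleR_conv_of_real) (simp add: divide_simps power2_eq_square)
    also have "2 * of_real (1 + q) * v - 2 * (z * cnj v + cnj z * v) * z = 2 * v - 2 * z\<^sup>2 * cnj v"
      using zz by (simp add: algebra_simps power2_eq_square flip: zz)
    finally show ?thesis by (simp add: diff_divide_distrib)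
    qed
  qed
qed

lemma harea_eq_integral_kmap:
  assumes c: "c \<in> hyp_plane" and A: "A \<subseteq> hyp_plane" "compact (kmap c ` A)"
  shows "harea A = integral (kmap c ` A) kdens"
proof -
  have c1: "cmod c < 1" using c by (simp add: hyp_plane_def)
  \<comment> \<open>Chain rule: the derivative of \<open>mob c\<close> is multiplication by a
    complex number, which enters the coefficient of \<open>cnj v\<close> through its
    conjugate.\<close>
  define a where "a z = of_real (2 / (1 + (cmod (mob c z))\<^sup>2)\<^sup>2) * (of_real (1 - (cmod c)\<^sup>2) / (1 - cnj c * z)\<^sup>2)" for z
  define b where "b z = (- 2 * (mob c z)\<^sup>2 / of_real ((1 + (cmod (mob c z))\<^sup>2)\<^sup>2)) * cnj (of_real (1 - (cmod c)\<^sup>2) / (1 - cnj c * z)\<^sup>2)" for z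
  have der: "(kmap c has_derivative (\<lambda>v. a z * v + b z * cnj v)) (at z)" if "z \<in> hyp_plane" for z
  proof -
    have "((\<lambda>z. klein (mob c z)) has_derivative (\<lambda>v. a z * v + b z * cnj v)) (at z)"
      using has_derivative_compose[OF has_derivative_mob[of c z] has_derivative_klein] c1 that
      by (simp only: hyp_plane_def a_def b_def mult.assoc complex_cnj_mult mem_Collect_eq)
    then show ?thesis unfolding kmap_def .
  qed
  have cont: "continuous_on hyp_plane (kmap c)"
    using der has_derivative_continuous by (blast intro: continuous_at_imp_continuous_on)
  have "open hyp_plane" unfolding hyp_plane_def by (intro open_Collect_less continuous_intros)
  \<comment> \<open>By injectivity \<open>A\<close> is the whole preimage of a compact set, hence
    closed in the disk; this is where its measurability comes from.\<close>
  have Aeq: "A = hyp_plane \<inter> kmap c -` (kmap c ` A)"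
    using A bij_betw_kmap[OF c] unfolding bij_betw_def inj_on_def by blast
  have "closedin (top_of_set hyp_plane) A"
    using continuous_closedin_preimage[OF cont compact_imp_closed[OF A(2)]] Aeq by simp
  then have SA: "A \<in> sets borel"
    using \<open>open hyp_plane\<close> by (auto simp: closedin_closed)
  have gA: "kmap c ` A \<in> sets borel" using A(2) by (simp add: borel_compact)
  have "kmap c ` A \<subseteq> ball 0 1"
    using A bij_betwE[OF bij_betw_kmap[OF c]] by blast
  then have int: "kdens absolutely_integrable_on (kmap c ` A)"
    by (rule kdens_absolutely_integrable[OF A(2)])
  have J: "4 / (1 - (cmod z)\<^sup>2)\<^sup>2 = \<bar>(cmod (a z))\<^sup>2 - (cmod (b z))\<^sup>2\<bar> * kdens (kmap c z)"
    if "z \<in> A" for z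
  proof -
    have z1: "cmod z < 1" using subsetD[OF A(1) that] by (simp add: hyp_plane_def)
    define q where "q = (cmod (mob c z))\<^sup>2"
    have q: "0 \<le> q" "q < 1" unfolding q_def using mob_norm_less[OF c1 z1] by (auto simp: abs_square_less_1)
    define M where "M = (1 - (cmod c)\<^sup>2) / (cmod (1 - cnj c * z))\<^sup>2"
    have cc: "(cmod c)\<^sup>2 < 1" "(cmod z)\<^sup>2 < 1" using c1 z1 by (auto simp: abs_square_less_1)
    have M: "M > 0" unfolding M_def using cc mob_denom[OF c1 z1] by simp
    have cm: "cmod (of_real (1 - (cmod c)\<^sup>2) / (1 - cnj c * z)\<^sup>2) = M"
      unfolding M_def norm_divide norm_power norm_of_real using cc by simp
    have "(cmod (a z))\<^sup>2 = (2 / (1 + q)\<^sup>2 * M)\<^sup>2"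
      unfolding a_def norm_mult cm norm_of_real q_def by simp
    moreover have "(cmod (b z))\<^sup>2 = (2 * q / (1 + q)\<^sup>2 * M)\<^sup>2"
      unfolding b_def norm_mult complex_mod_cnj cm unfolding norm_divide norm_of_real q_def by (simp add: norm_power)
    ultimately have "(cmod (a z))\<^sup>2 - (cmod (b z))\<^sup>2 = (2 / (1 + q)\<^sup>2 * M)\<^sup>2 - (2 * q / (1 + q)\<^sup>2 * M)\<^sup>2"
      by simp
    also have "\<dots> = 4 * M\<^sup>2 * (1 - q\<^sup>2) / (1 + q)^4"
      by (simp add: power_mult_distrib power_divide flip: power_mult diff_divide_distrib)
         (simp add: algebra_simps)
    also have "\<dots> = 4 * M\<^sup>2 * ((1 - q) * (1 + q)) / ((1 + q) * (1 + q)^3)"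
      by (simp add: power2_eq_square algebra_simps numeral_eq_Suc)
    also have "\<dots> = 4 * M\<^sup>2 * (1 - q) / (1 + q)^3"
      using q by simp
    finally have det: "\<bar>(cmod (a z))\<^sup>2 - (cmod (b z))\<^sup>2\<bar> = 4 * M\<^sup>2 * (1 - q) / (1 + q)^3"
      using q M by simp
    have kd: "kdens (kmap c z) = (1 + q)^3 / (1 - q)^3"
      unfolding kdens_def kmap_def sqrt_one_minus_klein[OF mob_norm_less[OF c1 z1]] q_def
      by (simp add: power_divide)
    \<comment> \<open>\<open>M\<close> is the modulus of the derivative of \<open>mob c\<close> at
      \<open>z\<close>, so this is the infinitesimal form of \<open>mob c\<close> being an isometry.
      It reduces the claim to a computation at the point \<open>mob c z\<close>.\<close>
    have "1 - q = M * (1 - (cmod z)\<^sup>2)" unfolding q_def M_def one_minus_mob[OF c1 z1] by simp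
    then have "4 / (1 - (cmod z)\<^sup>2)\<^sup>2 = 4 * M\<^sup>2 / (1 - q)\<^sup>2"
      using M by (simp add: power_mult_distrib)
    also have "\<dots> = 4 * M\<^sup>2 * (1 - q) / (1 + q)^3 * ((1 + q)^3 / (1 - q)^3)"
      using q by (simp add: divide_simps) (simp add: power2_eq_square numeral_eq_Suc)
    finally show ?thesis unfolding det kd .
  qed
  have "(LINT z:A|lebesgue. 4 / (1 - (cmod z)\<^sup>2)\<^sup>2) = integral (kmap c ` A) kdens"
  proof (rule complex_change_of_variables(2)[OF SA gA _ _ _ _ J int])
    show "\<And>z. z \<in> A \<Longrightarrow> (kmap c has_derivative (\<lambda>v. a z * v + b z * cnj v)) (at z)"
      using der A by blast
    show "inj_on (kmap c) A"
      using bij_betw_kmap[OF c] A by (meson bij_betw_def inj_on_subset)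
  qed measurable
  then show ?thesis by (simp add: harea_def)
qed

lemma harea_hconvex_hull:
  assumes "c \<in> hyp_plane" "S \<subseteq> hyp_plane" "finite S"
  shows "harea (hconvex_hull S) = integral (convex hull (kmap c ` S)) kdens"
proof -
  have "compact (kmap c ` hconvex_hull S)"
    unfolding kmap_hconvex_hull(2)[OF assms(1,2)] using assms(3) by (simp add: finite_imp_compact_convex_hull)
  moreover have "hconvex_hull S \<subseteq> hyp_plane" using kmap_hconvex_hull(1)[OF assms(1,2)] by auto
  ultimately show ?thesis
    using harea_eq_integral_kmap[OF assms(1)] kmap_hconvex_hull(2)[OF assms(1,2)] by metis
qed

section \<open>Area of a circular cap\<close>

text \<open>The part of the disk of radius \<open>R\<close> beyond a chord of half angle \<theta>
  whose arc is centred in direction \<mu>. For \<open>\<theta> > pi / 2\<close> it is the larger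
  part; such a \<theta> occurs when the circumcentre lies outside the polygon.\<close>

definition kcap :: "real \<Rightarrow> real \<Rightarrow> real \<Rightarrow> complex set" where
  "kcap R \<mu> \<theta> = {w. cmod w \<le> R \<and> R * cos \<theta> \<le> Re (cis (-\<mu>) * w)}"

text \<open>With \<open>cosh r = 1 / sqrt (1 - R\<^sup>2)\<close> and
  \<open>\<theta> < pi / 2\<close> this is the sector area
  \<open>2 * \<theta> * (cosh r - 1)\<close> minus the area of an isosceles triangle; the argument
  of \<open>arccos\<close> is the sine of the base angle of that triangle.\<close>

definition cap_area :: "real \<Rightarrow> real \<Rightarrow> real" where
  "cap_area R \<theta> = 2 * \<theta> / sqrt (1 - R\<^sup>2)
     - 2 * arccos (sqrt (1 - R\<^sup>2) * cos \<theta> / sqrt (1 - R\<^sup>2 * (cos \<theta>)\<^sup>2))"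

lemma distr_Complex: "distr (lborel \<Otimes>\<^sub>M lborel) borel (\<lambda>p. Complex (fst p) (snd p)) = lborel"
proof (rule lborel_eqI[symmetric])
  have [measurable]: "(\<lambda>p. Complex (fst p) (snd p)) \<in> borel_measurable (lborel \<Otimes>\<^sub>M lborel)"
    unfolding Complex_eq by measurable
  fix l u :: complex
  assume lu: "\<And>b. b \<in> Basis \<Longrightarrow> l \<bullet> b \<le> u \<bullet> b"
  have "(\<lambda>p. Complex (fst p) (snd p)) -` box l u \<inter> space (lborel \<Otimes>\<^sub>M lborel) = box (Re l) (Re u) \<times> box (Im l) (Im u)"
    by (auto simp: mem_box Basis_complex_def space_pair_measure)
  then show "emeasure (distr (lborel \<Otimes>\<^sub>M lborel) borel (\<lambda>p. Complex (fst p) (snd p))) (box l u) = ennreal (\<Prod>b\<in>Basis. (u - l) \<bullet> b)"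
    using lu[of 1] lu[of \<i>]
    by (subst emeasure_distr) (auto simp: lborel.emeasure_pair_measure_Times Basis_complex_def ennreal_mult)
qed auto

lemma slice_has_integral:
  assumes x: "x\<^sup>2 \<le> R\<^sup>2" and R: "0 < R" "R < 1"
  shows "((\<lambda>y. 1 / sqrt (1 - x\<^sup>2 - y\<^sup>2) ^ 3) has_integral
     2 * sqrt (R\<^sup>2 - x\<^sup>2) / ((1 - x\<^sup>2) * sqrt (1 - R\<^sup>2))) {- sqrt (R\<^sup>2 - x\<^sup>2)..sqrt (R\<^sup>2 - x\<^sup>2)}"
proof -
  define P Y where "P = 1 - x\<^sup>2" and "Y = sqrt (R\<^sup>2 - x\<^sup>2)"
  have R2: "R\<^sup>2 < 1" using R by (simp add: abs_square_less_1)
  then have P: "P > 0" using x by (simp add: P_def)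
  have Y: "Y \<ge> 0" "Y\<^sup>2 = R\<^sup>2 - x\<^sup>2" using x by (auto simp: Y_def)
  have PY: "P - Y\<^sup>2 = 1 - R\<^sup>2" unfolding P_def Y by simp
  \<comment> \<open>An antiderivative of \<open>(P - y^2)^(-3/2)\<close>. At the ends of the slice
    \<open>P - y^2\<close> equals \<open>1 - R^2\<close> whatever \<open>x\<close> is, which keeps
    the value simple.\<close>
  define F where "F y = y / (P * sqrt (P - y\<^sup>2))" for y
  have "((\<lambda>y. 1 / sqrt (P - y\<^sup>2) ^ 3) has_integral F Y - F (-Y)) {-Y..Y}"
  proof (rule fundamental_theorem_of_calculus)
    fix y assume "y \<in> {-Y..Y}"
    then have "y\<^sup>2 \<le> Y\<^sup>2" using abs_le_square_iff[of y Y] by auto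
    then have pos: "P - y\<^sup>2 > 0" using PY R2 by linarith
    define r where "r = sqrt (P - y\<^sup>2)"
    have r: "r > 0" "r\<^sup>2 = P - y\<^sup>2" using pos by (auto simp: r_def)
    have "(F has_real_derivative (1 * (P * r) - y * (P * ((- 2 * y) / (2 * r)))) / ((P * r) * (P * r))) (at y)"
      unfolding F_def r_def
      by (intro DERIV_divide) (use pos P in \<open>auto intro!: derivative_eq_intros simp: divide_simps\<close>)
    also have "(1 * (P * r) - y * (P * ((- 2 * y) / (2 * r)))) / ((P * r) * (P * r)) = (r\<^sup>2 + y\<^sup>2) / (P * r ^ 3)"
      using r(1) P by (simp add: divide_simps) (simp add: algebra_simps power2_eq_square power3_eq_cube)
    also have "\<dots> = 1 / r ^ 3" using P r by simp
    finally show "(F has_vector_derivative 1 / sqrt (P - y\<^sup>2) ^ 3) (at y within {-Y..Y})"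
      unfolding r_def has_real_derivative_iff_has_vector_derivative
      by (rule has_vector_derivative_at_within)
  qed (use Y in auto)
  moreover have "F Y - F (-Y) = 2 * Y / (P * sqrt (1 - R\<^sup>2))"
    using PY by (simp add: F_def)
  ultimately show ?thesis by (simp add: P_def Y_def)
qed

lemma cap_profile_has_integral:
  assumes R: "0 < R" "R < 1" and \<theta>: "0 \<le> \<theta>" "\<theta> \<le> pi"
  shows "((\<lambda>x. 2 * sqrt (R\<^sup>2 - x\<^sup>2) / ((1 - x\<^sup>2) * sqrt (1 - R\<^sup>2))) has_integral cap_area R \<theta>) {R * cos \<theta>..R}"
proof -
  define s where "s = sqrt (1 - R\<^sup>2)"
  have R2: "R\<^sup>2 < 1" using R by (simp add: abs_square_less_1)
  then have s: "s > 0" "s\<^sup>2 = 1 - R\<^sup>2" by (auto simp: s_def)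
  define G where "G x = 2 * arccos ((s / R) * x / sqrt (1 - x\<^sup>2)) - 2 * arccos (x / R) / s" for x
  have key: "1 - ((s / R) * x / sqrt (1 - x\<^sup>2))\<^sup>2 = (R\<^sup>2 - x\<^sup>2) / (R\<^sup>2 * (1 - x\<^sup>2))" if "x\<^sup>2 < 1" for x
  proof -
    have e: "((s / R) * x / sqrt (1 - x\<^sup>2))\<^sup>2 = (1 - R\<^sup>2) * x\<^sup>2 / (R\<^sup>2 * (1 - x\<^sup>2))"
      unfolding s(2)[symmetric] using that by (simp add: power_mult_distrib power_divide)
    show ?thesis unfolding e using that R by (simp add: divide_simps) (simp add: algebra_simps)
  qed
  have xR: "x\<^sup>2 \<le> R\<^sup>2" if "x \<in> {-R..R}" for x
    using that abs_le_square_iff[of x R] R by auto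
  have rng: "\<bar>(s / R) * x / sqrt (1 - x\<^sup>2)\<bar> \<le> 1" if "x \<in> {-R..R}" for x
  proof -
    have "x\<^sup>2 < 1" "x\<^sup>2 \<le> R\<^sup>2" using xR[OF that] R2 by auto
    then have "0 \<le> 1 - ((s / R) * x / sqrt (1 - x\<^sup>2))\<^sup>2" unfolding key[OF \<open>x\<^sup>2 < 1\<close>] by simp
    then show ?thesis using abs_square_le_1 by force
  qed
  have h: "R * cos \<theta> \<in> {-R..R}"
    using R mult_left_mono[OF cos_le_one[of \<theta>], of R] mult_left_mono[OF cos_ge_minus_one[of \<theta>], of R] by simp
  have sub: "{R * cos \<theta>..R} \<subseteq> {-R..R}" using h by auto
  \<comment> \<open>Both arguments of \<open>arccos\<close> in \<open>G\<close> reach 1 in absolute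
    value at \<open>x = R\<close> and \<open>x = - R\<close>, where \<open>arccos\<close> is only
    continuous. Hence the version of the fundamental theorem that asks for derivatives in the
    interior only.\<close>
  have "((\<lambda>x. 2 * sqrt (R\<^sup>2 - x\<^sup>2) / ((1 - x\<^sup>2) * s)) has_integral G R - G (R * cos \<theta>)) {R * cos \<theta>..R}"
  proof (rule fundamental_theorem_of_calculus_interior)
    show "R * cos \<theta> \<le> R" using h by auto
    have nz: "1 - x\<^sup>2 > 0" if "x \<in> {R * cos \<theta>..R}" for x
      using xR that sub R2 by fastforce
    show "continuous_on {R * cos \<theta>..R} G"
      unfolding G_def
    proof (intro continuous_intros ballI conjI)
      fix x assume x: "x \<in> {R * cos \<theta>..R}"
      then have x': "x \<in> {-R..R}" using sub by blast
      show "- 1 \<le> s / R * x / sqrt (1 - x\<^sup>2)" "s / R * x / sqrt (1 - x\<^sup>2) \<le> 1"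
        using rng[OF x'] unfolding abs_le_iff by linarith+
      show "- 1 \<le> x / R" "x / R \<le> 1" using x' R by (auto simp: divide_simps)
      show "sqrt (1 - x\<^sup>2) \<noteq> 0" using nz[OF x] by simp
    qed (use R s in auto)
    fix x assume x: "x \<in> {R * cos \<theta><..<R}"
    then have xlt: "\<bar>x\<bar> < R" using h by auto
    then have x2: "x\<^sup>2 < R\<^sup>2" using R by (metis abs_less_iff abs_of_pos power2_abs power_strict_mono abs_ge_zero zero_less_numeral)
    then have x1: "x\<^sup>2 < 1" using R2 by simp
    define q where "q = sqrt (1 - x\<^sup>2)"
    have q: "q > 0" "q\<^sup>2 = 1 - x\<^sup>2" using x1 by (auto simp: q_def)
    define Y where "Y = sqrt (R\<^sup>2 - x\<^sup>2)"
    have Y: "Y > 0" "Y\<^sup>2 = R\<^sup>2 - x\<^sup>2" using x2 by (auto simp: Y_def)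
    have d1: "((\<lambda>x. (s / R) * x / sqrt (1 - x\<^sup>2)) has_real_derivative (s / R) / q ^ 3) (at x)"
    proof -
      have "((\<lambda>x. (s / R) * x / sqrt (1 - x\<^sup>2)) has_real_derivative ((s / R) * q - (s / R) * x * ((- 2 * x) / (2 * q))) / (q * q)) (at x)"
        unfolding q_def
        by (intro DERIV_divide) (use x1 R in \<open>auto intro!: derivative_eq_intros simp: divide_simps\<close>)
      also have "((s / R) * q - (s / R) * x * ((- 2 * x) / (2 * q))) / (q * q) = (s / R) * ((q\<^sup>2 + x\<^sup>2) / q ^ 3)"
        using q(1) R by (simp add: divide_simps) (simp add: algebra_simps power2_eq_square power3_eq_cube)
      finally show ?thesis using q by simp
    qed
    have u: "1 - ((s / R) * x / sqrt (1 - x\<^sup>2))\<^sup>2 = (Y / (R * q))\<^sup>2"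
      unfolding key[OF x1] using Y q by (simp add: power_divide power_mult_distrib)
    then have "((s / R) * x / sqrt (1 - x\<^sup>2))\<^sup>2 < 1"
      using Y q R by (smt (verit) divide_pos_pos mult_pos_pos zero_less_power)
    then have b: "\<bar>(s / R) * x / sqrt (1 - x\<^sup>2)\<bar> < 1" by (simp only: abs_square_less_1)
    have v: "1 - (x / R)\<^sup>2 = (Y / R)\<^sup>2" using Y R by (simp add: power_divide diff_divide_distrib)
    have b2: "\<bar>x / R\<bar> < 1" using xlt R by (simp add: abs_divide)
    have e1: "((\<lambda>x. arccos ((s / R) * x / sqrt (1 - x\<^sup>2))) has_real_derivative
        inverse (- sqrt (1 - ((s / R) * x / sqrt (1 - x\<^sup>2))\<^sup>2)) * ((s / R) / q ^ 3)) (at x)"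
      using b unfolding abs_less_iff by (intro DERIV_chain2[OF DERIV_arccos d1]) linarith+
    have e2: "((\<lambda>x. arccos (x / R)) has_real_derivative inverse (- sqrt (1 - (x / R)\<^sup>2)) * (1 / R)) (at x)"
      using b2 R unfolding abs_less_iff by (intro DERIV_chain2[OF DERIV_arccos]) (auto intro!: derivative_eq_intros)
    have "(G has_real_derivative 2 * (inverse (- (Y / (R * q))) * ((s / R) / q ^ 3)) - 2 * (inverse (- (Y / R)) * (1 / R)) / s) (at x)"
      unfolding G_def
      using DERIV_diff[OF DERIV_cmult[OF e1, of 2] DERIV_cdivide[OF DERIV_cmult[OF e2, of 2], of s]]
      unfolding u v using Y q R by simp
    also have "2 * (inverse (- (Y / (R * q))) * ((s / R) / q ^ 3)) - 2 * (inverse (- (Y / R)) * (1 / R)) / s =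
        2 * (q\<^sup>2 - s\<^sup>2) / (Y * q\<^sup>2 * s)"
      using Y(1) q(1) R s(1) by (simp add: divide_simps) (simp add: algebra_simps power2_eq_square power3_eq_cube)
    also have "q\<^sup>2 - s\<^sup>2 = Y * Y" using q s Y by (simp add: power2_eq_square)
    also have "2 * (Y * Y) / (Y * q\<^sup>2 * s) = 2 * Y / ((1 - x\<^sup>2) * s)"
      using Y(1) q by simp
    finally show "(G has_vector_derivative 2 * sqrt (R\<^sup>2 - x\<^sup>2) / ((1 - x\<^sup>2) * s)) (at x)"
      unfolding has_real_derivative_iff_has_vector_derivative Y_def .
  qed
  moreover have "G R = 0" using R s by (simp add: G_def s_def)
  moreover have "G (R * cos \<theta>) = - cap_area R \<theta>"
    unfolding G_def cap_area_def using R \<theta> by (simp add: power_mult_distrib s_def arccos_cos)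
  ultimately show ?thesis by (simp add: s_def)
qed

lemma closed_kcap: "closed (kcap R \<mu> \<theta>)"
  unfolding kcap_def by (intro closed_Collect_conj closed_Collect_le continuous_intros)

text \<open>The density is nonnegative on the cap, so Tonelli over vertical slices yields
  integrability together with the value.\<close>

lemma kcap_0_has_integral:
  assumes R: "0 < R" "R < 1" and \<theta>: "0 \<le> \<theta>" "\<theta> \<le> pi"
  shows "(kdens has_integral cap_area R \<theta>) (kcap R 0 \<theta>)"
proof -
  let ?E = "kcap R 0 \<theta>"
  define f where "f w = indicator ?E w * kdens w" for w
  have R2: "R\<^sup>2 < 1" using R by (simp add: abs_square_less_1)
  have [measurable]: "?E \<in> sets borel" using closed_kcap by (simp add: borel_closed)
  have [measurable]: "f \<in> borel_measurable borel" unfolding f_def by measurable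
  have [measurable]: "(\<lambda>p. Complex (fst p) (snd p)) \<in> borel_measurable (lborel \<Otimes>\<^sub>M lborel)"
    unfolding Complex_eq by measurable
  have f0: "0 \<le> f w" for w
  proof (cases "w \<in> ?E")
    case True
    then have "(cmod w)\<^sup>2 \<le> R\<^sup>2" using R by (auto simp: kcap_def power_mono)
    then show ?thesis using R2 by (simp add: f_def kdens_def)
  qed (simp add: f_def)
  have h: "- R \<le> R * cos \<theta>" using R mult_left_mono[OF cos_ge_minus_one[of \<theta>], of R] by simp
  have slice: "(\<integral>\<^sup>+y. f (Complex x y) \<partial>lborel) =
     ennreal (indicator {R * cos \<theta>..R} x * (2 * sqrt (R\<^sup>2 - x\<^sup>2) / ((1 - x\<^sup>2) * sqrt (1 - R\<^sup>2))))" for x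
  proof (cases "x \<in> {R * cos \<theta>..R}")
    case True
    then have "\<bar>x\<bar> \<le> R" using h by auto
    then have x2: "x\<^sup>2 \<le> R\<^sup>2" using R by (metis abs_le_square_iff abs_of_pos)
    define Y where "Y = sqrt (R\<^sup>2 - x\<^sup>2)"
    have mem: "Complex x y \<in> ?E \<longleftrightarrow> y \<in> {-Y..Y}" for y
    proof -
      have "cmod (Complex x y) \<le> R \<longleftrightarrow> x\<^sup>2 + y\<^sup>2 \<le> R\<^sup>2"
        using R by (simp add: complex_norm real_sqrt_le_iff' real_le_lsqrt)
      also have "\<dots> \<longleftrightarrow> y\<^sup>2 \<le> Y\<^sup>2" using x2 by (auto simp: Y_def)
      also have "\<dots> \<longleftrightarrow> \<bar>y\<bar> \<le> Y" using abs_le_square_iff[of y Y] x2 by (simp add: Y_def)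
      finally show ?thesis using True by (auto simp: kcap_def)
    qed
    have "(\<integral>\<^sup>+y. f (Complex x y) \<partial>lborel) = (\<integral>\<^sup>+y. ennreal (indicator {-Y..Y} y * (1 / sqrt (1 - x\<^sup>2 - y\<^sup>2) ^ 3)) \<partial>lborel)"
      by (intro nn_integral_cong) (auto simp: f_def mem kdens_def indicator_def cmod_power2 algebra_simps)
    also have "\<dots> = ennreal (2 * sqrt (R\<^sup>2 - x\<^sup>2) / ((1 - x\<^sup>2) * sqrt (1 - R\<^sup>2)))"
    proof (rule nn_integral_has_integral_lebesgue)
      show "((\<lambda>y. 1 / sqrt (1 - x\<^sup>2 - y\<^sup>2) ^ 3) has_integral 2 * sqrt (R\<^sup>2 - x\<^sup>2) / ((1 - x\<^sup>2) * sqrt (1 - R\<^sup>2))) {-Y..Y}"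
        unfolding Y_def by (rule slice_has_integral[OF x2 R])
      fix y assume "y \<in> {-Y..Y}"
      then have "y\<^sup>2 \<le> Y\<^sup>2" by (auto simp flip: abs_le_square_iff)
      then have "x\<^sup>2 + y\<^sup>2 \<le> R\<^sup>2" using x2 by (simp add: Y_def)
      then show "0 \<le> 1 / sqrt (1 - x\<^sup>2 - y\<^sup>2) ^ 3" using R2 by simp
    qed
    finally show ?thesis using True by simp
  next
    case False
    then have "Complex x y \<notin> ?E" for y
      using abs_Re_le_cmod[of "Complex x y"] by (auto simp: kcap_def)
    then have "f (Complex x y) = 0" for y by (simp add: f_def)
    then show ?thesis using False by simp
  qed
  have "(\<integral>\<^sup>+w. f w \<partial>lborel) = (\<integral>\<^sup>+w. f w \<partial>distr (lborel \<Otimes>\<^sub>M lborel) borel (\<lambda>p. Complex (fst p) (snd p)))"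
    unfolding distr_Complex ..
  also have "\<dots> = (\<integral>\<^sup>+p. f (Complex (fst p) (snd p)) \<partial>(lborel \<Otimes>\<^sub>M lborel))"
    by (rule nn_integral_distr) measurable
  also have "\<dots> = (\<integral>\<^sup>+x. \<integral>\<^sup>+y. f (Complex x y) \<partial>lborel \<partial>lborel)"
    by (subst lborel.nn_integral_fst[symmetric]) auto
  also have "\<dots> = (\<integral>\<^sup>+x. ennreal (indicator {R * cos \<theta>..R} x * (2 * sqrt (R\<^sup>2 - x\<^sup>2) / ((1 - x\<^sup>2) * sqrt (1 - R\<^sup>2)))) \<partial>lborel)"
    unfolding slice ..
  also have "\<dots> = ennreal (cap_area R \<theta>)"
  proof (rule nn_integral_has_integral_lebesgue[OF _ cap_profile_has_integral[OF R \<theta>]])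
    fix x assume "x \<in> {R * cos \<theta>..R}"
    then have "\<bar>x\<bar> \<le> R" using h by auto
    then have "x\<^sup>2 \<le> R\<^sup>2" using R by (metis abs_le_square_iff abs_of_pos)
    then show "0 \<le> 2 * sqrt (R\<^sup>2 - x\<^sup>2) / ((1 - x\<^sup>2) * sqrt (1 - R\<^sup>2))"
      using R2 by (intro divide_nonneg_nonneg mult_nonneg_nonneg) auto
  qed
  finally have nn: "(\<integral>\<^sup>+w. f w \<partial>lborel) = ennreal (cap_area R \<theta>)" .
  have "0 \<le> cap_area R \<theta>"
  proof (rule has_integral_nonneg[OF cap_profile_has_integral[OF R \<theta>]])
    fix x assume "x \<in> {R * cos \<theta>..R}"
    then have "\<bar>x\<bar> \<le> R" using h by auto
    then have "x\<^sup>2 \<le> R\<^sup>2" using R by (metis abs_le_square_iff abs_of_pos)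
    then show "0 \<le> 2 * sqrt (R\<^sup>2 - x\<^sup>2) / ((1 - x\<^sup>2) * sqrt (1 - R\<^sup>2))"
      using R2 by (intro divide_nonneg_nonneg mult_nonneg_nonneg) auto
  qed
  then have "(f has_integral cap_area R \<theta>) UNIV"
    by (intro nn_integral_has_integral nn f0) auto
  moreover have "f = (\<lambda>w. if w \<in> ?E then kdens w else 0)" by (auto simp: f_def)
  ultimately show ?thesis by (simp add: has_integral_restrict_UNIV)
qed

text \<open>The density is invariant under rotation, and a rotation has Jacobian 1.\<close>

lemma kcap_has_integral:
  assumes R: "0 < R" "R < 1" and \<theta>: "0 \<le> \<theta>" "\<theta> \<le> pi"
  shows "(kdens has_integral cap_area R \<theta>) (kcap R \<mu> \<theta>)"
proof -
  let ?g = "\<lambda>w. cis (-\<mu>) * w"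
  have im: "?g ` kcap R \<mu> \<theta> = kcap R 0 \<theta>"
  proof
    show "kcap R 0 \<theta> \<subseteq> ?g ` kcap R \<mu> \<theta>"
    proof
      fix w assume w: "w \<in> kcap R 0 \<theta>"
      have e: "cis (-\<mu>) * (cis \<mu> * w) = w" by (simp add: cis_mult flip: mult.assoc)
      then have "cis \<mu> * w \<in> kcap R \<mu> \<theta>"
        using w by (simp only: kcap_def mem_Collect_eq e norm_mult norm_cis) simp
      then show "w \<in> ?g ` kcap R \<mu> \<theta>" using e by force
    qed
  qed (auto simp: kcap_def norm_mult)
  have R2: "R\<^sup>2 < 1" using R by (simp add: abs_square_less_1)
  have pos: "0 \<le> kdens w" if "w \<in> kcap R 0 \<theta>" for w
  proof -
    have "(cmod w)\<^sup>2 \<le> R\<^sup>2" using that R by (auto simp: kcap_def power_mono)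
    then show ?thesis using R2 by (simp add: kdens_def)
  qed
  have int: "kdens absolutely_integrable_on (?g ` kcap R \<mu> \<theta>)"
    unfolding im using kcap_0_has_integral[OF assms] pos
    by (auto intro!: nonnegative_absolutely_integrable_1)
  have inj: "inj_on ?g (kcap R \<mu> \<theta>)" by (auto simp: inj_on_def)
  have der: "(?g has_derivative (\<lambda>v. cis (-\<mu>) * v + 0 * cnj v)) (at z)" for z
    by (auto intro!: derivative_eq_intros)
  have bor: "kcap R \<mu> \<theta> \<in> sets borel" "?g ` kcap R \<mu> \<theta> \<in> sets borel"
    unfolding im using closed_kcap by (simp_all add: borel_closed)
  have dens: "kdens z = \<bar>(cmod (cis (-\<mu>)))\<^sup>2 - (cmod 0)\<^sup>2\<bar> * kdens (?g z)" for z
    by (simp add: kdens_def norm_mult)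
  note * = complex_change_of_variables[OF bor der inj kdens_measurable kdens_measurable dens int]
  show ?thesis
    using set_lebesgue_integral_eq_integral[OF *(1)] *(2) kcap_0_has_integral[OF assms]
    unfolding im by (simp add: has_integral_iff)
qed

section \<open>Inscribed Euclidean polygons\<close>

text \<open>Twice the signed area of the triangle \<open>p q w\<close>, positive when
  \<open>w\<close> lies to the left of the line from \<open>p\<close> to \<open>q\<close>.\<close>

definition ori :: "complex \<Rightarrow> complex \<Rightarrow> complex \<Rightarrow> real" where
  "ori p q w = (\<i> * (q - p)) \<bullet> (w - p)"

lemma ori_eq: "ori p q w = (Re q - Re p) * (Im w - Im p) - (Im q - Im p) * (Re w - Re p)"
  by (simp add: ori_def inner_complex_def algebra_simps)

lemma ori_affine: "u + v = 1 \<Longrightarrow> ori p q (u *\<^sub>R x + v *\<^sub>R y) = u * ori p q x + v * ori p q y"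
proof -
  assume "u + v = 1"
  then have v: "v = 1 - u" by simp
  show ?thesis unfolding ori_eq v by (simp add: algebra_simps)
qed

lemma convex_ori: "convex {w. 0 \<le> ori p q w}" "convex {w. ori p q w \<le> 0}"
  unfolding convex_alt by (auto simp: ori_affine mult_nonneg_nonpos add_nonpos_nonpos)

lemma negligible_ori: "p \<noteq> q \<Longrightarrow> negligible {w. ori p q w = 0}"
  using negligible_hyperplane[of "\<i> * (q - p)" "(\<i> * (q - p)) \<bullet> p"]
  by (simp add: ori_def inner_diff_right)

lemma ori_rotate: "ori p q w = ori q w p"
  by (simp add: ori_eq algebra_simps)

lemma ori_barycentric:
  "ori b c w *\<^sub>R a + ori c a w *\<^sub>R b + ori a b w *\<^sub>R c = ori a b c *\<^sub>R w"
  "ori b c w + ori c a w + ori a b w = ori a b c"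
  by (auto simp: complex_eq_iff ori_eq algebra_simps)

lemma triangle_eq_halfplanes:
  assumes D: "0 < ori a b c"
  shows "convex hull {a, b, c} = {w. 0 \<le> ori a b w \<and> 0 \<le> ori b c w \<and> 0 \<le> ori c a w}"
proof
  have "convex {w. 0 \<le> ori a b w \<and> 0 \<le> ori b c w \<and> 0 \<le> ori c a w}"
    using convex_Int[OF convex_ori(1)[of a b] convex_Int[OF convex_ori(1)[of b c] convex_ori(1)[of c a]]]
    by (simp add: Int_def)
  moreover have "ori b c a = ori a b c" "ori c a b = ori a b c"
    using ori_rotate by metis+
  moreover have "ori x y x = 0" "ori x y y = 0" for x y by (auto simp: ori_eq)
  ultimately show "convex hull {a, b, c} \<subseteq> {w. 0 \<le> ori a b w \<and> 0 \<le> ori b c w \<and> 0 \<le> ori c a w}"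
    using D by (intro hull_minimal) auto
next
  show "{w. 0 \<le> ori a b w \<and> 0 \<le> ori b c w \<and> 0 \<le> ori c a w} \<subseteq> convex hull {a, b, c}"
  proof
    fix w assume w: "w \<in> {w. 0 \<le> ori a b w \<and> 0 \<le> ori b c w \<and> 0 \<le> ori c a w}"
    let ?D = "ori a b c"
    have "(ori b c w / ?D) *\<^sub>R a + (ori c a w / ?D) *\<^sub>R b + (ori a b w / ?D) *\<^sub>R c = (1 / ?D) *\<^sub>R (?D *\<^sub>R w)"
      unfolding ori_barycentric(1)[symmetric, of a b c w] by (simp add: scaleR_right_distrib)
    also have "\<dots> = w" using D by simp
    finally have "w = (ori b c w / ?D) *\<^sub>R a + (ori c a w / ?D) *\<^sub>R b + (ori a b w / ?D) *\<^sub>R c" by simp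
    moreover have "ori b c w / ?D + ori c a w / ?D + ori a b w / ?D = 1"
      using D ori_barycentric(2)[of b c w a] by (simp flip: add_divide_distrib)
    moreover have "0 \<le> ori b c w / ?D" "0 \<le> ori c a w / ?D" "0 \<le> ori a b w / ?D" using w D by auto
    ultimately show "w \<in> convex hull {a, b, c}" unfolding convex_hull_3 by blast
  qed
qed

text \<open>A point beyond both lines \<open>a b\<close> and \<open>b c\<close> lies on the far side of the tangent at \<open>b\<close>.\<close>

lemma caps_almost_disjoint:
  assumes norm: "cmod a = R" "cmod b = R" "cmod c = R" "cmod w \<le> R"
    and D: "0 < ori a b c" and w: "ori a b w \<le> 0" "ori b c w \<le> 0"
  shows "ori a b w = 0 \<and> ori b c w = 0"
proof -
  define x y where "x = - ori b c w" and "y = - ori a b w"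
  have "x \<ge> 0" "y \<ge> 0" using w by (auto simp: x_def y_def)
  have ab: "0 < b \<bullet> (b - a)"
  proof -
    have "a \<noteq> b" using D by (auto simp: ori_eq)
    moreover have "2 * (b \<bullet> (b - a)) = (cmod (b - a))\<^sup>2 + (cmod b)\<^sup>2 - (cmod a)\<^sup>2"
      unfolding power2_norm_eq_inner by (simp add: inner_diff_left inner_diff_right inner_commute)
    ultimately show ?thesis using norm by (smt (verit) right_minus_eq zero_less_norm_iff zero_less_power)
  qed
  have bc: "0 < b \<bullet> (b - c)"
  proof -
    have "b \<noteq> c" using D by (auto simp: ori_eq)
    moreover have "2 * (b \<bullet> (b - c)) = (cmod (b - c))\<^sup>2 + (cmod b)\<^sup>2 - (cmod c)\<^sup>2"
      unfolding power2_norm_eq_inner by (simp add: inner_diff_left inner_diff_right inner_commute)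
    ultimately show ?thesis using norm by (smt (verit) right_minus_eq zero_less_norm_iff zero_less_power)
  qed
  \<comment> \<open>The barycentric identity rewritten as
    \<open>ori a b c * (w - b) = x * (b - a) + y * (b - c)\<close> and paired with
    \<open>b\<close>.\<close>
  have "ori a b c * (b \<bullet> (w - b)) = x * (b \<bullet> (b - a)) + y * (b \<bullet> (b - c))"
    unfolding x_def y_def ori_eq inner_complex_def by simp algebra
  moreover have "b \<bullet> (w - b) \<le> 0"
  proof -
    have "b \<bullet> w \<le> cmod b * cmod w" by (rule norm_cauchy_schwarz)
    also have "\<dots> \<le> R * R" using norm by (intro mult_mono) auto
    also have "\<dots> = b \<bullet> b" using norm by (simp add: dot_square_norm power2_eq_square)
    finally show ?thesis by (simp add: inner_diff_right)
  qed
  ultimately have "x * (b \<bullet> (b - a)) + y * (b \<bullet> (b - c)) \<le> 0"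
    using mult_nonneg_nonpos[of "ori a b c" "b \<bullet> (w - b)"] D by linarith
  then have "x * (b \<bullet> (b - a)) = 0" "y * (b \<bullet> (b - c)) = 0"
    using \<open>x \<ge> 0\<close> \<open>y \<ge> 0\<close> ab bc mult_nonneg_nonneg[of x "b \<bullet> (b - a)"] mult_nonneg_nonneg[of y "b \<bullet> (b - c)"] by linarith+
  then show ?thesis using ab bc by (simp add: x_def y_def)
qed

text \<open>A segment from \<open>p\<close> to a point of \<open>K\<close> can leave the triangle
  only through its side \<open>a b\<close>, which belongs to \<open>K\<close>; the two lateral side
  conditions keep it from leaving elsewhere.\<close>

lemma convex_hull_insert_ear:
  assumes K: "convex K" "a \<in> K" "b \<in> K" and D: "0 < ori a b p"
    and side: "\<And>s. s \<in> K \<Longrightarrow> ori a b s \<le> 0" "\<And>s. s \<in> K \<Longrightarrow> 0 \<le> ori b p s" "\<And>s. s \<in> K \<Longrightarrow> 0 \<le> ori p a s"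
  shows "convex hull (insert p K) = K \<union> convex hull {a, b, p}"
proof
  show "K \<union> convex hull {a, b, p} \<subseteq> convex hull (insert p K)"
    using K by (intro Un_least hull_mono) (auto intro: hull_inc)
  have z: "ori b p p = 0" "ori p a p = 0" "ori a b a = 0" "ori a b b = 0" by (auto simp: ori_eq)
  show "convex hull (insert p K) \<subseteq> K \<union> convex hull {a, b, p}"
  proof
    fix w assume "w \<in> convex hull (insert p K)"
    then obtain u v q where uv: "0 \<le> u" "0 \<le> v" "u + v = 1" "q \<in> K" and w: "w = u *\<^sub>R p + v *\<^sub>R q"
      using convex_hull_insert[of K p] K by (auto simp: hull_same)
    have bp: "0 \<le> ori b p x" and pa: "0 \<le> ori p a x"
      if "x = s *\<^sub>R p + t *\<^sub>R q" "0 \<le> s" "0 \<le> t" "s + t = 1" for x s t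
      using that side(2,3)[OF \<open>q \<in> K\<close>] by (auto simp: ori_affine z)
    show "w \<in> K \<union> convex hull {a, b, p}"
    proof (cases "0 \<le> ori a b w")
      case True
      then show ?thesis using bp[OF w] pa[OF w] uv triangle_eq_halfplanes[OF D] by auto
    next
      case False
      define l where "l = - ori a b q"
      have neg: "u * ori a b p < v * l" using False unfolding w ori_affine[OF uv(3)] l_def by simp
      have l: "l > 0"
      proof (rule ccontr)
        assume "\<not> l > 0"
        then have "v * l \<le> 0" using uv by (simp add: mult_nonneg_nonpos)
        then show False using neg uv D mult_nonneg_nonneg[of u "ori a b p"] by linarith
      qed
      define e where "e = ori a b p"
      have e: "e > 0" using D by (simp add: e_def)
      \<comment> \<open>The point where the segment from \<open>p\<close> to \<open>q\<close>
        crosses the line \<open>a b\<close>: its endpoints are weighted by each other's signed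
        distance from that line.\<close>
      define q' where "q' = (l / (l + e)) *\<^sub>R p + (e / (l + e)) *\<^sub>R q"
      have s1: "l / (l + e) + e / (l + e) = 1" using l e by (simp flip: add_divide_distrib)
      have q0: "ori a b q' = 0"
        unfolding q'_def ori_affine[OF s1] using l e by (simp add: l_def[symmetric] e_def[symmetric] field_simps) (simp add: l_def)
      have "q' \<in> closed_segment a b"
      proof -
        have n: "0 \<le> ori b p q'" "0 \<le> ori p a q'"
          using bp[OF q'_def] pa[OF q'_def] s1 l e by auto
        have bs: "ori b p q' + ori p a q' = e" using ori_barycentric(2)[of b p q' a] q0 by (simp add: e_def)
        have "ori b p q' *\<^sub>R a + ori p a q' *\<^sub>R b = e *\<^sub>R q'"
          using ori_barycentric(1)[of b p q' a] q0 by (simp add: e_def)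
        then have "(1 / e) *\<^sub>R (ori b p q' *\<^sub>R a + ori p a q' *\<^sub>R b) = q'" using e by simp
        then have "q' = (ori b p q' / e) *\<^sub>R a + (ori p a q' / e) *\<^sub>R b" by (simp add: scaleR_right_distrib)
        moreover have "ori b p q' / e = 1 - ori p a q' / e" using bs e by (simp add: field_simps)
        moreover have "0 \<le> ori p a q' / e" "ori p a q' / e \<le> 1" using n bs e by auto
        ultimately show ?thesis unfolding closed_segment_def by auto
      qed
      then have q'K: "q' \<in> K" using K by (meson closed_segment_subset subsetD)
      have "w = (u * (l + e) / l) *\<^sub>R q' + (v - u * e / l) *\<^sub>R q"
        unfolding w q'_def using l e by (simp add: scaleR_right_distrib) (simp add: algebra_simps divide_simps flip: scaleR_left_distrib)
      moreover have "0 \<le> u * (l + e) / l" "0 \<le> v - u * e / l"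
        using uv l e neg by (auto simp: field_simps e_def)
      moreover have "u * (l + e) / l + (v - u * e / l) = 1"
        using l uv(3) by (simp add: distrib_left add_divide_distrib)
      ultimately show ?thesis using convexD[OF K(1) q'K uv(4)] by simp
    qed
  qed
qed

section \<open>Orientation of points on a circle and areas of inscribed polygons\<close>

definition circ_pt :: "real \<Rightarrow> real \<Rightarrow> complex" where
  "circ_pt R a = of_real R * cis a"

lemma norm_circ_pt: "0 \<le> R \<Longrightarrow> cmod (circ_pt R a) = R"
  by (simp add: circ_pt_def norm_mult)

text \<open>Rotating by the mean of the two angles makes the chord vertical, with abscissa
  \<open>R * cos ((b - a) / 2)\<close> and length \<open>2 * R * sin ((b - a) / 2)\<close>. This
  links half-planes with \<open>kcap\<close>.\<close>

lemma ori_circ_pt: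
  "ori (circ_pt R a) (circ_pt R b) w =
     - 2 * R * sin ((b - a) / 2) * (Re (cis (- ((a + b) / 2)) * w) - R * cos ((b - a) / 2))"
proof -
  define m t where "m = (a + b) / 2" and "t = (b - a) / 2"
  have ab: "a = m - t" "b = m + t" by (auto simp: m_def t_def field_simps)
  have cc: "cos m * (cos m * z) = z - sin m * (sin m * z)" for z
  proof -
    have "cos m * (cos m * z) = (cos m)\<^sup>2 * z" by (simp add: power2_eq_square)
    also have "\<dots> = z - sin m * (sin m * z)"
      unfolding cos_squared_eq by (simp add: power2_eq_square algebra_simps)
    finally show ?thesis .
  qed
  have "ori (circ_pt R (m - t)) (circ_pt R (m + t)) w = - 2 * R * sin t * (Re (cis (- m) * w) - R * cos t)"
    unfolding ori_eq circ_pt_def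
    by (simp add: cos_add sin_add cos_diff sin_diff algebra_simps cc)
  then show ?thesis unfolding ab[symmetric] by (simp add: m_def t_def)
qed

text \<open>Makes the orientation of three points on the circle a matter of the signs of sines of
  half differences, that is, of their cyclic order.\<close>

lemma ori_circ_pt3:
  "ori (circ_pt R a) (circ_pt R b) (circ_pt R c) =
     4 * R\<^sup>2 * sin ((b - a) / 2) * sin ((c - b) / 2) * sin ((c - a) / 2)"
proof -
  have "Re (cis (- ((a + b) / 2)) * circ_pt R c) = R * cos (c - (a + b) / 2)"
    by (simp add: circ_pt_def cos_diff algebra_simps)
  moreover have "cos ((b - a) / 2) - cos (c - (a + b) / 2) = 2 * sin ((c - a) / 2) * sin ((c - b) / 2)"
  proof -
    have e: "((b - a) / 2 + (c - (a + b) / 2)) / 2 = (c - a) / 2" "((c - (a + b) / 2) - (b - a) / 2) / 2 = (c - b) / 2"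
      by (auto simp: field_simps)
    show ?thesis unfolding cos_diff_cos e ..
  qed
  ultimately have "ori (circ_pt R a) (circ_pt R b) (circ_pt R c) = 2 * R\<^sup>2 * sin ((b - a) / 2) * (2 * sin ((c - a) / 2) * sin ((c - b) / 2))"
    unfolding ori_circ_pt by (simp add: power2_eq_square algebra_simps)
  then show ?thesis by simp
qed

lemma circ_pt_neq:
  assumes "0 < R" "a < b" "b < a + 2 * pi" shows "circ_pt R a \<noteq> circ_pt R b"
proof -
  define c where "c = (a + b) / 2"
  have "0 < sin ((c - a) / 2)" "0 < sin ((b - c) / 2)" "0 < sin ((b - a) / 2)"
    using assms by (auto intro!: sin_gt_zero simp: c_def field_simps)
  then have "0 < ori (circ_pt R a) (circ_pt R c) (circ_pt R b)"
    unfolding ori_circ_pt3 using assms by simp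
  then show ?thesis by (auto simp: ori_eq)
qed

lemma kcap_eq_ori:
  assumes "0 < R" "a < b" "b < a + 2 * pi"
  shows "kcap R ((a + b) / 2) ((b - a) / 2) = {w. cmod w \<le> R \<and> ori (circ_pt R a) (circ_pt R b) w \<le> 0}"
proof -
  have "0 < sin ((b - a) / 2)" using assms by (intro sin_gt_zero) auto
  then have "0 < 2 * R * sin ((b - a) / 2)" using assms by simp
  moreover have "- c * t \<le> 0 \<longleftrightarrow> 0 \<le> t" if "0 < c" for c t :: real
    using that by (simp add: zero_le_mult_iff)
  ultimately have "- (2 * R * sin ((b - a) / 2)) * t \<le> 0 \<longleftrightarrow> 0 \<le> t" for t by blast
  then have e: "- 2 * R * sin ((b - a) / 2) * t \<le> 0 \<longleftrightarrow> 0 \<le> t" for t by (simp only: mult_minus_left)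
  show ?thesis unfolding kcap_def ori_circ_pt e diff_ge_0_iff_ge ..
qed

text \<open>The cap over the arc from \<open>a\<close> to \<open>c\<close> consists of the triangle
  and the caps over the two shorter arcs, overlapping only along lines.\<close>

lemma triangle_has_integral:
  assumes R: "0 < R" "R < 1" and abc: "a < b" "b < c" "c < a + 2 * pi"
  shows "(kdens has_integral cap_area R ((c - a) / 2) - cap_area R ((b - a) / 2) - cap_area R ((c - b) / 2))
     (convex hull {circ_pt R a, circ_pt R b, circ_pt R c})"
proof -
  let ?a = "circ_pt R a" and ?b = "circ_pt R b" and ?c = "circ_pt R c"
  have norm: "cmod ?a = R" "cmod ?b = R" "cmod ?c = R" using R by (auto simp: norm_circ_pt)
  have "0 < sin ((b - a) / 2)" "0 < sin ((c - b) / 2)" "0 < sin ((c - a) / 2)"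
    using abc by (auto intro!: sin_gt_zero)
  then have D: "0 < ori ?a ?b ?c" unfolding ori_circ_pt3 using R by simp
  then have D': "0 < ori ?b ?c ?a" "0 < ori ?c ?a ?b" using ori_rotate by metis+
  have ne: "?a \<noteq> ?b" "?b \<noteq> ?c" "?a \<noteq> ?c" using D by (auto simp: ori_eq)
  have flip: "ori ?c ?a w = - ori ?a ?c w" for w by (simp add: ori_eq algebra_simps)
  let ?T = "convex hull {?a, ?b, ?c}"
  define AB where "AB = {w. cmod w \<le> R \<and> ori ?a ?b w \<le> 0}"
  define BC where "BC = {w. cmod w \<le> R \<and> ori ?b ?c w \<le> 0}"
  define AC where "AC = {w. cmod w \<le> R \<and> ori ?a ?c w \<le> 0}"
  have cap: "(kdens has_integral cap_area R ((v - u) / 2)) {w. cmod w \<le> R \<and> ori (circ_pt R u) (circ_pt R v) w \<le> 0}"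
    if "u < v" "v < u + 2 * pi" for u v
    using kcap_has_integral[OF R, of "(v - u) / 2" "(u + v) / 2"] that unfolding kcap_eq_ori[OF R(1) that] by simp
  have Tsub: "?T \<subseteq> cball 0 R" using norm by (intro hull_minimal convex_cball) auto
  have "kdens integrable_on ?T"
    using R Tsub by (intro set_lebesgue_integral_eq_integral(1) kdens_absolutely_integrable finite_imp_compact_convex_hull) auto
  then have T: "(kdens has_integral integral ?T kdens) ?T" by (rule integrable_integral)
  have "(kdens has_integral integral ?T kdens + cap_area R ((b - a) / 2)) (?T \<union> AB)"
  proof (rule has_integral_Un[OF T])
    show "(kdens has_integral cap_area R ((b - a) / 2)) AB" unfolding AB_def using abc by (intro cap) auto
    show "negligible (?T \<inter> AB)"
      by (rule negligible_subset[OF negligible_ori[OF ne(1)]]) (auto simp: triangle_eq_halfplanes[OF D] AB_def)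
  qed
  then have "(kdens has_integral integral ?T kdens + cap_area R ((b - a) / 2) + cap_area R ((c - b) / 2)) ((?T \<union> AB) \<union> BC)"
  proof (rule has_integral_Un)
    show "(kdens has_integral cap_area R ((c - b) / 2)) BC" unfolding BC_def using abc by (intro cap) auto
    have "ori ?b ?c w = 0" if "w \<in> (?T \<union> AB) \<inter> BC" for w
      using that caps_almost_disjoint[OF norm _ D, of w] by (auto simp: triangle_eq_halfplanes[OF D] AB_def BC_def)
    then show "negligible ((?T \<union> AB) \<inter> BC)"
      by (intro negligible_subset[OF negligible_ori[OF ne(2)]]) auto
  qed
  \<comment> \<open>A point of the cap on \<open>a b\<close> cannot also lie strictly beyond the
    side \<open>c a\<close>, by near disjointness of the caps meeting at \<open>a\<close>; likewise
    for \<open>b c\<close> at the vertex \<open>c\<close>.\<close>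
  moreover have "(?T \<union> AB) \<union> BC = AC"
  proof -
    have "ori ?a ?c w \<le> 0" if "w \<in> AB" for w
      using caps_almost_disjoint[OF norm(3,1,2) _ D'(2), of w] that flip[of w] by (cases "ori ?a ?c w \<le> 0") (auto simp: AB_def)
    moreover have "ori ?a ?c w \<le> 0" if "w \<in> BC" for w
      using caps_almost_disjoint[OF norm(2,3,1) _ D'(1), of w] that flip[of w] by (cases "ori ?a ?c w \<le> 0") (auto simp: BC_def)
    ultimately show ?thesis
      using Tsub by (auto simp: triangle_eq_halfplanes[OF D] AB_def BC_def AC_def flip)
  qed
  moreover have "(kdens has_integral cap_area R ((c - a) / 2)) AC" unfolding AC_def using abc by (intro cap) auto
  ultimately have "integral ?T kdens + cap_area R ((b - a) / 2) + cap_area R ((c - b) / 2) = cap_area R ((c - a) / 2)"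
    using has_integral_unique by metis
  then have "integral ?T kdens = cap_area R ((c - a) / 2) - cap_area R ((b - a) / 2) - cap_area R ((c - b) / 2)" by simp
  then show ?thesis using T by simp
qed

text \<open>Fan triangulation from vertex 0: each new vertex adds an ear over the current closing
  chord, and the caps over these chords telescope. The induction starts at a segment, which is
  negligible.\<close>

lemma inscribed_polygon_has_integral:
  fixes \<alpha> :: "nat \<Rightarrow> real"
  assumes R: "0 < R" "R < 1"
    and "strict_mono_on {0..k} \<alpha>" "\<alpha> k < \<alpha> 0 + 2 * pi" "1 \<le> k"
  shows "(kdens has_integral cap_area R ((\<alpha> k - \<alpha> 0) / 2) - (\<Sum>i=1..k. cap_area R ((\<alpha> i - \<alpha> (i - 1)) / 2)))
     (convex hull ((\<lambda>i. circ_pt R (\<alpha> i)) ` {0..k}))"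
  using assms(5,3,4)
proof (induction k rule: dec_induct)
  case base
  have "{0..1::nat} = {0, 1}" by auto
  then have im: "(\<lambda>i. circ_pt R (\<alpha> i)) ` {0..1} = {circ_pt R (\<alpha> 0), circ_pt R (\<alpha> 1)}" by simp
  have "\<alpha> 0 < \<alpha> 1" using base by (auto simp: strict_mono_on_def)
  then have "circ_pt R (\<alpha> 0) \<noteq> circ_pt R (\<alpha> 1)"
    using base R by (intro circ_pt_neq) auto
  moreover have "convex hull {circ_pt R (\<alpha> 0), circ_pt R (\<alpha> 1)} \<subseteq> {w. ori (circ_pt R (\<alpha> 0)) (circ_pt R (\<alpha> 1)) w = 0}"
    unfolding segment_convex_hull[symmetric] closed_segment_def by (auto simp: ori_affine) (auto simp: ori_eq)
  ultimately have "negligible (convex hull ((\<lambda>i. circ_pt R (\<alpha> i)) ` {0..1}))"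
    unfolding im using negligible_subset negligible_ori by blast
  then have "(kdens has_integral 0) (convex hull ((\<lambda>i. circ_pt R (\<alpha> i)) ` {0..1}))"
    by (rule has_integral_negligible) simp
  then show ?case by simp
next
  case (step k)
  let ?x = "\<lambda>i. circ_pt R (\<alpha> i)"
  let ?K = "convex hull (?x ` {0..k})"
  have lt: "\<alpha> i < \<alpha> j" if "i < j" "j \<le> Suc k" for i j
    using that step.prems(1) by (auto simp: strict_mono_on_def)
  then have le: "\<alpha> i \<le> \<alpha> j" if "i \<le> j" "j \<le> Suc k" for i j
    using that by (cases "i = j") (auto simp: less_le)
  have smk: "strict_mono_on {0..k} \<alpha>" using lt by (auto simp: strict_mono_on_def)
  have k2: "\<alpha> k < \<alpha> 0 + 2 * pi" using lt[of k "Suc k"] step.prems(2) by simp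
  have IH: "(kdens has_integral cap_area R ((\<alpha> k - \<alpha> 0) / 2) - (\<Sum>i=1..k. cap_area R ((\<alpha> i - \<alpha> (i - 1)) / 2))) ?K"
    by (rule step.IH[OF smk k2])
  have sn: "0 \<le> sin ((\<alpha> j - \<alpha> i) / 2)" if "i \<le> j" "j \<le> Suc k" for i j
    using le[OF that] le[of 0 i] le[of j "Suc k"] that step.prems(2) by (intro sin_ge_zero) auto
  have sm: "sin ((\<alpha> i - \<alpha> j) / 2) \<le> 0" if "i \<le> j" "j \<le> Suc k" for i j
    using sn[OF that] sin_minus[of "(\<alpha> j - \<alpha> i) / 2"] by (simp add: minus_divide_left del: sin_minus)
  have sp: "0 < sin ((\<alpha> j - \<alpha> i) / 2)" if "i < j" "j \<le> Suc k" for i j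
    using lt[OF that] le[of 0 i] le[of j "Suc k"] that step.prems(2) by (intro sin_gt_zero) auto
  have D: "0 < ori (?x 0) (?x k) (?x (Suc k))"
    unfolding ori_circ_pt3 using R step.hyps by (intro mult_pos_pos sp) auto
  have ear: "convex hull (insert (?x (Suc k)) ?K) = ?K \<union> convex hull {?x 0, ?x k, ?x (Suc k)}"
  proof (rule convex_hull_insert_ear[OF convex_convex_hull _ _ D])
    have "?K \<subseteq> {w. ori (?x 0) (?x k) w \<le> 0}"
    proof (intro hull_minimal convex_ori subsetI)
      fix s assume "s \<in> ?x ` {0..k}"
      then obtain i where i: "i \<le> k" "s = ?x i" by auto
      then show "s \<in> {w. ori (?x 0) (?x k) w \<le> 0}"
        unfolding i ori_circ_pt3 mem_Collect_eq using sn[of 0 k] sm[of i k] sn[of 0 i]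
        by (intro mult_nonpos_nonneg mult_nonneg_nonpos mult_nonneg_nonneg) auto
    qed
    then show "\<And>s. s \<in> ?K \<Longrightarrow> ori (?x 0) (?x k) s \<le> 0" by auto
    have "?K \<subseteq> {w. 0 \<le> ori (?x k) (?x (Suc k)) w}"
    proof (intro hull_minimal convex_ori subsetI)
      fix s assume "s \<in> ?x ` {0..k}"
      then obtain i where i: "i \<le> k" "s = ?x i" by auto
      then show "s \<in> {w. 0 \<le> ori (?x k) (?x (Suc k)) w}"
        unfolding i ori_circ_pt3 mem_Collect_eq using sn[of k "Suc k"] sm[of i k] sm[of i "Suc k"]
        by (intro mult_nonpos_nonpos mult_nonneg_nonpos mult_nonneg_nonneg) auto
    qed
    then show "\<And>s. s \<in> ?K \<Longrightarrow> 0 \<le> ori (?x k) (?x (Suc k)) s" by auto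
    have "?K \<subseteq> {w. 0 \<le> ori (?x (Suc k)) (?x 0) w}"
    proof (intro hull_minimal convex_ori subsetI)
      fix s assume "s \<in> ?x ` {0..k}"
      then obtain i where i: "i \<le> k" "s = ?x i" by auto
      have "0 \<le> (4 * R\<^sup>2) * (sin ((\<alpha> 0 - \<alpha> (Suc k)) / 2) * sin ((\<alpha> i - \<alpha> (Suc k)) / 2)) * sin ((\<alpha> i - \<alpha> 0) / 2)"
        using sn[of 0 i] sm[of i "Suc k"] sm[of 0 "Suc k"] i
        by (intro mult_nonneg_nonneg mult_nonpos_nonpos) auto
      then show "s \<in> {w. 0 \<le> ori (?x (Suc k)) (?x 0) w}"
        unfolding i ori_circ_pt3 mem_Collect_eq by (simp add: mult_ac)
    qed
    then show "\<And>s. s \<in> ?K \<Longrightarrow> 0 \<le> ori (?x (Suc k)) (?x 0) s" by auto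
  qed (auto intro: hull_inc)
  have hull: "convex hull (?x ` {0..Suc k}) = ?K \<union> convex hull {?x 0, ?x k, ?x (Suc k)}"
    unfolding ear[symmetric] atLeastAtMostSuc_conv[of 0 k, simplified] image_insert by (rule hull_insert)
  have "0 < k" using step.hyps by simp
  then have T: "(kdens has_integral cap_area R ((\<alpha> (Suc k) - \<alpha> 0) / 2) - cap_area R ((\<alpha> k - \<alpha> 0) / 2) - cap_area R ((\<alpha> (Suc k) - \<alpha> k) / 2))
      (convex hull {?x 0, ?x k, ?x (Suc k)})"
    using lt step.prems(2) by (intro triangle_has_integral[OF R]) auto
  have "negligible (?K \<inter> convex hull {?x 0, ?x k, ?x (Suc k)})"
  proof (rule negligible_subset)
    show "negligible {w. ori (?x 0) (?x k) w = 0}"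
      using D by (intro negligible_ori) (auto simp: ori_eq)
    have "?K \<subseteq> {w. ori (?x 0) (?x k) w \<le> 0}"
    proof (intro hull_minimal convex_ori subsetI)
      fix s assume "s \<in> ?x ` {0..k}"
      then obtain i where i: "i \<le> k" "s = ?x i" by auto
      then show "s \<in> {w. ori (?x 0) (?x k) w \<le> 0}"
        unfolding i ori_circ_pt3 mem_Collect_eq using sn[of 0 k] sm[of i k] sn[of 0 i]
        by (intro mult_nonpos_nonneg mult_nonneg_nonpos mult_nonneg_nonneg) auto
    qed
    then show "?K \<inter> convex hull {?x 0, ?x k, ?x (Suc k)} \<subseteq> {w. ori (?x 0) (?x k) w = 0}"
      unfolding triangle_eq_halfplanes[OF D] by force
  qed
  from has_integral_Un[OF IH T this] show ?case
    unfolding hull by (simp add: algebra_simps)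
qed

section \<open>Area of cyclic polygons\<close>

text \<open>\<open>R / sqrt (1 - R\<^sup>2)\<close> is the hyperbolic sine of the circumradius, so
  this is the sine rule in the right triangle that is half of the isosceles triangle on the
  side.\<close>

lemma sinh_half_hdist:
  assumes "c \<in> hyp_plane" "x \<in> hyp_plane" "y \<in> hyp_plane" and R: "0 < R" "R < 1"
    and "kmap c x = circ_pt R a" "kmap c y = circ_pt R b"
  shows "sinh (hdist x y / 2) = R / sqrt (1 - R\<^sup>2) * \<bar>sin ((b - a) / 2)\<bar>"
proof -
  have R2: "R\<^sup>2 < 1" using R by (simp add: abs_square_less_1)
  have "circ_pt R a \<bullet> circ_pt R b = R\<^sup>2 * cos (b - a)"
    by (simp add: circ_pt_def inner_complex_def cos_diff power2_eq_square algebra_simps)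
  then have "cosh (hdist x y) = (1 - R\<^sup>2 * cos (b - a)) / (1 - R\<^sup>2)"
    using cosh_hdist_kmap[OF assms(1-3)] R R2 by (simp add: assms(6,7) norm_circ_pt)
  moreover have "cosh (hdist x y) = 1 + 2 * (sinh (hdist x y / 2))\<^sup>2"
    using cosh_double[of "hdist x y / 2"] by (simp add: cosh_square_eq)
  moreover have "cos (b - a) = 1 - 2 * (sin ((b - a) / 2))\<^sup>2"
  proof -
    have "b - a = 2 * ((b - a) / 2)" by (simp add: field_simps)
    then show ?thesis by (metis cos_double_sin)
  qed
  ultimately have "2 * (sinh (hdist x y / 2))\<^sup>2 = (1 - R\<^sup>2 * (1 - 2 * (sin ((b - a) / 2))\<^sup>2)) / (1 - R\<^sup>2) - 1"
    by simp
  also have "\<dots> = 2 * (R\<^sup>2 * (sin ((b - a) / 2))\<^sup>2 / (1 - R\<^sup>2))"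
    using R2 by (simp add: divide_simps) (simp add: algebra_simps)
  also have "R\<^sup>2 * (sin ((b - a) / 2))\<^sup>2 / (1 - R\<^sup>2) = (R / sqrt (1 - R\<^sup>2) * \<bar>sin ((b - a) / 2)\<bar>)\<^sup>2"
    using R2 by (simp add: power_mult_distrib power_divide)
  finally have "(sinh (hdist x y / 2))\<^sup>2 = (R / sqrt (1 - R\<^sup>2) * \<bar>sin ((b - a) / 2)\<bar>)\<^sup>2" by simp
  moreover have "0 \<le> sinh (hdist x y / 2)" using assms(2,3) hdist_nonneg by (simp add: hyp_plane_def)
  moreover have "0 \<le> R / sqrt (1 - R\<^sup>2) * \<bar>sin ((b - a) / 2)\<bar>" using R(1) R2 by simp
  ultimately show ?thesis by (rule power2_eq_imp_eq)
qed

lemma Arg2pi_cis: "0 \<le> a \<Longrightarrow> a < 2 * pi \<Longrightarrow> Arg2pi (cis a) = a"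
  by (rule Arg2pi_unique[of 1]) (auto simp: cis_conv_exp)

lemma mob_inj:
  assumes "cmod c < 1" "cmod x < 1" "cmod y < 1" "mob c x = mob c y" shows "x = y"
proof -
  have "mob (-c) (mob c x) = x" "mob (-c) (mob c y) = y"
    using mob_mob_minus[of "-c"] assms(1-3) by auto
  then show ?thesis using assms(4) by metis
qed

lemma norm_mob_hcircle:
  assumes c: "c \<in> hyp_plane" and x: "x \<in> hcircle c r"
  shows "(cmod (mob c x))\<^sup>2 = (cosh r - 1) / (cosh r + 1)"
proof -
  let ?t = "cmod (mob c x)"
  have "?t < 1" using c x mob_norm_less by (auto simp: hcircle_def hyp_plane_def)
  moreover have "r = 2 * artanh ?t" using x by (simp add: hcircle_def hdist_def)
  ultimately have "cosh r = (1 + ?t\<^sup>2) / (1 - ?t\<^sup>2)" using cosh_two_artanh[of ?t] by simp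
  moreover have "?t\<^sup>2 < 1" using \<open>?t < 1\<close> by (simp add: abs_square_less_1)
  ultimately have "?t\<^sup>2 * (cosh r + 1) = cosh r - 1" by (simp add: divide_simps) (simp add: algebra_simps)
  moreover have "cosh r + 1 > 0" using cosh_real_pos[of r] by linarith
  ultimately show ?thesis by (simp add: eq_divide_eq)
qed

text \<open>With \<open>\<theta> i\<close> half the angle that side \<open>i\<close> subtends at the circumcentre on the side away from
  the polygon, this is Gauss--Bonnet for an inscribed polygon.\<close>

definition angle_area :: "nat \<Rightarrow> (nat \<Rightarrow> real) \<Rightarrow> (nat \<Rightarrow> real) \<Rightarrow> real" where
  "angle_area n d \<theta> = 2 * (\<Sum>i<n. arccos (cos (\<theta> i) / cosh (d i / 2))) - 2 * pi"

text \<open>Expressing the base angle through the side length leaves \<open>R\<close> only in a term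
  linear in \<theta>, which becomes a constant when summed over a tuple with total \<pi>.\<close>

lemma cap_area_eq:
  assumes R: "0 < R" "R < 1" and d: "sinh (d / 2) = R / sqrt (1 - R\<^sup>2) * sin \<theta>"
  shows "cap_area R \<theta> = 2 * \<theta> / sqrt (1 - R\<^sup>2) - 2 * arccos (cos \<theta> / cosh (d / 2))"
proof -
  have R2: "R\<^sup>2 < 1" using R by (simp add: abs_square_less_1)
  have "(cosh (d / 2))\<^sup>2 = 1 + R\<^sup>2 * (sin \<theta>)\<^sup>2 / (1 - R\<^sup>2)"
    unfolding cosh_square_eq d using R2 by (simp add: power_mult_distrib power_divide)
  also have "\<dots> = (1 - R\<^sup>2 * (cos \<theta>)\<^sup>2) / (1 - R\<^sup>2)"
    using R2 unfolding sin_squared_eq by (simp add: divide_simps) (simp add: algebra_simps)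
  finally have "cosh (d / 2) = sqrt ((1 - R\<^sup>2 * (cos \<theta>)\<^sup>2) / (1 - R\<^sup>2))"
    by (metis abs_of_pos cosh_real_pos real_sqrt_abs)
  then show ?thesis unfolding cap_area_def by (simp add: real_sqrt_divide mult.commute)
qed

text \<open>Complementary caps make up the disk, whose hyperbolic area is
  \<open>2 * pi / sqrt (1 - R\<^sup>2) - 2 * pi\<close>.\<close>

lemma cap_area_pi_minus:
  assumes R: "0 < R" "R < 1"
  shows "cap_area R (pi - \<theta>) = 2 * pi / sqrt (1 - R\<^sup>2) - 2 * pi - cap_area R \<theta>"
proof -
  let ?u = "sqrt (1 - R\<^sup>2) * cos \<theta> / sqrt (1 - R\<^sup>2 * (cos \<theta>)\<^sup>2)"
  have R2: "R\<^sup>2 < 1" using R by (simp add: abs_square_less_1)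
  have c1: "(cos \<theta>)\<^sup>2 \<le> 1" by (simp add: abs_square_le_1)
  have "R\<^sup>2 * (cos \<theta>)\<^sup>2 \<le> R\<^sup>2 * 1" by (rule mult_left_mono[OF c1]) simp
  then have p: "0 < 1 - R\<^sup>2 * (cos \<theta>)\<^sup>2" using R2 by linarith
  have "?u\<^sup>2 = (1 - R\<^sup>2) * (cos \<theta>)\<^sup>2 / (1 - R\<^sup>2 * (cos \<theta>)\<^sup>2)"
    using R2 p by (simp add: power_mult_distrib power_divide)
  also have "\<dots> \<le> 1" using p c1 by (simp add: divide_simps algebra_simps)
  finally have "\<bar>?u\<bar> \<le> 1" by (simp only: abs_square_le_1)
  then have "arccos (- ?u) = pi - arccos ?u" by (intro arccos_minus) (auto simp only: abs_le_iff)
  then show ?thesis unfolding cap_area_def by (simp add: diff_divide_distrib right_diff_distrib)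
qed

text \<open>The density is at least 1, and the open triangle, which contains its centroid, lies in
  the hull. This gives the strict positivity of the area of a cyclic polygon.\<close>

lemma integral_kdens_triangle_pos:
  assumes R: "0 < R" "R < 1" and abc: "a < b" "b < c" "c < a + 2 * pi"
    and S: "finite S" "S \<subseteq> cball 0 R" "{circ_pt R a, circ_pt R b, circ_pt R c} \<subseteq> S"
  shows "0 < integral (convex hull S) kdens"
proof -
  let ?a = "circ_pt R a" and ?b = "circ_pt R b" and ?c = "circ_pt R c"
  have "0 < sin ((b - a) / 2)" "0 < sin ((c - b) / 2)" "0 < sin ((c - a) / 2)"
    using abc by (auto intro!: sin_gt_zero)
  then have D: "0 < ori ?a ?b ?c" unfolding ori_circ_pt3 using R by simp
  let ?U = "{w. 0 < ori ?a ?b w} \<inter> {w. 0 < ori ?b ?c w} \<inter> {w. 0 < ori ?c ?a w}"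
  have "open ?U" unfolding ori_def by (intro open_Int open_Collect_less continuous_intros)
  moreover have "(1/3) *\<^sub>R (?a + ?b + ?c) \<in> ?U"   proof -
    have "ori p q ((1/3) *\<^sub>R (p + q + s)) = ori p q s / 3" for p q s
      by (simp add: ori_eq field_simps)
    from this[of ?a ?b ?c] this[of ?b ?c ?a] this[of ?c ?a ?b] show ?thesis
      using D ori_rotate[of ?a ?b ?c] ori_rotate[of ?b ?c ?a] by (simp add: add_ac)
  qed
  ultimately have "\<not> negligible ?U" using open_not_negligible by blast
  moreover have "?U \<subseteq> convex hull {?a, ?b, ?c}" unfolding triangle_eq_halfplanes[OF D] by auto
  moreover have "convex hull {?a, ?b, ?c} \<subseteq> convex hull S" using S by (intro hull_mono)
  ultimately have nn: "\<not> negligible (convex hull S)" using negligible_subset by blast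
  have com: "compact (convex hull S)" using S(1) by (rule finite_imp_compact_convex_hull)
  then have lm: "convex hull S \<in> lmeasurable" by (rule lmeasurable_compact)
  have sub: "convex hull S \<subseteq> cball 0 R" using S(2) by (intro hull_minimal convex_cball)
  have "measure lebesgue (convex hull S) \<noteq> 0" using nn negligible_iff_measure[of "convex hull S"] lm by blast
  then have pos: "0 < measure lebesgue (convex hull S)" using zero_less_measure_iff by blast
  have "((\<lambda>_. 1::real) has_integral measure lebesgue (convex hull S)) (convex hull S)"
  proof -
    have "indicat_real (convex hull S) = (\<lambda>w. if w \<in> convex hull S then 1 else 0)" by (auto simp: indicator_def)
    then show ?thesis
      using lm has_integral_restrict_UNIV[of "convex hull S" "\<lambda>_. 1::real"] by (simp add: lmeasurable_iff_has_integral)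
  qed
  moreover have "(kdens has_integral integral (convex hull S) kdens) (convex hull S)"
    using R sub by (intro integrable_integral set_lebesgue_integral_eq_integral(1) kdens_absolutely_integrable com) auto
  moreover have "1 \<le> kdens w" if "w \<in> convex hull S" for w
  proof -
    have "cmod w \<le> R" using that sub by auto
    then have "(cmod w)\<^sup>2 < 1" using R by (simp add: abs_square_less_1)
    then have "0 < sqrt (1 - (cmod w)\<^sup>2)" "sqrt (1 - (cmod w)\<^sup>2) \<le> 1" by auto
    then show ?thesis unfolding kdens_def by (simp add: power_le_one)
  qed
  ultimately have "measure lebesgue (convex hull S) \<le> integral (convex hull S) kdens"
    by (rule has_integral_le)
  then show ?thesis using pos by simp
qed

lemma sum_lessThan_eq_atLeastAtMost:
  fixes f :: "nat \<Rightarrow> real"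
  assumes "0 < n" shows "(\<Sum>i<n. f i) = f 0 + (\<Sum>i=1..n - 1. f i)"
proof -
  obtain m where m: "n = Suc m" using assms gr0_implies_Suc by blast
  have "{..<n} = insert 0 {1..n - 1}" by (auto simp: m)
  then show ?thesis by simp
qed

text \<open>Reads off from an arbitrary cyclic polygon all that is needed later: its angle tuple,
  with \<rho> the hyperbolic sine of the circumradius, and its area in terms of that tuple
  only.\<close>

lemma cyclic_ngon_angles:
  assumes n: "n \<ge> 3" and d: "\<And>i. i < n \<Longrightarrow> 0 < d i" and ngon: "cyclic_ngon n x d"
  obtains \<theta> \<rho> where "0 < \<rho>" "\<And>i. i < n \<Longrightarrow> 0 < \<theta> i \<and> \<theta> i < pi" "(\<Sum>i<n. \<theta> i) = pi"
    "\<And>i. i < n \<Longrightarrow> sinh (d i / 2) = \<rho> * sin (\<theta> i)"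
    "harea (hconvex_hull (x ` {..<n})) = angle_area n d \<theta>" "0 < angle_area n d \<theta>"
proof -
  from ngon have "\<exists>c\<in>hyp_plane. \<exists>r>0. (\<forall>i<n. x i \<in> hcircle c r) \<and>
      (\<forall>i\<in>{1..<n}. \<forall>j<n. j \<noteq> i \<longrightarrow> x j \<notin> ccw_arc c r (x (i - 1)) (x i))"
    and side: "\<And>i. i \<in> {1..<n} \<Longrightarrow> hdist (x (i - 1)) (x i) = d i" and side0: "hdist (x (n - 1)) (x 0) = d 0"
    unfolding cyclic_ngon_def by simp_all
  then obtain c r where c: "c \<in> hyp_plane" and r: "r > 0"
    and circ': "\<forall>i<n. x i \<in> hcircle c r"
    and arc': "\<forall>i\<in>{1..<n}. \<forall>j<n. j \<noteq> i \<longrightarrow> x j \<notin> ccw_arc c r (x (i - 1)) (x i)"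
    by (elim bexE exE conjE)
  note circ = circ'[rule_format] and arc = arc'[rule_format]
  have c1: "cmod c < 1" using c by (simp add: hyp_plane_def)
  have xh: "x i \<in> hyp_plane" "cmod (x i) < 1" if "i < n" for i
    using circ[OF that] by (auto simp: hcircle_def hyp_plane_def)
  define y where "y i = mob c (x i)" for i
  define t where "t = cmod (y 0)"
  have t1: "t < 1" using mob_norm_less[OF c1 xh(2)[of 0]] n by (simp add: t_def y_def)
  have t0: "t > 0"
  proof -
    have "r = 2 * artanh t" using circ[of 0] n by (simp add: hcircle_def hdist_def t_def y_def)
    then show ?thesis using r by (cases "t = 0") (auto simp: t_def)
  qed
  have ty: "cmod (y i) = t" if "i < n" for i
  proof -
    have "(cmod (y i))\<^sup>2 = t\<^sup>2" unfolding y_def t_def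
      using norm_mob_hcircle[OF c circ[OF that]] norm_mob_hcircle[OF c circ[of 0]] n by simp
    then show ?thesis using t0 by (simp add: power2_eq_iff_nonneg)
  qed
  define \<alpha> where "\<alpha> i = Arg2pi (y i / y 0)" for i
  have \<alpha>r: "0 \<le> \<alpha> i" "\<alpha> i < 2 * pi" for i unfolding \<alpha>_def using Arg2pi by auto
  have y\<alpha>: "y i = y 0 * cis (\<alpha> i)" if "i < n" for i
  proof -
    have "y 0 \<noteq> 0" using t0 by (auto simp: t_def)
    moreover have "cmod (y i / y 0) = 1" using ty[OF that] t0 by (simp add: norm_divide flip: t_def)
    ultimately show ?thesis using Arg2pi_eq[of "y i / y 0"] by (simp add: \<alpha>_def cis_conv_exp field_simps)
  qed
  have \<alpha>0: "\<alpha> 0 = 0" using t0 by (auto simp: \<alpha>_def t_def Arg2pi_of_real[of 1, simplified])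
  have ydiv: "y i / y j = cis (\<alpha> i - \<alpha> j)" if "i < n" "j < n" for i j
  proof -
    have "y 0 \<noteq> 0" using t0 by (auto simp: t_def)
    then show ?thesis unfolding y\<alpha>[OF that(1)] y\<alpha>[OF that(2)] by (simp add: cis_divide)
  qed
  \<comment> \<open>If the angle did not increase, the counterclockwise way from vertex
    \<open>i - 1\<close> to vertex \<open>i\<close> would pass vertex 0, which the arc condition
    forbids. Equal angles are excluded because side \<open>i\<close> is positive.\<close>
  have inc: "\<alpha> (i - 1) < \<alpha> i" if i: "i \<in> {1..<n}" for i
  proof (rule ccontr)
    have il: "i < n" "i - 1 < n" "1 \<le> i" "0 < n" using i by auto
    assume "\<not> \<alpha> (i - 1) < \<alpha> i"
    moreover have "\<alpha> (i - 1) \<noteq> \<alpha> i"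
    proof
      assume "\<alpha> (i - 1) = \<alpha> i"
      then have "y (i - 1) = y i" using y\<alpha>[OF il(1)] y\<alpha>[OF il(2)] by simp
      then have "x (i - 1) = x i" unfolding y_def by (rule mob_inj[OF c1 xh(2)[OF il(2)] xh(2)[OF il(1)]])
      then have "d i = 0" using side[OF i] by (simp add: hdist_def mob_def)
      then show False using d[OF il(1)] by simp
    qed
    ultimately have gt: "\<alpha> i < \<alpha> (i - 1)" by simp
    have "Arg2pi (y 0 / y (i - 1)) = 2 * pi - \<alpha> (i - 1)"
    proof -
      have "y 0 / y (i - 1) = cis (2 * pi - \<alpha> (i - 1))"
        using ydiv[OF il(4,2)] by (simp add: \<alpha>0 cis.code complex_eq_iff cos_diff sin_diff)
      then show ?thesis using \<alpha>r[of "i - 1"] \<alpha>r(1)[of i] gt by (simp add: Arg2pi_cis)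
    qed
    moreover have "Arg2pi (y i / y (i - 1)) = 2 * pi + \<alpha> i - \<alpha> (i - 1)"
    proof -
      have "2 * pi + \<alpha> i - \<alpha> (i - 1) = (\<alpha> i - \<alpha> (i - 1)) + 2 * pi" by simp
      then have "cis (2 * pi + \<alpha> i - \<alpha> (i - 1)) = cis (\<alpha> i - \<alpha> (i - 1))" by (simp only: cis_2pi cis_mult[symmetric] mult_1_right)
      then have "y i / y (i - 1) = cis (2 * pi + \<alpha> i - \<alpha> (i - 1))"
        using ydiv[OF il(1,2)] by simp
      then show ?thesis using \<alpha>r[of "i - 1"] \<alpha>r[of i] gt by (simp add: Arg2pi_cis)
    qed
    ultimately have "x 0 \<in> ccw_arc c r (x (i - 1)) (x i)"
      unfolding ccw_arc_def using circ[of 0] \<alpha>r[of "i - 1"] \<alpha>r(1)[of i] n by (simp add: y_def[symmetric])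
    then show False using arc[OF i, of 0] i n by simp
  qed
  have mono: "\<alpha> i < \<alpha> j" if "i < j" "j < n" for i j
    using that
  proof (induction j)
    case (Suc j)
    have "\<alpha> j < \<alpha> (Suc j)" using inc[of "Suc j"] Suc.prems by simp
    then show ?case using Suc by (cases "i = j") auto
  qed simp
  define \<gamma> where "\<gamma> = Arg2pi (y 0)"
  have y0: "y 0 = of_real t * cis \<gamma>"
    using Arg2pi_eq[of "y 0"] by (simp add: \<gamma>_def t_def cis_conv_exp)
  \<comment> \<open>The Klein modulus of the vertices: \<open>t\<close> is \<open>tanh\<close> of
    half the circumradius, and \<open>R\<close> is \<open>tanh\<close> of the circumradius
    itself.\<close>
  define R where "R = 2 * t / (1 + t\<^sup>2)"
  have "0 < (1 - t)\<^sup>2" using t1 by simp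
  then have "2 * t < 1 + t\<^sup>2" by (simp add: power2_eq_square algebra_simps)
  then have R: "0 < R" "R < 1" using t0 by (auto simp: R_def divide_simps add_pos_pos)
  have R2: "R\<^sup>2 < 1" using R by (simp add: abs_square_less_1)
  define \<beta> where "\<beta> i = \<gamma> + \<alpha> i" for i
  have k: "kmap c (x i) = circ_pt R (\<beta> i)" if "i < n" for i
  proof -
    have "y i = of_real t * cis (\<beta> i)" unfolding y\<alpha>[OF that] y0 by (simp add: \<beta>_def cis_mult)
    then have "klein (y i) = (2 / (1 + t\<^sup>2)) *\<^sub>R (of_real t * cis (\<beta> i))" unfolding klein_def ty[OF that] by simp
    also have "\<dots> = circ_pt R (\<beta> i)" by (simp add: circ_pt_def R_def scaleR_conv_of_real)
    finally show ?thesis by (simp add: kmap_def y_def)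
  qed
  define \<rho> where "\<rho> = R / sqrt (1 - R\<^sup>2)"
  have \<rho>: "\<rho> > 0" using R R2 by (simp add: \<rho>_def)
  \<comment> \<open>Side 0 is the one that closes the polygon, from vertex \<open>n - 1\<close> to
    vertex 0; its half angle is what remains of \<pi>.\<close>
  define \<theta> where "\<theta> i = (if i = 0 then pi - \<alpha> (n - 1) / 2 else (\<alpha> i - \<alpha> (i - 1)) / 2)" for i
  have \<theta>: "0 < \<theta> i \<and> \<theta> i < pi" if "i < n" for i
  proof (cases "i = 0")
    case True
    then show ?thesis using \<alpha>r[of "n - 1"] mono[of 0 "n - 1"] n by (simp add: \<theta>_def \<alpha>0)
  next
    case False
    then show ?thesis using mono[of "i - 1" i] that \<alpha>r[of i] \<alpha>r[of "i - 1"] by (simp add: \<theta>_def)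
  qed
  have tel: "(\<Sum>i=1..m. \<alpha> i - \<alpha> (i - 1)) = \<alpha> m" for m
    by (induction m) (auto simp: \<alpha>0)
  have sum\<theta>: "(\<Sum>i<n. \<theta> i) = pi"
  proof -
    have "(\<Sum>i=1..n - 1. \<theta> i) = (\<Sum>i=1..n - 1. (\<alpha> i - \<alpha> (i - 1)) / 2)" by (intro sum.cong) (auto simp: \<theta>_def)
    also have "\<dots> = \<alpha> (n - 1) / 2" unfolding sum_divide_distrib[symmetric] tel ..
    finally show ?thesis using n by (simp add: sum_lessThan_eq_atLeastAtMost \<theta>_def)
  qed
  have sides: "sinh (d i / 2) = \<rho> * sin (\<theta> i)" if "i < n" for i
  proof (cases "i = 0")
    case True
    have "sinh (d 0 / 2) = \<rho> * \<bar>sin ((\<beta> 0 - \<beta> (n - 1)) / 2)\<bar>"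
      unfolding side0[symmetric] \<rho>_def using n by (intro sinh_half_hdist[OF c xh(1) xh(1) R k k]) auto
    also have "\<bar>sin ((\<beta> 0 - \<beta> (n - 1)) / 2)\<bar> = \<bar>sin (\<theta> 0)\<bar>"
      by (simp add: \<beta>_def \<theta>_def \<alpha>0)
    also have "\<dots> = sin (\<theta> 0)" using \<theta>[of 0] n sin_gt_zero[of "\<theta> 0"] by simp
    finally show ?thesis using True by simp
  next
    case False
    then have i: "i \<in> {1..<n}" using that by auto
    have "sinh (d i / 2) = \<rho> * \<bar>sin ((\<beta> i - \<beta> (i - 1)) / 2)\<bar>"
      unfolding side[OF i, symmetric] \<rho>_def using i by (intro sinh_half_hdist[OF c xh(1) xh(1) R k k]) auto
    also have "(\<beta> i - \<beta> (i - 1)) / 2 = \<theta> i" using False by (simp add: \<beta>_def \<theta>_def)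
    also have "\<bar>sin (\<theta> i)\<bar> = sin (\<theta> i)" using \<theta>[OF that] sin_gt_zero[of "\<theta> i"] by simp
    finally show ?thesis .
  qed
  have S: "x ` {..<n} \<subseteq> hyp_plane" using xh by auto
  have im: "kmap c ` (x ` {..<n}) = (\<lambda>i. circ_pt R (\<beta> i)) ` {0..n - 1}"
    unfolding image_image using n by (intro image_cong) (auto simp: k)
  have ha: "harea (hconvex_hull (x ` {..<n})) = integral (convex hull ((\<lambda>i. circ_pt R (\<beta> i)) ` {0..n - 1})) kdens"
    unfolding im[symmetric] by (rule harea_hconvex_hull[OF c S]) simp
  also have "\<dots> = cap_area R ((\<beta> (n - 1) - \<beta> 0) / 2) - (\<Sum>i=1..n - 1. cap_area R ((\<beta> i - \<beta> (i - 1)) / 2))"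
  proof (intro integral_unique inscribed_polygon_has_integral R)
    show "strict_mono_on {0..n - 1} \<beta>" using mono n by (auto simp: strict_mono_on_def \<beta>_def)
    show "\<beta> (n - 1) < \<beta> 0 + 2 * pi" using \<alpha>r[of "n - 1"] by (simp add: \<beta>_def \<alpha>0)
  qed (use n in auto)
  also have "(\<beta> (n - 1) - \<beta> 0) / 2 = pi - \<theta> 0" by (simp add: \<beta>_def \<theta>_def \<alpha>0)
  also have "(\<Sum>i=1..n - 1. cap_area R ((\<beta> i - \<beta> (i - 1)) / 2)) = (\<Sum>i=1..n - 1. cap_area R (\<theta> i))"
    by (intro sum.cong) (auto simp: \<beta>_def \<theta>_def)
  \<comment> \<open>The cap over the whole chain of vertices is complementary to the cap on the
    closing side, which restores the symmetry between side 0 and the others.\<close>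
  also have "cap_area R (pi - \<theta> 0) - (\<Sum>i=1..n - 1. cap_area R (\<theta> i)) = 2 * pi / sqrt (1 - R\<^sup>2) - 2 * pi - (\<Sum>i<n. cap_area R (\<theta> i))"
    using n by (simp add: cap_area_pi_minus[OF R] sum_lessThan_eq_atLeastAtMost)
  also have "(\<Sum>i<n. cap_area R (\<theta> i)) = (\<Sum>i<n. 2 * \<theta> i / sqrt (1 - R\<^sup>2) - 2 * arccos (cos (\<theta> i) / cosh (d i / 2)))"
    by (intro sum.cong refl cap_area_eq R) (auto simp: sides \<rho>_def)
  also have "\<dots> = 2 * (\<Sum>i<n. \<theta> i) / sqrt (1 - R\<^sup>2) - 2 * (\<Sum>i<n. arccos (cos (\<theta> i) / cosh (d i / 2)))"
    by (simp add: sum_subtractf sum_distrib_left sum_divide_distrib)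
  finally have area: "harea (hconvex_hull (x ` {..<n})) = angle_area n d \<theta>"
    by (simp add: sum\<theta> angle_area_def)
  have "0 < integral (convex hull ((\<lambda>i. circ_pt R (\<beta> i)) ` {0..n - 1})) kdens"
  proof (rule integral_kdens_triangle_pos[OF R])
    show "\<beta> 0 < \<beta> 1" "\<beta> 1 < \<beta> 2" "\<beta> 2 < \<beta> 0 + 2 * pi"
      using mono[of 0 1] mono[of 1 2] \<alpha>r[of 2] n by (auto simp: \<beta>_def \<alpha>0)
  qed (use n R in \<open>auto simp: norm_circ_pt\<close>)
  then have "0 < angle_area n d \<theta>" using ha area by simp
  with \<rho> \<theta> sum\<theta> sides area show ?thesis by (intro that)
qed

text \<open>The vertices are placed on a circle about the origin at twice the partial sums of the
  angles.\<close>

lemma cyclic_ngon_exists: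
  assumes n: "n \<ge> 3" and d: "\<And>i. i < n \<Longrightarrow> 0 < d i" and \<rho>: "0 < \<rho>"
    and \<theta>: "\<And>i. i < n \<Longrightarrow> 0 < \<theta> i \<and> \<theta> i < pi" and sum\<theta>: "(\<Sum>i<n. \<theta> i) = pi"
    and sides: "\<And>i. i < n \<Longrightarrow> sinh (d i / 2) = \<rho> * sin (\<theta> i)"
  shows "\<exists>x. cyclic_ngon n x d"
proof -
  \<comment> \<open>Solves \<open>R / sqrt (1 - R\<^sup>2) = \<rho>\<close>: from the hyperbolic
    sine of the circumradius to its hyperbolic tangent.\<close>
  define R where "R = \<rho> / sqrt (1 + \<rho>\<^sup>2)"
  have s0: "0 < 1 + \<rho>\<^sup>2" by (simp add: add_pos_nonneg)
  have R2: "R\<^sup>2 = \<rho>\<^sup>2 / (1 + \<rho>\<^sup>2)" using s0 by (simp add: R_def power_divide)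
  have R21: "1 - R\<^sup>2 = 1 / (1 + \<rho>\<^sup>2)" unfolding R2 using s0 by (simp add: divide_simps)
  have Rpos: "0 < R" using \<rho> s0 by (simp add: R_def)
  have "0 < 1 - R\<^sup>2" unfolding R21 using s0 by simp
  then have R: "0 < R" "R < 1" using Rpos by (auto simp: abs_square_less_1)
  have \<rho>R: "R / sqrt (1 - R\<^sup>2) = \<rho>" unfolding R21 using s0 by (simp add: R_def real_sqrt_divide)
  \<comment> \<open>The sum starts at index 1, since \<open>\<theta> 0\<close> belongs to the
    closing side.\<close>
  define \<alpha> where "\<alpha> i = 2 * (\<Sum>j=1..i. \<theta> j)" for i
  define t where "t = R / (1 + sqrt (1 - R\<^sup>2))"
  define x where "x i = of_real t * cis (\<alpha> i)" for i
  have xk: "x i = klein_inv (circ_pt R (\<alpha> i))" for i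
    unfolding x_def klein_inv_def norm_circ_pt[OF less_imp_le[OF R(1)]] by (simp add: circ_pt_def t_def scaleR_conv_of_real)
  have t0: "t > 0" using R \<open>0 < 1 - R\<^sup>2\<close> by (simp add: t_def add_pos_nonneg)
  have x1: "cmod (x i) < 1" and xkl: "klein (x i) = circ_pt R (\<alpha> i)" for i
    unfolding xk using R by (auto intro!: klein_klein_inv simp: norm_circ_pt)
  have norm: "cmod (x i) = t" for i using t0 by (simp add: x_def norm_mult)
  then have t1: "t < 1" using x1 by metis
  have xh: "x i \<in> hyp_plane" for i using x1 by (simp add: hyp_plane_def)
  have mob0: "mob 0 z = z" for z by (simp add: mob_def)
  have h0: "0 \<in> hyp_plane" by (simp add: hyp_plane_def)
  have k: "kmap 0 (x i) = circ_pt R (\<alpha> i)" for i by (simp add: kmap_def mob0 xkl)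
  have step: "\<alpha> i - \<alpha> (i - 1) = 2 * \<theta> i" if "1 \<le> i" for i
    using that by (cases i) (auto simp: \<alpha>_def)
  have last: "\<alpha> (n - 1) = 2 * pi - 2 * \<theta> 0"
    using sum\<theta> n sum_lessThan_eq_atLeastAtMost[of n \<theta>] by (simp add: \<alpha>_def)
  have mono: "\<alpha> i < \<alpha> j" if "i < j" "j < n" for i j
    using that
  proof (induction j)
    case (Suc j)
    have "\<alpha> j < \<alpha> (Suc j)" using step[of "Suc j"] \<theta>[of "Suc j"] Suc.prems by simp
    then show ?case using Suc by (cases "i = j") auto
  qed simp
  have \<alpha>0: "\<alpha> 0 = 0" by (simp add: \<alpha>_def)
  have \<alpha>r: "0 \<le> \<alpha> i" "\<alpha> i < 2 * pi" if "i < n" for i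
  proof -
    show "0 \<le> \<alpha> i" using mono[of 0 i] that \<alpha>0 by (cases "i = 0") auto
    have "i = n - 1 \<or> i < n - 1" using that by linarith
    then have "\<alpha> i \<le> \<alpha> (n - 1)" using mono[of i "n - 1"] n by auto
    then show "\<alpha> i < 2 * pi" using last \<theta>[of 0] n by simp
  qed
  define r where "r = 2 * artanh t"
  have "(1 + t) / (1 - t) > 1" using t0 t1 by simp
  then have r: "r > 0" unfolding r_def artanh_def by simp
  have circ: "x i \<in> hcircle 0 r" for i
    using xh by (simp add: hcircle_def hdist_def mob0 norm r_def)
  have dist: "hdist (x i) (x j) = d l" if "\<bar>sin ((\<alpha> j - \<alpha> i) / 2)\<bar> = sin (\<theta> l)" "l < n" for i j l
  proof -
    have "sinh (hdist (x i) (x j) / 2) = sinh (d l / 2)"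
      using sinh_half_hdist[OF h0 xh xh R k k, of i j] that sides by (simp add: \<rho>R)
    then show ?thesis by simp
  qed
  have sp: "0 < sin (\<theta> i)" if "i < n" for i using \<theta>[OF that] by (simp add: sin_gt_zero)
  have "cyclic_ngon n x d"
    unfolding cyclic_ngon_def
  proof (intro conjI bexI[OF _ h0] exI[of _ r] r allI impI ballI)
    show "x i \<in> hcircle 0 r" for i by (rule circ)
    show "hdist (x (i - 1)) (x i) = d i" if "i \<in> {1..<n}" for i
      using that step[of i] sp[of i] by (intro dist) auto
    have e: "(\<alpha> 0 - \<alpha> (n - 1)) / 2 = \<theta> 0 - pi" using last by (simp add: \<alpha>0)
    have "\<bar>sin ((\<alpha> 0 - \<alpha> (n - 1)) / 2)\<bar> = sin (\<theta> 0)"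
      unfolding e using sp[of 0] n by (simp add: sin_diff)
    then show "hdist (x (n - 1)) (x 0) = d 0"
      using n by (intro dist) auto
    fix i j assume i: "i \<in> {1..<n}" and j: "j < n" "j \<noteq> i"
    have il: "i < n" "i - 1 < n" "i - 1 < i" using i by auto
    note \<alpha>i = \<alpha>r[OF il(1)] and \<alpha>p = \<alpha>r[OF il(2)] and \<alpha>j = \<alpha>r[OF j(1)] and ip = mono[OF il(3,1)]
    have q: "x j / x l = cis (\<alpha> j - \<alpha> l)" for j l
      using t0 by (simp add: x_def cis_divide)
    have Ai: "Arg2pi (x i / x (i - 1)) = \<alpha> i - \<alpha> (i - 1)"
      unfolding q using ip \<alpha>i \<alpha>p by (intro Arg2pi_cis) auto
    show "x j \<notin> ccw_arc 0 r (x (i - 1)) (x i)"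
    proof (cases "i - 1 \<le> j")
      case True
      have le: "\<alpha> (i - 1) \<le> \<alpha> j" using mono[of "i - 1" j] True j by (cases "i - 1 = j") auto
      have A: "Arg2pi (x j / x (i - 1)) = \<alpha> j - \<alpha> (i - 1)"
        unfolding q using le \<alpha>j \<alpha>p by (intro Arg2pi_cis) auto
      show ?thesis
      proof (cases "j = i - 1")
        case True
        then show ?thesis unfolding ccw_arc_def mob0 using A by simp
      next
        case False
        then have "i < j" using j True by simp
        then show ?thesis unfolding ccw_arc_def mob0 using A Ai mono[of i j] j by simp
      qed
    next
      \<comment> \<open>A vertex that precedes \<open>i - 1\<close> is met only after passing vertex
        0, hence with a turn larger than the one that reaches vertex \<open>i\<close>.\<close>
      case False
      then have lt: "\<alpha> j < \<alpha> (i - 1)" using mono[of j "i - 1"] i by auto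
      have "2 * pi + \<alpha> j - \<alpha> (i - 1) = (\<alpha> j - \<alpha> (i - 1)) + 2 * pi" by simp
      then have "cis (2 * pi + \<alpha> j - \<alpha> (i - 1)) = cis (\<alpha> j - \<alpha> (i - 1))"
        by (simp only: cis_2pi cis_mult[symmetric] mult_1_right)
      then have "Arg2pi (x j / x (i - 1)) = 2 * pi + \<alpha> j - \<alpha> (i - 1)"
        unfolding q using lt \<alpha>j \<alpha>p Arg2pi_cis[of "2 * pi + \<alpha> j - \<alpha> (i - 1)"] by auto
      then show ?thesis unfolding ccw_arc_def mob0 using Ai \<alpha>i \<alpha>j by auto
    qed
  qed
  then show ?thesis by blast
qed

section \<open>Angles with prescribed ratios of sines\<close>

definition polygon_ineq :: "nat \<Rightarrow> (nat \<Rightarrow> real) \<Rightarrow> bool" where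
  "polygon_ineq n s \<longleftrightarrow> (\<forall>i<n. 0 \<le> s i \<and> s i \<le> (\<Sum>j\<in>{..<n} - {i}. s j))"

text \<open>Half central angles of a possibly degenerate inscribed polygon with \<open>sin (\<theta> i)\<close> proportional
  to \<open>s i\<close>. The last condition follows from the others when the factor is positive, is closed
  under limits, and makes \<open>\<theta> i = pi\<close> possible only if \<open>s i\<close> is the sum of the other entries.\<close>

definition angle_sol :: "nat \<Rightarrow> (nat \<Rightarrow> real) \<Rightarrow> (nat \<Rightarrow> real) \<Rightarrow> bool" where
  "angle_sol n s \<theta> \<longleftrightarrow> (\<forall>i<n. 0 \<le> \<theta> i \<and> \<theta> i \<le> pi) \<and> (\<Sum>i<n. \<theta> i) = pi \<and>
     (\<forall>i<n. \<forall>j<n. s j * sin (\<theta> i) = s i * sin (\<theta> j)) \<and>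
     (\<forall>i<n. - cos (\<theta> i) * (\<Sum>j\<in>{..<n} - {i}. s j) \<le> s i)"

section \<open>Inequalities for sines of sums and multiples\<close>

lemma mult_cos_le_sin:
  assumes "0 \<le> x" "x \<le> pi" shows "x * cos x \<le> sin x"
proof -
  have "(\<lambda>x. sin x - x * cos x) 0 \<le> (\<lambda>x. sin x - x * cos x) x"
  proof (rule DERIV_nonneg_imp_nondecreasing[OF assms(1)])
    fix t assume t: "0 \<le> t" "t \<le> x"
    have "((\<lambda>x. sin x - x * cos x) has_real_derivative t * sin t) (at t)"
      by (auto intro!: derivative_eq_intros)
    moreover have "0 \<le> t * sin t" using t assms by (simp add: sin_ge_zero)
    ultimately show "\<exists>y. ((\<lambda>x. sin x - x * cos x) has_real_derivative y) (at t) \<and> 0 \<le> y" by blast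
  qed
  then show ?thesis by simp
qed

text \<open>With the sum equal to \<open>pi - \<theta> i\<close> this becomes the last condition of
  \<open>angle_sol\<close>. Only a positive cosine matters; then the sines are bounded by their
  arguments and \<open>x * cos x \<le> sin x\<close> applies.\<close>

lemma cos_mult_sum_sin_le:
  fixes y :: "nat \<Rightarrow> real"
  assumes "finite J" "\<And>j. j \<in> J \<Longrightarrow> 0 \<le> y j" "sum y J \<le> pi"
  shows "cos (sum y J) * (\<Sum>j\<in>J. sin (y j)) \<le> sin (sum y J)"
proof -
  let ?x = "sum y J"
  have x: "0 \<le> ?x" using assms by (simp add: sum_nonneg)
  have yle: "y j \<le> pi" if "j \<in> J" for j
    using member_le_sum[of j J y] that assms by fastforce
  show ?thesis
  proof (cases "cos ?x \<le> 0")
    case True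
    have "0 \<le> (\<Sum>j\<in>J. sin (y j))" using assms yle by (intro sum_nonneg sin_ge_zero) auto
    then have "cos ?x * (\<Sum>j\<in>J. sin (y j)) \<le> 0" using True by (simp add: mult_nonpos_nonneg)
    also have "0 \<le> sin ?x" using x assms by (intro sin_ge_zero) auto
    finally show ?thesis .
  next
    case False
    have "(\<Sum>j\<in>J. sin (y j)) \<le> ?x" using assms by (intro sum_mono sin_x_le_x) auto
    then have "cos ?x * (\<Sum>j\<in>J. sin (y j)) \<le> cos ?x * ?x" using False by (intro mult_left_mono) auto
    also have "\<dots> \<le> sin ?x" using mult_cos_le_sin[OF x assms(3)] by (simp add: mult.commute)
    finally show ?thesis .
  qed
qed

lemma sin_add_less:
  assumes "0 < a" "0 < b" "a + b \<le> pi" shows "sin (a + b) < sin a + sin b"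
proof -
  have s: "0 < sin a" "0 < sin b" using assms by (auto intro!: sin_gt_zero)
  have "cos a < 1" "cos b < 1"
    using cos_monotone_0_pi[of 0 a] cos_monotone_0_pi[of 0 b] assms by auto
  then have "sin a * cos b < sin a * 1" "cos a * sin b < 1 * sin b"
    using s by (auto intro!: mult_strict_left_mono mult_strict_right_mono simp del: mult_1_left mult_1_right)
  then show ?thesis by (simp add: sin_add)
qed

lemma sin_sum_le:
  fixes y :: "nat \<Rightarrow> real"
  assumes "finite J" "\<And>j. j \<in> J \<Longrightarrow> 0 \<le> y j" "sum y J \<le> pi"
  shows "sin (sum y J) \<le> (\<Sum>j\<in>J. sin (y j))"
  using assms
proof (induction J rule: finite_induct)
  case (insert a J)
  have n: "0 \<le> y a" "0 \<le> sum y J" using insert.prems by (auto intro: sum_nonneg)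
  have le: "y a + sum y J \<le> pi" using insert by simp
  have IH: "sin (sum y J) \<le> (\<Sum>j\<in>J. sin (y j))" using insert n le by auto
  have "sin (y a + sum y J) \<le> sin (y a) + sin (sum y J)"
    using sin_add_less[of "y a" "sum y J"] n le by (cases "y a = 0"; cases "sum y J = 0") auto
  then show ?case using insert.hyps IH by simp
qed simp

text \<open>Equality in the subadditivity of sine therefore leaves at most one positive summand,
  which settles the boundary case of the polygon inequality.\<close>

lemma sin_sum_less:
  fixes y :: "nat \<Rightarrow> real"
  assumes J: "finite J" "\<And>j. j \<in> J \<Longrightarrow> 0 \<le> y j" "sum y J \<le> pi"
    and ab: "a \<in> J" "b \<in> J" "a \<noteq> b" "0 < y a" "0 < y b"
  shows "sin (sum y J) < (\<Sum>j\<in>J. sin (y j))"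
proof -
  have rm: "sum y J = y a + sum y (J - {a})" "(\<Sum>j\<in>J. sin (y j)) = sin (y a) + (\<Sum>j\<in>J - {a}. sin (y j))"
    using J ab by (auto intro: sum.remove)
  have "y b \<le> sum y (J - {a})" using J ab by (intro member_le_sum) auto
  then have p: "0 < sum y (J - {a})" using ab by simp
  have "sin (sum y J) < sin (y a) + sin (sum y (J - {a}))"
    unfolding rm using p ab J rm by (intro sin_add_less) auto
  also have "\<dots> \<le> sin (y a) + (\<Sum>j\<in>J - {a}. sin (y j))"
    using J rm ab by (intro add_left_mono sin_sum_le) auto
  finally show ?thesis using rm by simp
qed

text \<open>The quotient \<open>sin (k * t) / sin t\<close> is strictly increasing on the interval
  from 0 to \<pi>. This monotonicity drives the uniqueness of the angles.\<close>

lemma sin_mult_ratio_less: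
  assumes k: "0 < k" "k < 1" and xy: "0 < x" "x < y" "y < pi"
  shows "sin (k * x) * sin y < sin (k * y) * sin x"
proof -
  \<comment> \<open>The numerator of the derivative of the quotient. It vanishes at 0 and has
    derivative \<open>(1 - k\<^sup>2) * (sin (k * t) * sin t)\<close>, so it is positive.\<close>
  have N: "0 < k * cos (k * t) * sin t - sin (k * t) * cos t" if t: "0 < t" "t < pi" for t
  proof -
    have "(\<lambda>t. k * cos (k * t) * sin t - sin (k * t) * cos t) 0 < (\<lambda>t. k * cos (k * t) * sin t - sin (k * t) * cos t) t"
    proof (rule DERIV_pos_imp_increasing_open[OF t(1)])
      fix u assume u: "0 < u" "u < t"
      have "k * u < 1 * u" using k u by (intro mult_strict_right_mono) auto
      then have "k * u < u" by (simp only: mult_1_left)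
      then have ku: "0 < k * u" "k * u < pi" "u < pi" using mult_pos_pos[OF k(1) u(1)] u t by linarith+
      have "((\<lambda>t. k * cos (k * t) * sin t - sin (k * t) * cos t) has_real_derivative
        (1 - k\<^sup>2) * (sin (k * u) * sin u)) (at u)"
        by (auto intro!: derivative_eq_intros simp: algebra_simps power2_eq_square)
      moreover have "0 < sin (k * u)" "0 < sin u" using u(1) ku by (auto intro!: sin_gt_zero)
      moreover have "k\<^sup>2 < 1" using k by (simp add: abs_square_less_1)
      ultimately show "\<exists>y. ((\<lambda>t. k * cos (k * t) * sin t - sin (k * t) * cos t) has_real_derivative y) (at u) \<and> 0 < y"
        by (intro exI[of _ "(1 - k\<^sup>2) * (sin (k * u) * sin u)"] conjI mult_pos_pos) auto
    qed (auto intro!: continuous_intros)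
    then show ?thesis by simp
  qed
  have "(\<lambda>t. sin (k * t) / sin t) x < (\<lambda>t. sin (k * t) / sin t) y"
  proof (rule DERIV_pos_imp_increasing[OF xy(2)])
    fix t assume t: "x \<le> t" "t \<le> y"
    have st: "0 < sin t" using t xy by (intro sin_gt_zero) auto
    have "((\<lambda>t. sin (k * t) / sin t) has_real_derivative
       (k * cos (k * t) * sin t - sin (k * t) * cos t) / (sin t * sin t)) (at t)"
      using st by (auto intro!: derivative_eq_intros)
    moreover have "0 < (k * cos (k * t) * sin t - sin (k * t) * cos t) / (sin t * sin t)"
      using N[of t] t xy st by simp
    ultimately show "\<exists>D. ((\<lambda>t. sin (k * t) / sin t) has_real_derivative D) (at t) \<and> 0 < D" by blast
  qed
  moreover have "0 < sin x" "0 < sin y" using xy by (auto intro!: sin_gt_zero)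
  ultimately show ?thesis by (simp add: field_simps)
qed

section \<open>Existence of angle tuples\<close>

lemma angle_sol_of_proportional:
  assumes p: "0 < p" and \<theta>: "\<And>i. i < n \<Longrightarrow> 0 \<le> \<theta> i" and sum: "(\<Sum>i<n. \<theta> i) = pi"
    and pr: "\<And>i. i < n \<Longrightarrow> sin (\<theta> i) = p * s i"
  shows "angle_sol n s \<theta>"
  unfolding angle_sol_def
proof (intro conjI allI impI sum)
  fix i assume i: "i < n"
  have rest: "\<theta> i + (\<Sum>j\<in>{..<n} - {i}. \<theta> j) = pi" using sum sum.remove[of "{..<n}" i \<theta>] i by simp
  have nn: "0 \<le> (\<Sum>j\<in>{..<n} - {i}. \<theta> j)" using \<theta> by (intro sum_nonneg) auto
  show "0 \<le> \<theta> i" by (rule \<theta>[OF i])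
  show "\<theta> i \<le> pi" using rest nn by linarith
  show "s j * sin (\<theta> i) = s i * sin (\<theta> j)" if "j < n" for j
    using pr[OF i] pr[OF that] by simp
  have e: "(\<Sum>j\<in>{..<n} - {i}. \<theta> j) = pi - \<theta> i" using rest by linarith
  have "cos (\<Sum>j\<in>{..<n} - {i}. \<theta> j) * (\<Sum>j\<in>{..<n} - {i}. sin (\<theta> j)) \<le> sin (\<Sum>j\<in>{..<n} - {i}. \<theta> j)"
    using \<theta> rest \<theta>[OF i] by (intro cos_mult_sum_sin_le) auto
  moreover have "(\<Sum>j\<in>{..<n} - {i}. sin (\<theta> j)) = p * (\<Sum>j\<in>{..<n} - {i}. s j)"
    unfolding sum_distrib_left by (intro sum.cong) (auto simp: pr)
  ultimately have "p * (- cos (\<theta> i) * (\<Sum>j\<in>{..<n} - {i}. s j)) \<le> p * s i"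
    unfolding e using pr[OF i] by (simp add: mult_ac)
  then show "- cos (\<theta> i) * (\<Sum>j\<in>{..<n} - {i}. s j) \<le> s i" by (simp only: mult_le_cancel_left_pos[OF p])
qed

lemma angle_sol_degenerate:
  assumes "polygon_ineq n s" "i < n" "s i = (\<Sum>j\<in>{..<n} - {i}. s j)"
  shows "angle_sol n s (\<lambda>j. if j = i then pi else 0)"
proof -
  have "- (\<Sum>j\<in>{..<n} - {k}. s j) \<le> s k" if "k < n" for k
    using assms that sum_nonneg[of "{..<n} - {k}" s] by (auto simp: polygon_ineq_def)
  then show ?thesis using assms unfolding angle_sol_def by auto
qed

lemma Max_index:
  fixes s :: "nat \<Rightarrow> real"
  assumes "0 < n" obtains m where "m < n" "\<And>i. i < n \<Longrightarrow> s i \<le> s m"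
proof -
  have "Max (s ` {..<n}) \<in> s ` {..<n}" using assms by (intro Max_in) auto
  then obtain m where "m < n" "s m = Max (s ` {..<n})" by auto
  moreover have "s i \<le> Max (s ` {..<n})" if "i < n" for i using that by (intro Max_ge) auto
  ultimately show ?thesis using that by auto
qed

text \<open>Only the angle of the largest entry can be obtuse. Writing it as \<open>pi - x\<close>
  makes every other angle an \<open>arcsin\<close> of a multiple of \<open>sin x\<close>, and the
  angle sum becomes one equation in \<open>x\<close>, solved by the intermediate value
  theorem.\<close>

lemma angle_sol_strict_exists:
  fixes n :: nat
  assumes n: "0 < n" and s: "\<And>i. i < n \<Longrightarrow> 0 \<le> s i"
    and strict: "\<And>i. i < n \<Longrightarrow> s i < (\<Sum>j\<in>{..<n} - {i}. s j)"
  shows "\<exists>\<theta> p. 0 < p \<and> (\<forall>i<n. 0 \<le> \<theta> i) \<and> (\<Sum>i<n. \<theta> i) = pi \<and> (\<forall>i<n. sin (\<theta> i) = p * s i)"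
proof -
  obtain m where m: "m < n" and mx: "\<And>i. i < n \<Longrightarrow> s i \<le> s m" using Max_index[OF n] by blast
  let ?J = "{..<n} - {m}"
  have sm: "0 < s m"
  proof (rule ccontr)
    assume "\<not> 0 < s m"
    then have "s j = 0" if "j < n" for j using s[OF that] mx[OF that] by linarith
    then show False using strict[OF m] s[OF m] by simp
  qed
  define \<sigma> where "\<sigma> i = s i / s m" for i
  have \<sigma>: "0 \<le> \<sigma> i" "\<sigma> i \<le> 1" if "i < n" for i using s[OF that] mx[OF that] sm by (auto simp: \<sigma>_def)
  have \<sigma>sin: "0 \<le> \<sigma> i * sin x \<and> \<sigma> i * sin x \<le> 1" if "i < n" "0 \<le> x" "x \<le> pi" for i x
    using \<sigma>[OF that(1)] sin_ge_zero[OF that(2,3)] sin_le_one[of x] mult_mono[of "\<sigma> i" 1 "sin x" 1] by auto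
  define S where "S = (\<Sum>i\<in>?J. \<sigma> i)"
  have S: "S > 1" using strict[OF m] sm by (simp add: S_def \<sigma>_def flip: sum_divide_distrib)
  define h where "h x = (\<Sum>i\<in>?J. arcsin (\<sigma> i * sin x)) - x" for x
  \<comment> \<open>\<open>h\<close> has the useless zero 0, so a positive left end is needed with
    \<open>h\<close> nonnegative. Since \<open>x * cos x \<le> sin x\<close>, it suffices that
    \<open>S * cos x0 > 1\<close>; the cosine is taken midway between \<open>1 / S\<close> and
    1.\<close>
  define x0 where "x0 = arccos ((1 + 1 / S) / 2)"
  have u: "0 < 1 / S" "1 / S < 1" using S by auto
  have x0: "0 < x0" "x0 < pi"
    unfolding x0_def using arccos_lt_bounded[of "(1 + 1 / S) / 2"] u by auto
  have cx0: "cos x0 = (1 + 1 / S) / 2" unfolding x0_def using u by (intro cos_arccos) auto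
  have "q < (1 + q) / 2" if "q < 1" for q :: real using that by simp
  then have "1 / S < cos x0" using u(2) unfolding cx0 by blast
  then have "1 < S * cos x0" using S by (simp add: field_simps)
  have "x0 * 1 < x0 * (S * cos x0)" using x0 \<open>1 < S * cos x0\<close> by (intro mult_strict_left_mono) auto
  also have "\<dots> = S * (x0 * cos x0)" by simp
  also have "\<dots> \<le> S * sin x0" using mult_cos_le_sin[of x0] x0 S by (intro mult_left_mono) auto
  also have "\<dots> = (\<Sum>i\<in>?J. \<sigma> i * sin x0)" by (simp add: S_def sum_distrib_right)
  also have "\<dots> \<le> (\<Sum>i\<in>?J. arcsin (\<sigma> i * sin x0))"
  proof (rule sum_mono)
    fix i assume "i \<in> ?J"
    then have b: "0 \<le> \<sigma> i * sin x0" "\<sigma> i * sin x0 \<le> 1" using \<sigma>sin[of i x0] x0 by auto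
    then have "0 \<le> arcsin (\<sigma> i * sin x0)" using arcsin_le_arcsin[of 0 "\<sigma> i * sin x0"] by simp
    then have "sin (arcsin (\<sigma> i * sin x0)) \<le> arcsin (\<sigma> i * sin x0)" by (rule sin_x_le_x)
    then show "\<sigma> i * sin x0 \<le> arcsin (\<sigma> i * sin x0)" using b by simp
  qed
  finally have h0: "0 \<le> h x0" by (simp add: h_def)
  have "\<exists>x\<ge>x0. x \<le> pi \<and> h x = 0"
  proof (rule IVT2')
    show "h pi \<le> 0" by (simp add: h_def)
    show "continuous_on {x0..pi} h"
      unfolding h_def
    proof (intro continuous_intros ballI conjI)
      fix i x assume "i \<in> ?J" "x \<in> {x0..pi}"
      then have "0 \<le> \<sigma> i * sin x \<and> \<sigma> i * sin x \<le> 1" using x0 by (intro \<sigma>sin) auto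
      then show "- 1 \<le> \<sigma> i * sin x" "\<sigma> i * sin x \<le> 1" by auto
    qed
  qed (use h0 x0 in auto)
  then obtain x where x: "x0 \<le> x" "x \<le> pi" "h x = 0" by blast
  have "x \<noteq> pi" using x(3) by (auto simp: h_def)
  then have x1: "0 < x" "x < pi" using x x0 by auto
  define \<theta> where "\<theta> i = (if i = m then pi - x else arcsin (\<sigma> i * sin x))" for i
  show ?thesis
  proof (intro exI[of _ \<theta>] exI[of _ "sin x / s m"] conjI allI impI)
    show "0 < sin x / s m" using sm x1 by (simp add: sin_gt_zero)
    show "0 \<le> \<theta> i" if "i < n" for i
      using \<sigma>sin[OF that, of x] arcsin_le_arcsin[of 0 "\<sigma> i * sin x"] x1 by (auto simp: \<theta>_def)
    have "(\<Sum>i<n. \<theta> i) = \<theta> m + (\<Sum>i\<in>?J. \<theta> i)" using m by (intro sum.remove) auto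
    also have "(\<Sum>i\<in>?J. \<theta> i) = (\<Sum>i\<in>?J. arcsin (\<sigma> i * sin x))" by (intro sum.cong) (auto simp: \<theta>_def)
    finally show "(\<Sum>i<n. \<theta> i) = pi" using x(3) by (simp add: \<theta>_def h_def)
    show "sin (\<theta> i) = sin x / s m * s i" if "i < n" for i
      using \<sigma>sin[OF that, of x] x1 sm by (auto simp: \<theta>_def \<sigma>_def)
  qed
qed

lemma angle_sol_exists:
  assumes "0 < n" "polygon_ineq n s" shows "\<exists>\<theta>. angle_sol n s \<theta>"
proof (cases "\<exists>i<n. s i = (\<Sum>j\<in>{..<n} - {i}. s j)")
  case True
  then show ?thesis using angle_sol_degenerate assms by blast
next
  case False
  then have "s i < (\<Sum>j\<in>{..<n} - {i}. s j)" if "i < n" for i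
    using assms(2) that by (auto simp: polygon_ineq_def less_le)
  then show ?thesis
    using angle_sol_strict_exists[OF assms(1), of s] assms(2) angle_sol_of_proportional
    by (auto simp: polygon_ineq_def) blast
qed

section \<open>Uniqueness of angle tuples and of the resulting area\<close>

lemma angle_sol_factor:
  assumes sol: "angle_sol n s \<theta>" and k: "k < n" "0 < s k"
  obtains p where "0 \<le> p" "\<And>i. i < n \<Longrightarrow> sin (\<theta> i) = p * s i"
proof -
  have "sin (\<theta> i) = sin (\<theta> k) / s k * s i" if "i < n" for i
    using sol that k unfolding angle_sol_def by (simp add: field_simps)
  moreover have "0 \<le> sin (\<theta> k) / s k" using sol k unfolding angle_sol_def by (simp add: sin_ge_zero)
  ultimately show ?thesis using that by blast
qed

text \<open>Proportionality factor 0 corresponds to polygons inscribed in a horocycle.\<close>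

lemma angle_sol_sin_zero:
  assumes sol: "angle_sol n s \<theta>" and s: "polygon_ineq n s" and z: "\<And>i. i < n \<Longrightarrow> sin (\<theta> i) = 0"
  obtains k where "k < n" "\<And>i. i < n \<Longrightarrow> \<theta> i = (if i = k then pi else 0)" "s k = (\<Sum>j\<in>{..<n} - {k}. s j)"
proof -
  have \<theta>: "\<theta> i = 0 \<or> \<theta> i = pi" if "i < n" for i
  proof (rule ccontr)
    assume "\<not> (\<theta> i = 0 \<or> \<theta> i = pi)"
    then have "0 < \<theta> i" "\<theta> i < pi" using sol that unfolding angle_sol_def by (auto simp: less_le)
    then have "0 < sin (\<theta> i)" by (rule sin_gt_zero)
    then show False using z[OF that] by simp
  qed
  have sum: "(\<Sum>i<n. \<theta> i) = pi" using sol by (simp add: angle_sol_def)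
  obtain k where k: "k < n" "\<theta> k \<noteq> 0"
    using sum pi_neq_zero by (metis (no_types, lifting) lessThan_iff sum.neutral)
  then have kp: "\<theta> k = pi" using \<theta> by auto
  have "(\<Sum>i\<in>{..<n} - {k}. \<theta> i) = 0" using sum sum.remove[of "{..<n}" k \<theta>] k kp by simp
  then have "\<theta> i = 0" if "i < n" "i \<noteq> k" for i
    using that sol sum_nonneg_eq_0_iff[of "{..<n} - {k}" \<theta>] unfolding angle_sol_def by auto
  then have e: "\<theta> i = (if i = k then pi else 0)" if "i < n" for i using that kp by auto
  have "(\<Sum>j\<in>{..<n} - {k}. s j) \<le> s k" using sol k kp unfolding angle_sol_def by force
  then have "s k = (\<Sum>j\<in>{..<n} - {k}. s j)" using s k by (auto simp: polygon_ineq_def intro: order_antisym)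
  then show ?thesis using that k e by blast
qed

text \<open>If \<open>\<theta> i\<close> were obtuse, the positive angle \<open>\<theta> k\<close>
  would leave \<open>\<theta> m < pi - \<theta> i\<close>, an acute angle, so that
  \<open>sin (\<theta> m) < sin (\<theta> i)\<close> against the choice of \<open>m\<close>. Acute
  angles can be recovered from their sines.\<close>

lemma angle_sol_le_half_pi:
  fixes n :: nat
  assumes pr: "0 < p" "\<And>i. i < n \<Longrightarrow> sin (\<theta> i) = p * s i"
    and \<theta>: "\<And>i. i < n \<Longrightarrow> 0 \<le> \<theta> i" and sum: "(\<Sum>i<n. \<theta> i) = pi"
    and m: "m < n" "s i \<le> s m" and i: "i < n" "i \<noteq> m" and k: "k < n" "k \<noteq> i" "k \<noteq> m" "0 < s k"
  shows "\<theta> i \<le> pi / 2"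
proof (rule ccontr)
  assume c: "\<not> \<theta> i \<le> pi / 2"
  have "0 < \<theta> k"
    using pr(2)[OF k(1)] pr(1) k(4) \<theta>[OF k(1)] by (cases "\<theta> k = 0") auto
  moreover have "(\<Sum>j\<in>{i, m, k}. \<theta> j) \<le> (\<Sum>j<n. \<theta> j)"
    using m i k \<theta> by (intro sum_mono2) auto
  ultimately have lt: "\<theta> m < pi - \<theta> i" using sum i k by simp
  have "sin (\<theta> m) < sin (pi - \<theta> i)"
    using c lt \<theta>[OF m(1)] \<theta>[OF i(1)] by (intro sin_monotone_2pi) auto
  then have "p * s m < p * s i" using pr(2)[OF m(1)] pr(2)[OF i(1)] by simp
  then show False using pr(1) m(2) by simp
qed

text \<open>Let \<delta> and \<open>\<delta>'\<close> be the totals of the angles other than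
  \<open>m\<close>, so that \<open>\<delta> < \<delta>'\<close>. Scaling the primed angles by
  \<open>k = \<delta> / \<delta>'\<close> brings their total to \<delta>, yet shrinks each positive
  one below its unprimed partner: \<open>sin (k * x) / sin x\<close> is smaller at
  \<open>\<theta>' i\<close> than at \<open>\<delta>'\<close>, where it equals
  \<open>p / p'\<close>. The totals then contradict each other.\<close>

lemma angle_sol_unique_aux:
  fixes n :: nat
  assumes p: "0 < p" "\<And>i. i < n \<Longrightarrow> sin (\<theta> i) = p * s i" and p': "0 < p'" "\<And>i. i < n \<Longrightarrow> sin (\<theta>' i) = p' * s i"
    and \<theta>: "\<And>i. i < n \<Longrightarrow> 0 \<le> \<theta> i" "(\<Sum>i<n. \<theta> i) = pi"
    and \<theta>': "\<And>i. i < n \<Longrightarrow> 0 \<le> \<theta>' i" "(\<Sum>i<n. \<theta>' i) = pi"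
    and m: "m < n" "0 < s m" and half: "\<And>i. i < n \<Longrightarrow> i \<noteq> m \<Longrightarrow> \<theta> i \<le> pi / 2" "\<And>i. i < n \<Longrightarrow> i \<noteq> m \<Longrightarrow> \<theta>' i \<le> pi / 2"
    and ab: "a < n" "b < n" "a \<noteq> m" "b \<noteq> m" "a \<noteq> b" "0 < s a" "0 < s b"
  shows "\<not> \<theta>' m < \<theta> m"
proof
  assume lt: "\<theta>' m < \<theta> m"
  let ?J = "{..<n} - {m}"
  define \<delta> \<delta>' where "\<delta> = (\<Sum>i\<in>?J. \<theta> i)" and "\<delta>' = (\<Sum>i\<in>?J. \<theta>' i)"
  have \<delta>: "\<theta> m = pi - \<delta>" "\<theta>' m = pi - \<delta>'"
    using \<theta>(2) \<theta>'(2) sum.remove[of "{..<n}" m \<theta>] sum.remove[of "{..<n}" m \<theta>'] m by (auto simp: \<delta>_def \<delta>'_def)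
  have sd: "sin \<delta> = p * s m" "sin \<delta>' = p' * s m" using p(2)[OF m(1)] p'(2)[OF m(1)] \<delta> by auto
  have "\<delta> \<noteq> 0" using sd(1) p(1) m(2) by auto
  moreover have "0 \<le> \<delta>" unfolding \<delta>_def using \<theta> by (intro sum_nonneg) auto
  ultimately have d0: "0 < \<delta>" by simp
  have dlt: "\<delta> < \<delta>'" using lt \<delta> by simp
  have "\<delta>' \<noteq> pi" using sd(2) p'(1) m(2) by auto
  moreover have "\<delta>' \<le> pi" using \<delta>(2) \<theta>'(1)[OF m(1)] by simp
  ultimately have d1: "\<delta>' < pi" by simp
  define k where "k = \<delta> / \<delta>'"
  have k: "0 < k" "k < 1" "k * \<delta>' = \<delta>" using d0 dlt by (auto simp: k_def)
  have pos': "0 < \<theta>' i" if "i < n" "0 < s i" for i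
    using p'(2)[OF that(1)] p'(1) that \<theta>'(1)[OF that(1)] by (cases "\<theta>' i = 0") auto
  have strict: "k * \<theta>' i < \<theta> i" if i: "i \<in> ?J" "0 < s i" for i
  proof -
    have i': "0 < \<theta>' i" "i < n" "i \<noteq> m" using pos' i by auto
    \<comment> \<open>A second positive angle outside \<open>m\<close> makes
      \<open>\<theta>' i\<close> strictly smaller than the total \<open>\<delta>'\<close>, as the
      strict ratio inequality demands.\<close>
    obtain c where c: "c \<in> ?J" "c \<noteq> i" "0 < s c" using ab by (cases "i = a") auto
    have "(\<Sum>j\<in>{i, c}. \<theta>' j) \<le> \<delta>'" unfolding \<delta>'_def using i c \<theta>'(1) by (intro sum_mono2) auto
    then have il: "\<theta>' i < \<delta>'" using c pos'[of c] by simp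
    have spos: "0 < sin \<delta>'" "0 < sin \<delta>" using d0 d1 dlt by (auto intro!: sin_gt_zero)
    have "sin (k * \<theta>' i) * sin \<delta>' < sin \<delta> * sin (\<theta>' i)"
      using sin_mult_ratio_less[OF k(1,2) i'(1) il d1] k(3) by simp
    also have "\<dots> = sin (\<theta> i) * sin \<delta>'" unfolding sd p(2)[OF i'(2)] p'(2)[OF i'(2)] by simp
    finally have "sin (k * \<theta>' i) < sin (\<theta> i)" using spos by simp
    moreover have "k * \<theta>' i \<le> 1 * \<theta>' i" using k i' by (intro mult_right_mono) auto
    then have "k * \<theta>' i \<le> pi / 2" using half(2)[OF i'(2,3)] by simp
    ultimately show ?thesis
      using sin_monotone_2pi_le[of "\<theta> i" "k * \<theta>' i"] \<theta>(1)[OF i'(2)] pi_ge_zero by linarith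
  qed
  have weak: "k * \<theta>' i \<le> \<theta> i" if i: "i \<in> ?J" for i
  proof (cases "0 < s i")
    case False
    have "0 \<le> sin (\<theta>' i)" using \<theta>'(1)[of i] half(2)[of i] i by (intro sin_ge_zero) auto
    then have "0 \<le> s i" using p'(2)[of i] p'(1) i by (simp add: zero_le_mult_iff)
    then have "sin (\<theta>' i) = 0" using False p'(2)[of i] i by simp
    then have "\<theta>' i = 0" using \<theta>'(1)[of i] half(2)[of i] i sin_gt_zero[of "\<theta>' i"] by force
    then show ?thesis using \<theta>(1) i by simp
  qed (use strict i in force)
  have "(\<Sum>i\<in>?J. k * \<theta>' i) < (\<Sum>i\<in>?J. \<theta> i)"
    using weak strict[of a] ab by (intro sum_strict_mono_ex1) auto
  then have "k * \<delta>' < \<delta>" by (simp add: \<delta>_def \<delta>'_def sum_distrib_left)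
  then show False using k(3) by simp
qed

lemma angle_sol_unique:
  fixes n :: nat
  assumes s: "\<And>i. i < n \<Longrightarrow> 0 \<le> s i" and strict: "\<And>i. i < n \<Longrightarrow> s i < (\<Sum>j\<in>{..<n} - {i}. s j)" and n: "0 < n"
    and p: "0 < p" "\<And>i. i < n \<Longrightarrow> sin (\<theta> i) = p * s i" and p': "0 < p'" "\<And>i. i < n \<Longrightarrow> sin (\<theta>' i) = p' * s i"
    and \<theta>: "\<And>i. i < n \<Longrightarrow> 0 \<le> \<theta> i" "(\<Sum>i<n. \<theta> i) = pi"
    and \<theta>': "\<And>i. i < n \<Longrightarrow> 0 \<le> \<theta>' i" "(\<Sum>i<n. \<theta>' i) = pi"
    and i: "i < n"
  shows "\<theta> i = \<theta>' i"
proof -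
  obtain m where m: "m < n" and mx: "\<And>i. i < n \<Longrightarrow> s i \<le> s m" using Max_index[OF n] by blast
  have "0 < (\<Sum>j\<in>{..<n} - {m}. s j)" using strict[OF m] s[OF m] by simp
  then obtain a where a: "a \<in> {..<n} - {m}" "0 < s a"
    by (metis (no_types, lifting) not_less sum_nonpos)
  then have sm: "0 < s m" using mx[of a] by auto
  \<comment> \<open>One entry cannot exceed the maximum \<open>s m\<close> on its own, so the strict
    inequality yields a second positive entry besides \<open>m\<close>.\<close>
  have "(\<Sum>j\<in>{..<n} - {m}. s j) = s a + (\<Sum>j\<in>{..<n} - {m} - {a}. s j)" using a by (intro sum.remove) auto
  then have "0 < (\<Sum>j\<in>{..<n} - {m} - {a}. s j)" using strict[OF m] mx[of a] a by auto
  then obtain b where b: "b \<in> {..<n} - {m} - {a}" "0 < s b"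
    by (metis (no_types, lifting) not_less sum_nonpos)
  have ab: "a < n" "b < n" "a \<noteq> m" "b \<noteq> m" "a \<noteq> b" using a b by auto
  have half: "\<theta> i \<le> pi / 2 \<and> \<theta>' i \<le> pi / 2" if "i < n" "i \<noteq> m" for i
  proof -
    obtain k where k: "k < n" "k \<noteq> i" "k \<noteq> m" "0 < s k" using a b by (cases "i = a") auto
    show ?thesis
      using angle_sol_le_half_pi[OF p \<theta> m mx[OF that(1)] that k] angle_sol_le_half_pi[OF p' \<theta>' m mx[OF that(1)] that k] by blast
  qed
  have 1: "\<not> \<theta>' m < \<theta> m"
    by (rule angle_sol_unique_aux[OF p p' \<theta> \<theta>' m sm _ _ ab a(2) b(2)]) (use half in auto)
  have 2: "\<not> \<theta> m < \<theta>' m"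
    by (rule angle_sol_unique_aux[OF p' p \<theta>' \<theta> m sm _ _ ab a(2) b(2)]) (use half in auto)
  have eqm: "\<theta> m = \<theta>' m" using 1 2 by simp
  then have "p * s m = p' * s m" using p(2)[OF m] p'(2)[OF m] by metis
  then have pp: "p = p'" using sm by auto
  show ?thesis
  proof (cases "i = m")
    case False
    have "sin (\<theta> i) = sin (\<theta>' i)" using p(2)[OF i] p'(2)[OF i] pp by simp
    moreover have "arcsin (sin (\<theta> i)) = \<theta> i" "arcsin (sin (\<theta>' i)) = \<theta>' i"
      using half[OF i False] \<theta>(1)[OF i] \<theta>'(1)[OF i] by (auto intro!: arcsin_sin)
    ultimately show ?thesis by metis
  qed (use eqm in simp)
qed

lemma angle_area_cong: "(\<And>i. i < n \<Longrightarrow> \<theta> i = \<theta>' i) \<Longrightarrow> angle_area n d \<theta> = angle_area n d \<theta>'"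
  by (simp add: angle_area_def)

text \<open>The area of a doubled segment. Opposite cosines over equal sides give two
  \<open>arccos\<close> values with sum \<pi>, and a zero side with zero angle contributes
  \<open>arccos 1 = 0\<close>.\<close>

lemma angle_area_two:
  assumes ik: "i < n" "k < n" "i \<noteq> k" and d: "d i = d k" and \<theta>: "\<theta> k = pi - \<theta> i"
    and rest: "\<And>j. j < n \<Longrightarrow> j \<noteq> i \<Longrightarrow> j \<noteq> k \<Longrightarrow> d j = 0 \<and> \<theta> j = 0"
  shows "angle_area n d \<theta> = 0"
proof -
  let ?f = "\<lambda>j. arccos (cos (\<theta> j) / cosh (d j / 2))"
  have "\<bar>cos (\<theta> i)\<bar> \<le> cosh (d i / 2)"
    using abs_cos_le_one[of "\<theta> i"] cosh_real_ge_1[of "d i / 2"] by linarith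
  then have "\<bar>cos (\<theta> i) / cosh (d i / 2)\<bar> \<le> 1" by (simp add: abs_divide)
  then have "arccos (- (cos (\<theta> i) / cosh (d i / 2))) = pi - ?f i"
    by (intro arccos_minus) (simp_all only: abs_le_iff, linarith+)
  then have "?f k = pi - ?f i" by (simp add: \<theta> d)
  moreover have "(\<Sum>j<n. ?f j) = (\<Sum>j\<in>{i, k}. ?f j)"
    using ik rest by (intro sum.mono_neutral_right) auto
  ultimately show ?thesis using ik by (simp add: angle_area_def)
qed

text \<open>Besides the horocyclic tuple there are other solutions only if all sides vanish or if
  exactly two sides are nonzero and these are equal. In both situations every solution gives area
  0.\<close>

lemma angle_area_degenerate:
  assumes s: "polygon_ineq n s" and sd: "\<And>i. i < n \<Longrightarrow> s i = sinh (d i / 2)"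
    and i: "i < n" "s i = (\<Sum>j\<in>{..<n} - {i}. s j)" and sol: "angle_sol n s \<theta>"
  shows "angle_area n d \<theta> = angle_area n d (\<lambda>j. if j = i then pi else 0)"
proof (cases "s i = 0")
  case True
  have nn: "0 \<le> s j" if "j < n" for j using s that by (simp add: polygon_ineq_def)
  have "(\<Sum>j\<in>{..<n} - {i}. s j) = 0" using True i by simp
  then have "s j = 0" if "j < n" for j
    using that nn True sum_nonneg_eq_0_iff[of "{..<n} - {i}" s] by (cases "j = i") auto
  then have d0: "d j = 0" if "j < n" for j using sd[OF that] that by simp
  \<comment> \<open>All sides are zero, so each summand is
    \<open>arccos (cos (\<eta> j)) = \<eta> j\<close> and only the angle sum matters.\<close>
  have "angle_area n d \<eta> = 2 * (\<Sum>j<n. \<eta> j) - 2 * pi" if "\<And>j. j < n \<Longrightarrow> 0 \<le> \<eta> j \<and> \<eta> j \<le> pi" for \<eta>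
    unfolding angle_area_def using d0 that by (simp add: arccos_cos)
  from this[of \<theta>] this[of "\<lambda>j. if j = i then pi else 0"] show ?thesis
    using sol i by (simp add: angle_sol_def)
next
  case False
  have nn: "0 \<le> s j" if "j < n" for j using s that by (simp add: polygon_ineq_def)
  then have si: "0 < s i" using False i by force
  obtain p where p: "0 \<le> p" "\<And>j. j < n \<Longrightarrow> sin (\<theta> j) = p * s j" using angle_sol_factor[OF sol i(1) si] by blast
  have two: "angle_area n d \<eta> = 0"
    if k: "k < n" "k \<noteq> i" "s k = s i" and \<eta>: "\<eta> k = pi - \<eta> i" "\<And>j. j < n \<Longrightarrow> j \<noteq> i \<Longrightarrow> j \<noteq> k \<Longrightarrow> \<eta> j = 0" for k \<eta>
  proof (rule angle_area_two[OF i(1) k(1) k(2)[symmetric] _ \<eta>(1)])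
    show "d i = d k" using sd[OF k(1)] sd[OF i(1)] k(3) by simp
    have "s k + (\<Sum>j\<in>{..<n} - {i} - {k}. s j) = s i" unfolding i(2) using k by (intro sum.remove[symmetric]) auto
    then have "(\<Sum>j\<in>{..<n} - {i} - {k}. s j) = 0" using k(3) by simp
    then have "s j = 0" if "j < n" "j \<noteq> i" "j \<noteq> k" for j
      using that nn sum_nonneg_eq_0_iff[of "{..<n} - {i} - {k}" s] by auto
    then show "d j = 0 \<and> \<eta> j = 0" if "j < n" "j \<noteq> i" "j \<noteq> k" for j using that \<eta>(2) sd[of j] by simp
  qed
  show ?thesis
  proof (cases "p = 0")
    case True
    then obtain k where k: "k < n" "\<And>j. j < n \<Longrightarrow> \<theta> j = (if j = k then pi else 0)" "s k = (\<Sum>j\<in>{..<n} - {k}. s j)"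
      using angle_sol_sin_zero[OF sol s] p(2) by auto
    show ?thesis
    proof (cases "k = i")
      case True
      then show ?thesis using k(2) by (intro angle_area_cong) simp
    next
      case False
      have "s k \<le> s i" using i(2) False k(1) nn member_le_sum[of k "{..<n} - {i}" s] by auto
      moreover have "s i \<le> s k" using k(3) False i(1) nn member_le_sum[of i "{..<n} - {k}" s] by auto
      ultimately have ks: "s k = s i" by simp
      have "angle_area n d \<theta> = 0" using k(1,2) i(1) False by (intro two[OF k(1) False ks]) auto
      moreover have "angle_area n d (\<lambda>j. if j = i then pi else 0) = 0" using False by (intro two[OF k(1) False ks]) auto
      ultimately show ?thesis by simp
    qed
  next
    case False
    then have p0: "0 < p" using p by simp
    let ?J = "{..<n} - {i}"
    have \<theta>: "0 \<le> \<theta> j \<and> \<theta> j \<le> pi" if "j < n" for j using sol that by (simp add: angle_sol_def)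
    have sum: "\<theta> i + (\<Sum>j\<in>?J. \<theta> j) = pi" using sol sum.remove[of "{..<n}" i \<theta>] i by (simp add: angle_sol_def)
    then have e: "(\<Sum>j\<in>?J. \<theta> j) = pi - \<theta> i" by simp
    have "sin (\<Sum>j\<in>?J. \<theta> j) = p * s i" unfolding e using p(2)[OF i(1)] by simp
    also have "\<dots> = (\<Sum>j\<in>?J. sin (\<theta> j))"
      unfolding i(2) sum_distrib_left by (intro sum.cong) (auto simp: p(2))
    finally have eq: "sin (\<Sum>j\<in>?J. \<theta> j) = (\<Sum>j\<in>?J. sin (\<theta> j))" .
    have "0 < sin (\<theta> i)" using p(2)[OF i(1)] p0 si by simp
    then have "\<theta> i \<noteq> 0" "\<theta> i \<noteq> pi" by auto
    then have \<theta>i: "0 < \<theta> i" "\<theta> i < pi" using \<theta>[OF i(1)] by auto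
    then have "0 < (\<Sum>j\<in>?J. \<theta> j)" using e by simp
    then obtain k where k: "k \<in> ?J" "0 < \<theta> k" by (metis (no_types, lifting) not_less sum_nonpos)
    \<comment> \<open>\<open>eq\<close> is equality in the subadditivity of sine, which a second
      positive angle would make strict.\<close>
    have z: "\<theta> j = 0" if "j \<in> ?J" "j \<noteq> k" for j
    proof (rule ccontr)
      assume "\<theta> j \<noteq> 0"
      then have "0 < \<theta> j" using \<theta>[of j] that by (auto simp: less_le)
      then have "sin (\<Sum>j\<in>?J. \<theta> j) < (\<Sum>j\<in>?J. sin (\<theta> j))"
        using that k \<theta> sum \<theta>i by (intro sin_sum_less[of _ _ j k]) auto
      then show False using eq by simp
    qed
    have "(\<Sum>j\<in>?J. \<theta> j) = (\<Sum>j\<in>{k}. \<theta> j)" using k z by (intro sum.mono_neutral_right) auto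
    then have \<theta>k: "\<theta> k = pi - \<theta> i" using e by simp
    have k': "k < n" "k \<noteq> i" using k by auto
    have "sin (\<theta> k) = sin (\<theta> i)" by (simp add: \<theta>k)
    then have "p * s k = p * s i" using p(2)[OF k'(1)] p(2)[OF i(1)] by metis
    then have ks: "s k = s i" using p0 by auto
    have "angle_area n d \<theta> = 0" using z by (intro two[OF k' ks \<theta>k]) auto
    moreover have "angle_area n d (\<lambda>j. if j = i then pi else 0) = 0" using k' by (intro two[OF k' ks]) auto
    ultimately show ?thesis by simp
  qed
qed

lemma angle_sol_strict_factor:
  assumes n: "0 < n" and s: "polygon_ineq n s" and strict: "\<And>i. i < n \<Longrightarrow> s i < (\<Sum>j\<in>{..<n} - {i}. s j)"
    and sol: "angle_sol n s \<theta>"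
  obtains p where "0 < p" "\<And>i. i < n \<Longrightarrow> sin (\<theta> i) = p * s i"
proof -
  have "0 < (\<Sum>j\<in>{..<n} - {0}. s j)" using strict[OF n] s n by (force simp: polygon_ineq_def)
  then obtain a where a: "a \<in> {..<n} - {0}" "0 < s a" by (metis (no_types, lifting) not_less sum_nonpos)
  obtain p where p: "0 \<le> p" "\<And>j. j < n \<Longrightarrow> sin (\<theta> j) = p * s j"
    using angle_sol_factor[OF sol _ a(2)] a by blast
  have "p \<noteq> 0"
  proof
    assume "p = 0"
    then have z: "\<And>j. j < n \<Longrightarrow> sin (\<theta> j) = 0" using p(2) by simp
    obtain k where "k < n" "s k = (\<Sum>j\<in>{..<n} - {k}. s j)" using angle_sol_sin_zero[OF sol s z] by blast
    then show False using strict by force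
  qed
  then have "0 < p" using p(1) by simp
  then show ?thesis using p(2) by (rule that)
qed

text \<open>Under strict inequalities the tuple itself is unique on the relevant indices; on the
  boundary only its area is.\<close>

proposition angle_area_unique:
  assumes n: "0 < n" and s: "polygon_ineq n s" and sd: "\<And>i. i < n \<Longrightarrow> s i = sinh (d i / 2)"
    and sol: "angle_sol n s \<theta>" "angle_sol n s \<theta>'"
  shows "angle_area n d \<theta> = angle_area n d \<theta>'"
proof (cases "\<exists>i<n. s i = (\<Sum>j\<in>{..<n} - {i}. s j)")
  case True
  then show ?thesis using angle_area_degenerate[OF s sd] sol by metis
next
  case False
  have nn: "0 \<le> s i" if "i < n" for i using s that by (simp add: polygon_ineq_def)
  have strict: "s i < (\<Sum>j\<in>{..<n} - {i}. s j)" if "i < n" for i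
    using False s that by (auto simp: polygon_ineq_def less_le)
  obtain p where p: "0 < p" "\<And>i. i < n \<Longrightarrow> sin (\<theta> i) = p * s i"
    using angle_sol_strict_factor[OF n s strict sol(1)] by blast
  obtain p' where p': "0 < p'" "\<And>i. i < n \<Longrightarrow> sin (\<theta>' i) = p' * s i"
    using angle_sol_strict_factor[OF n s strict sol(2)] by blast
  show ?thesis
    using sol by (intro angle_area_cong angle_sol_unique[OF nn strict n p p']) (auto simp: angle_sol_def)
qed

section \<open>Extension to the closure\<close>

abbreviation half_sinh :: "(nat \<Rightarrow> real) \<Rightarrow> nat \<Rightarrow> real" where
  "half_sinh d \<equiv> \<lambda>i. sinh (d i / 2)"

definition closed_AC :: "nat \<Rightarrow> (nat \<Rightarrow> real) set" where
  "closed_AC n = {d. (\<forall>i\<ge>n. d i = 0) \<and> polygon_ineq n (half_sinh d)}"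

lemma sum_others:
  fixes f :: "nat \<Rightarrow> real"
  shows "i < n \<Longrightarrow> (\<Sum>j\<in>{..<n} - {i}. f j) = (\<Sum>j<n. f j) - f i"
  by (simp add: sum_diff1)

lemma nonneg_orthant_eq:
  "nonneg_orthant n = top_of_set {d. (\<forall>i\<ge>n. d i = 0) \<and> (\<forall>i<n. 0 \<le> d i)}"
  by (simp add: nonneg_orthant_def Euclidean_space_def euclidean_product_topology subtopology_subtopology Int_def)

lemma AC_iff:
  "d \<in> AC n \<longleftrightarrow> (\<forall>i\<ge>n. d i = 0) \<and> (\<forall>i<n. 0 < d i \<and> sinh (d i / 2) < (\<Sum>j\<in>{..<n} - {i}. sinh (d j / 2)))"
  by (auto simp: AC_def pos_orthant_def topspace_Euclidean_space)

lemma AC_subset_closed_AC: "AC n \<subseteq> closed_AC n"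
  by (auto simp: AC_iff closed_AC_def polygon_ineq_def less_imp_le)

lemma continuous_on_coord: "continuous_on A (\<lambda>x. x i)"
  by (rule continuous_on_product_then_coordinatewise[OF continuous_on_id])

lemma closed_closed_AC: "closed (closed_AC n)"
  unfolding closed_AC_def polygon_ineq_def
  by (intro closed_Collect_conj closed_Collect_all closed_Collect_imp open_Collect_const closed_Collect_le
      closed_Collect_eq continuous_intros continuous_on_coord) auto

lemma closure_of_AC:
  assumes n: "n \<ge> 3"
  shows "nonneg_orthant n closure_of AC n = closed_AC n"
proof -
  let ?X = "{d. (\<forall>i\<ge>n. d i = 0) \<and> (\<forall>i<n. 0 \<le> d i)}"
  have "AC n \<subseteq> ?X" by (auto simp: AC_iff less_imp_le)
  then have e: "nonneg_orthant n closure_of AC n = ?X \<inter> closure (AC n)"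
    by (simp add: nonneg_orthant_eq closure_of_subtopology Int_absorb1)
  have sub1: "closure (AC n) \<subseteq> closed_AC n"
    by (rule closure_minimal[OF AC_subset_closed_AC closed_closed_AC])
  have sub2: "closed_AC n \<subseteq> closure (AC n)"
  proof
    fix d assume d: "d \<in> closed_AC n"
    \<comment> \<open>Adding \<open>t\<close> to every half-side hyperbolic sine adds
      \<open>t\<close> to the left of each inequality and \<open>(n - 1) * t\<close> to the right.
      As \<open>n - 1 > 1\<close>, all inequalities become strict and all sides positive, and
      \<open>g 0 = d\<close>.\<close>
    define g where "g t = (\<lambda>i. if i < n then 2 * arsinh (sinh (d i / 2) + t) else 0)" for t :: real
    have "g t \<in> AC n" if "t > 0" for t
    proof -
      have "sinh (d i / 2) + t < (\<Sum>j\<in>{..<n} - {i}. sinh (d j / 2) + t)" "0 < sinh (d i / 2) + t" if i: "i < n" for i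
      proof -
        have "1 * t < real (n - 1) * t" using n \<open>t > 0\<close> by (intro mult_strict_right_mono) auto
        moreover have "(\<Sum>j\<in>{..<n} - {i}. sinh (d j / 2) + t) = (\<Sum>j\<in>{..<n} - {i}. sinh (d j / 2)) + real (n - 1) * t"
          using i by (simp add: sum.distrib)
        moreover have "sinh (d i / 2) \<le> (\<Sum>j\<in>{..<n} - {i}. sinh (d j / 2))" "0 \<le> sinh (d i / 2)"
          using d i unfolding closed_AC_def polygon_ineq_def by blast+
        ultimately show "sinh (d i / 2) + t < (\<Sum>j\<in>{..<n} - {i}. sinh (d j / 2) + t)" "0 < sinh (d i / 2) + t"
          using \<open>t > 0\<close> by linarith+
      qed
      moreover have "(\<Sum>j\<in>{..<n} - {i}. sinh (g t j / 2)) = (\<Sum>j\<in>{..<n} - {i}. sinh (d j / 2) + t)" for i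
        by (intro sum.cong) (auto simp: g_def)
      ultimately show ?thesis by (auto simp: AC_iff g_def)
    qed
    then have "g ` {0<..} \<subseteq> closure (AC n)" using closure_subset[of "AC n"] by auto
    moreover have "continuous_on A (\<lambda>t. g t i)" for A i
      by (cases "i < n") (auto simp: g_def intro!: continuous_intros)
    then have "continuous_on (closure {0<..}) g" by (rule continuous_on_coordinatewise_then_product)
    ultimately have "g ` closure {0<..} \<subseteq> closure (AC n)"
      by (intro image_closure_subset closed_closure)
    moreover have "(0::real) \<in> closure {0<..}" by simp
    moreover have "g 0 = d" using d by (auto simp: g_def fun_eq_iff closed_AC_def arsinh_sinh_real not_less)
    ultimately show "d \<in> closure (AC n)" by (metis image_subset_iff)
  qed
  have sub3: "closed_AC n \<subseteq> ?X" by (auto simp: closed_AC_def polygon_ineq_def)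
  show ?thesis
    unfolding e by (rule equalityI[OF le_infI2[OF sub1] Int_greatest[OF sub3 sub2]])
qed

text \<open>Any solution may be chosen: on \<open>closed_AC n\<close> with \<open>n > 0\<close> the
  value is independent of it by \<open>angle_area_unique\<close>.\<close>

definition extended_area :: "nat \<Rightarrow> (nat \<Rightarrow> real) \<Rightarrow> real" where
  "extended_area n d = angle_area n d (SOME \<theta>. angle_sol n (half_sinh d) \<theta>)"

lemma extended_area_eq:
  assumes "0 < n" "polygon_ineq n (half_sinh d)" "angle_sol n (half_sinh d) \<theta>"
  shows "extended_area n d = angle_area n d \<theta>"
  unfolding extended_area_def
  by (rule angle_area_unique[OF assms(1,2) refl _ assms(3)]) (rule someI[of _ \<theta>], rule assms(3))

lemma angle_sol_cong:
  assumes "\<And>i. i < n \<Longrightarrow> \<theta> i = \<theta>' i" shows "angle_sol n s \<theta> \<longleftrightarrow> angle_sol n s \<theta>'"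
  using assms by (simp add: angle_sol_def)

text \<open>Preimages of closed sets are projections of closed sets along the compact space of angle
  tuples.\<close>

lemma continuous_on_extended_area:
  assumes n: "0 < n" shows "continuous_on (closed_AC n) (extended_area n)"
  unfolding continuous_closedin_preimage_eq
proof (intro allI impI)
  fix T :: "real set" assume T: "closed T"
  \<comment> \<open>A product over all natural numbers, compact by Tychonoff; coordinates from
    \<open>n\<close> on are kept in it although \<open>angle_sol n\<close> does not see
    them.\<close>
  define K :: "(nat \<Rightarrow> real) set" where "K = PiE UNIV (\<lambda>_. {0..pi})"
  have "compactin (product_topology (\<lambda>_. euclidean) UNIV) K"
    unfolding K_def compactin_PiE by simp
  then have K: "compact_space (top_of_set K)"
    by (intro compact_space_subtopology) (simp add: euclidean_product_topology)
  define G :: "((nat \<Rightarrow> real) \<times> (nat \<Rightarrow> real)) set" where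
    "G = {p. angle_sol n (half_sinh (snd p)) (fst p) \<and> angle_area n (snd p) (fst p) \<in> T}"
  have cf: "continuous_on UNIV (\<lambda>p::(nat \<Rightarrow> real) \<times> (nat \<Rightarrow> real). fst p i)" for i
    by (rule continuous_on_product_then_coordinatewise[OF continuous_on_fst[OF continuous_on_id]])
  have cs: "continuous_on UNIV (\<lambda>p::(nat \<Rightarrow> real) \<times> (nat \<Rightarrow> real). snd p i)" for i
    by (rule continuous_on_product_then_coordinatewise[OF continuous_on_snd[OF continuous_on_id]])
  have b: "\<bar>cos x / cosh y\<bar> \<le> 1" for x y :: real
  proof -
    have "\<bar>cos x\<bar> \<le> cosh y" using abs_cos_le_one[of x] cosh_real_ge_1[of y] by linarith
    then show ?thesis by (simp add: abs_divide)
  qed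
  then have b': "- 1 \<le> cos x / cosh y" "cos x / cosh y \<le> 1" for x y :: real
    unfolding abs_le_iff by (metis minus_le_iff)+
  have "closed {p::(nat \<Rightarrow> real) \<times> (nat \<Rightarrow> real). angle_sol n (half_sinh (snd p)) (fst p)}"
    unfolding angle_sol_def
    by (intro closed_Collect_conj closed_Collect_all closed_Collect_imp open_Collect_const closed_Collect_le
      closed_Collect_eq continuous_intros cf cs) auto
  moreover have "continuous_on UNIV (\<lambda>p::(nat \<Rightarrow> real) \<times> (nat \<Rightarrow> real). angle_area n (snd p) (fst p))"
    unfolding angle_area_def
    by (intro continuous_intros cf cs ballI conjI b') auto
  then have "closed {p::(nat \<Rightarrow> real) \<times> (nat \<Rightarrow> real). angle_area n (snd p) (fst p) \<in> T}"
    using closed_vimage[OF T] by (simp add: vimage_def)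
  ultimately have "closed G" unfolding G_def by (intro closed_Collect_conj)
  then have "closedin (prod_topology (top_of_set K) (top_of_set (closed_AC n))) ((K \<times> closed_AC n) \<inter> G)"
    by (simp add: closedin_closed_Int)
  then have "closedin (top_of_set (closed_AC n)) (snd ` ((K \<times> closed_AC n) \<inter> G))"
    using closed_map_snd[OF K] unfolding closed_map_def by blast
  moreover have "snd ` ((K \<times> closed_AC n) \<inter> G) = closed_AC n \<inter> extended_area n -` T"
  proof
    show "snd ` ((K \<times> closed_AC n) \<inter> G) \<subseteq> closed_AC n \<inter> extended_area n -` T"
    proof
      fix d assume "d \<in> snd ` ((K \<times> closed_AC n) \<inter> G)"
      then obtain \<theta> where "d \<in> closed_AC n" "angle_sol n (half_sinh d) \<theta>" "angle_area n d \<theta> \<in> T"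
        by (auto simp: G_def)
      then show "d \<in> closed_AC n \<inter> extended_area n -` T"
        using extended_area_eq[OF n, of d \<theta>] by (simp add: closed_AC_def)
    qed
    show "closed_AC n \<inter> extended_area n -` T \<subseteq> snd ` ((K \<times> closed_AC n) \<inter> G)"
    proof
      fix d assume d: "d \<in> closed_AC n \<inter> extended_area n -` T"
      then have pi: "polygon_ineq n (half_sinh d)" by (simp add: closed_AC_def)
      then obtain \<theta>0 where \<theta>0: "angle_sol n (half_sinh d) \<theta>0" using angle_sol_exists[OF n] by blast
      \<comment> \<open>The coordinates from \<open>n\<close> on are arbitrary in
        \<open>\<theta>0\<close>; setting them to 0 puts the tuple into \<open>K\<close>.\<close>
      define \<theta> where "\<theta> = (\<lambda>i. if i < n then \<theta>0 i else 0)"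
      have \<theta>: "angle_sol n (half_sinh d) \<theta>"
        using \<theta>0 angle_sol_cong[of n \<theta> \<theta>0] by (simp add: \<theta>_def)
      have "\<theta> \<in> K" using \<theta>0 by (auto simp: K_def \<theta>_def angle_sol_def)
      moreover have "angle_area n d \<theta> \<in> T" using extended_area_eq[OF n pi \<theta>] d by simp
      ultimately have "(\<theta>, d) \<in> (K \<times> closed_AC n) \<inter> G" using \<theta> d by (simp add: G_def)
      then show "d \<in> snd ` ((K \<times> closed_AC n) \<inter> G)" by force
    qed
  qed
  ultimately show "closedin (top_of_set (closed_AC n)) (closed_AC n \<inter> extended_area n -` T)" by simp
qed

text \<open>Justifies the definite description in \<open>cyclic_area\<close>: the angles of every
  cyclic polygon with these sides form a solution, so all such polygons have the same area, and the
  given solution supplies a polygon.\<close>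

lemma cyclic_area_AC:
  assumes n: "n \<ge> 3" and d: "d \<in> AC n" and sol: "angle_sol n (half_sinh d) \<theta>"
  shows "cyclic_area n d = angle_area n d \<theta>" "0 < angle_area n d \<theta>"
proof -
  have n0: "0 < n" using n by simp
  have pos: "0 < d i" and strict: "half_sinh d i < (\<Sum>j\<in>{..<n} - {i}. half_sinh d j)" if "i < n" for i
    using d that by (auto simp: AC_iff)
  have pi: "polygon_ineq n (half_sinh d)" using AC_subset_closed_AC d by (auto simp: closed_AC_def)
  have ngon: "harea (hconvex_hull (x ` {..<n})) = angle_area n d \<theta> \<and> 0 < angle_area n d \<theta>"
    if x: "cyclic_ngon n x d" for x
  proof (rule cyclic_ngon_angles[OF n pos x])
    fix \<eta> \<rho>
    assume \<rho>: "0 < \<rho>" and \<eta>: "\<And>i. i < n \<Longrightarrow> 0 < \<eta> i \<and> \<eta> i < pi" "(\<Sum>i<n. \<eta> i) = pi"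
      and s: "\<And>i. i < n \<Longrightarrow> sinh (d i / 2) = \<rho> * sin (\<eta> i)"
      and a: "harea (hconvex_hull (x ` {..<n})) = angle_area n d \<eta>" "0 < angle_area n d \<eta>"
    have "angle_sol n (half_sinh d) \<eta>"
      using \<rho> \<eta> s by (intro angle_sol_of_proportional[of "1 / \<rho>"]) (auto simp: less_imp_le)
    then have "angle_area n d \<eta> = angle_area n d \<theta>" using angle_area_unique[OF n0 pi refl _ sol] by blast
    then show "harea (hconvex_hull (x ` {..<n})) = angle_area n d \<theta> \<and> 0 < angle_area n d \<theta>" using a by simp
  qed
  obtain p where p: "0 < p" "\<And>i. i < n \<Longrightarrow> sin (\<theta> i) = p * half_sinh d i"
    using angle_sol_strict_factor[OF n0 pi strict sol] by blast
  have \<theta>: "0 < \<theta> i \<and> \<theta> i < pi" if "i < n" for i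
  proof -
    have "0 < sin (\<theta> i)" using p pos[OF that] that by simp
    then have "\<theta> i \<noteq> 0" "\<theta> i \<noteq> pi" by auto
    then show ?thesis using sol that unfolding angle_sol_def by (auto simp: less_le)
  qed
  have "\<exists>x. cyclic_ngon n x d"
  proof (rule cyclic_ngon_exists[OF n pos _ \<theta>])
    show "0 < 1 / p" using p by simp
    show "(\<Sum>i<n. \<theta> i) = pi" using sol by (simp add: angle_sol_def)
    show "sinh (d i / 2) = 1 / p * sin (\<theta> i)" if "i < n" for i using p that by simp
  qed auto
  then obtain x where x: "cyclic_ngon n x d" by blast
  show "0 < angle_area n d \<theta>" using ngon[OF x] by simp
  show "cyclic_area n d = angle_area n d \<theta>"
    unfolding cyclic_area_def
  proof (rule the_equality)
    show "\<exists>x. cyclic_ngon n x d \<and> angle_area n d \<theta> = harea (hconvex_hull (x ` {..<n}))"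
      using x ngon by metis
    show "a = angle_area n d \<theta>" if "\<exists>x. cyclic_ngon n x d \<and> a = harea (hconvex_hull (x ` {..<n}))" for a
      using that ngon by metis
  qed
qed

lemma horocyclic_area_HC:
  assumes n: "n \<ge> 3" and d: "d \<in> HC n"
  obtains i where "i < n" "half_sinh d i = (\<Sum>j\<in>{..<n} - {i}. half_sinh d j)"
    "polygon_ineq n (half_sinh d)" "horocyclic_area n d = angle_area n d (\<lambda>j. if j = i then pi else 0)"
proof -
  have pos: "0 < d i" if "i < n" for i using d that by (simp add: HC_def pos_orthant_def)
  obtain k where k: "k < n" "d k = Max (d ` {..<n})" and sk: "half_sinh d k = (\<Sum>i\<in>{..<n} - {k}. half_sinh d i)"
    using d by (auto simp: HC_def)
  have le: "d i \<le> d k" if "i < n" for i unfolding k(2) using that by (intro Max_ge) auto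
  have lt: "d i < d k" if i: "i < n" "i \<noteq> k" for i
  proof -
    \<comment> \<open>With \<open>n \<ge> 3\<close> there is a third side; being positive, it makes
      the longest side strictly longer than side \<open>i\<close>, so the index of the maximum is
      unique.\<close>
    have "\<exists>l\<in>{0, 1, 2}. l \<noteq> i \<and> l \<noteq> k" by force
    then obtain l where l: "l \<in> {0, 1, 2}" "l \<noteq> i" "l \<noteq> k" by blast
    then have ln: "l < n" using n by auto
    have "(\<Sum>j\<in>{i, l}. half_sinh d j) \<le> half_sinh d k"
      unfolding sk using i l ln pos by (intro sum_mono2) (auto simp: less_imp_le)
    then have "half_sinh d i + half_sinh d l \<le> half_sinh d k" using l by simp
    moreover have "0 < half_sinh d l" using pos[OF ln] by simp
    ultimately have "half_sinh d i < half_sinh d k" by linarith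
    then show ?thesis by simp
  qed
  have the: "(THE i. i < n \<and> d i = Max (d ` {..<n})) = k"
    using k lt by (intro the_equality) (auto simp: k(2)[symmetric] dest: less_imp_neq)
  have pineq: "polygon_ineq n (half_sinh d)"
    unfolding polygon_ineq_def
  proof (intro allI impI conjI)
    fix i assume i: "i < n"
    show "0 \<le> half_sinh d i" using pos[OF i] by simp
    show "half_sinh d i \<le> (\<Sum>j\<in>{..<n} - {i}. half_sinh d j)"
    proof (cases "i = k")
      case False
      have "half_sinh d i \<le> half_sinh d k" using lt[OF i False] by simp
      also have "\<dots> \<le> (\<Sum>j\<in>{..<n} - {i}. half_sinh d j)"
        using k False pos by (intro member_le_sum) (auto simp: less_imp_le)
      finally show ?thesis .
    qed (use sk in simp)
  qed
  \<comment> \<open>Each of the \<open>n\<close> terms contributes \<open>pi / 2\<close>, which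
    after doubling and subtracting \<open>2 * pi\<close> gives \<open>(n - 2) * pi\<close>; the sign
    of the \<open>arcsin\<close> flips at the long side because \<open>cos pi = -1\<close>.\<close>
  have ac: "arccos (1 / cosh x) = pi / 2 - arcsin (1 / cosh x)" "arccos (- (1 / cosh x)) = pi / 2 + arcsin (1 / cosh x)" for x :: real
  proof -
    have "1 / cosh x \<le> 1" "0 < 1 / cosh x" using cosh_real_ge_1[of x] cosh_real_pos[of x] by auto
    then have b: "- 1 \<le> 1 / cosh x" "1 / cosh x \<le> 1" by linarith+
    show 1: "arccos (1 / cosh x) = pi / 2 - arcsin (1 / cosh x)" by (rule arccos_arcsin_eq[OF b])
    have "arccos (- (1 / cosh x)) = pi - arccos (1 / cosh x)" by (rule arccos_minus[OF b])
    then show "arccos (- (1 / cosh x)) = pi / 2 + arcsin (1 / cosh x)" using 1 by simp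
  qed
  let ?\<theta> = "\<lambda>j. if j = k then pi else 0"
  have "(\<Sum>j<n. arccos (cos (?\<theta> j) / cosh (d j / 2))) =
      arccos (cos (?\<theta> k) / cosh (d k / 2)) + (\<Sum>j\<in>{..<n} - {k}. arccos (cos (?\<theta> j) / cosh (d j / 2)))"
    using k by (intro sum.remove) auto
  also have "(\<Sum>j\<in>{..<n} - {k}. arccos (cos (?\<theta> j) / cosh (d j / 2))) = (\<Sum>j\<in>{..<n} - {k}. pi / 2 - arcsin (1 / cosh (d j / 2)))"
    by (intro sum.cong) (auto simp: ac)
  also have "\<dots> = real (n - 1) * (pi / 2) - (\<Sum>j\<in>{..<n} - {k}. arcsin (1 / cosh (d j / 2)))"
    using k by (simp add: sum_subtractf)
  finally have "angle_area n d ?\<theta> = 2 * (pi / 2 + arcsin (1 / cosh (d k / 2)) + (real (n - 1) * (pi / 2) - (\<Sum>j\<in>{..<n} - {k}. arcsin (1 / cosh (d j / 2))))) - 2 * pi"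
    by (simp add: angle_area_def ac)
  moreover have "real (n - 1) = real n - 1" using n by simp
  ultimately have "horocyclic_area n d = angle_area n d ?\<theta>"
    unfolding horocyclic_area_def the Let_def by (simp only:) (simp add: right_diff_distrib left_diff_distrib diff_divide_distrib distrib_left)
  then show ?thesis using that k sk pineq by blast
qed

section \<open>Inserting sides of length zero\<close>

lemma phi_nth:
  assumes "I \<in> Idx m n" "j < m" shows "phi I x (I ! j) = x j"
proof -
  have I: "length I = m" "distinct I" using assms by (auto simp: Idx_def strict_sorted_iff)
  then have "(THE l. l < length I \<and> I ! l = I ! j) = j"
    using assms(2) by (intro the_equality) (auto simp: nth_eq_iff_index_eq)
  then show ?thesis using I assms(2) by (simp add: phi_def)
qed

lemma phi_outside: "i \<notin> set I \<Longrightarrow> phi I x i = 0"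
  by (simp add: phi_def)

lemma phi_comp:
  assumes "g 0 = 0" shows "phi I (\<lambda>j. g (x j)) = (\<lambda>i. g (phi I x i))"
  using assms by (auto simp: phi_def)

lemma set_IdxE:
  assumes "I \<in> Idx m n" "i \<in> set I" obtains j where "j < m" "i = I ! j"
  using assms by (auto simp: Idx_def in_set_conv_nth)

lemma sum_Idx:
  fixes f :: "nat \<Rightarrow> real"
  assumes I: "I \<in> Idx m n" and "\<And>i. i < n \<Longrightarrow> i \<notin> set I \<Longrightarrow> f i = 0"
  shows "(\<Sum>i<n. f i) = (\<Sum>j<m. f (I ! j))"
proof -
  have "(\<Sum>i<n. f i) = (\<Sum>i\<in>set I. f i)"
    using assms by (intro sum.mono_neutral_right) (auto simp: Idx_def)
  also have "\<dots> = (\<Sum>j<m. f (I ! j))"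
    using I by (intro sum.reindex_bij_betw[symmetric] bij_betw_nth) (auto simp: Idx_def strict_sorted_iff)
  finally show ?thesis .
qed

lemma sum_phi: "I \<in> Idx m n \<Longrightarrow> (\<Sum>i<n. phi I s i) = (\<Sum>j<m. s j)"
  using sum_Idx[of I m n "phi I s"] by (simp add: phi_outside phi_nth)

text \<open>Each inequality compares an entry with the total minus that entry, and zeros do not
  change the total.\<close>

lemma polygon_ineq_phi:
  assumes I: "I \<in> Idx m n" and s: "polygon_ineq m s" shows "polygon_ineq n (phi I s)"
proof -
  have tot: "0 \<le> (\<Sum>j<m. s j)" using s by (intro sum_nonneg) (auto simp: polygon_ineq_def)
  have "0 \<le> phi I s i \<and> phi I s i \<le> (\<Sum>j<m. s j) - phi I s i" for i
  proof (cases "i \<in> set I")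
    case True
    then obtain j where j: "j < m" "i = I ! j" using set_IdxE[OF I] by blast
    then have "0 \<le> s j" "s j \<le> (\<Sum>j<m. s j) - s j"
      using s sum_others[of j m s] by (auto simp: polygon_ineq_def)
    then show ?thesis using j phi_nth[OF I] by simp
  qed (use tot in \<open>simp add: phi_outside\<close>)
  then show ?thesis by (simp add: polygon_ineq_def sum_others sum_phi[OF I])
qed

text \<open>Inserted sides receive the angle 0. At such an index the last condition of
  \<open>angle_sol\<close> only says that the total of the entries is nonnegative.\<close>

lemma angle_sol_phi:
  assumes I: "I \<in> Idx m n" and s: "polygon_ineq m s" and sol: "angle_sol m s \<theta>"
  shows "angle_sol n (phi I s) (phi I \<theta>)"
proof -
  have tot: "0 \<le> (\<Sum>j<m. s j)" using s by (intro sum_nonneg) (auto simp: polygon_ineq_def)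
  have e: "phi I s i = 0 \<and> phi I \<theta> i = 0 \<or> (\<exists>j<m. phi I s i = s j \<and> phi I \<theta> i = \<theta> j)" for i
  proof (cases "i \<in> set I")
    case True
    then obtain j where "j < m" "i = I ! j" using set_IdxE[OF I] by blast
    then show ?thesis using phi_nth[OF I] by auto
  qed (simp add: phi_outside)
  have 1: "0 \<le> phi I \<theta> i \<and> phi I \<theta> i \<le> pi" for i
    using e[of i] sol by (auto simp: angle_sol_def)
  have 2: "phi I s k * sin (phi I \<theta> i) = phi I s i * sin (phi I \<theta> k)" for i k
    using e[of i] e[of k] sol by (auto simp: angle_sol_def)
  have 3: "- cos (phi I \<theta> i) * ((\<Sum>j<m. s j) - phi I s i) \<le> phi I s i" for i
    using e[of i]
  proof (elim disjE exE conjE)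
    fix j assume j: "j < m" "phi I s i = s j" "phi I \<theta> i = \<theta> j"
    have "- cos (\<theta> j) * (\<Sum>l\<in>{..<m} - {j}. s l) \<le> s j" using sol j(1) unfolding angle_sol_def by blast
    then show ?thesis unfolding sum_others[OF j(1)] j(2,3) .
  qed (use tot in simp)
  have 4: "(\<Sum>i<n. phi I \<theta> i) = pi" using sol by (simp add: sum_phi[OF I] angle_sol_def)
  show ?thesis unfolding angle_sol_def using 1 2 3 4 by (auto simp: sum_others sum_phi[OF I])
qed

lemma angle_area_phi:
  assumes I: "I \<in> Idx m n" shows "angle_area n (phi I d) (phi I \<theta>) = angle_area m d \<theta>"
proof -
  have "(\<Sum>i<n. arccos (cos (phi I \<theta> i) / cosh (phi I d i / 2))) =
      (\<Sum>j<m. arccos (cos (phi I \<theta> (I ! j)) / cosh (phi I d (I ! j) / 2)))"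
    by (rule sum_Idx[OF I]) (simp add: phi_outside)
  then show ?thesis by (simp add: angle_area_def phi_nth[OF I])
qed

lemma extended_area_phi:
  assumes n: "0 < n" and I: "I \<in> Idx m n" and s: "polygon_ineq m (half_sinh x)" and sol: "angle_sol m (half_sinh x) \<theta>"
  shows "phi I x \<in> closed_AC n" "extended_area n (phi I x) = angle_area m x \<theta>"
proof -
  have e: "phi I (half_sinh x) = half_sinh (phi I x)"
    using phi_comp[of "\<lambda>t. sinh (t / 2)" I x] by simp
  have p: "polygon_ineq n (half_sinh (phi I x))" using polygon_ineq_phi[OF I s] e by simp
  have "phi I x i = 0" if "i \<ge> n" for i using I that by (intro phi_outside) (auto simp: Idx_def)
  then show "phi I x \<in> closed_AC n" using p by (simp add: closed_AC_def)
  have "angle_sol n (half_sinh (phi I x)) (phi I \<theta>)" using angle_sol_phi[OF I s sol] e by simp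
  then show "extended_area n (phi I x) = angle_area m x \<theta>"
    using extended_area_eq[OF n p] angle_area_phi[OF I] by simp
qed

text \<open>Treats circular and horocyclic polygons alike, so that the compatibility with
  \<open>phi\<close> needs no case distinction.\<close>

lemma D0_eq_angle_area:
  assumes m: "m \<ge> 3" and x: "x \<in> AC m \<union> HC m"
  obtains \<theta> where "polygon_ineq m (half_sinh x)" "angle_sol m (half_sinh x) \<theta>" "D0 m x = angle_area m x \<theta>"
proof (cases "x \<in> AC m")
  case True
  then have p: "polygon_ineq m (half_sinh x)" using AC_subset_closed_AC by (auto simp: closed_AC_def)
  then obtain \<theta> where sol: "angle_sol m (half_sinh x) \<theta>" using angle_sol_exists[of m] m by auto
  then show ?thesis using that p cyclic_area_AC[OF m True sol] True by (simp add: D0_def)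
next
  case False
  then have "x \<in> HC m" using x by simp
  then obtain i where "i < m" "half_sinh x i = (\<Sum>j\<in>{..<m} - {i}. half_sinh x j)"
    "polygon_ineq m (half_sinh x)" "horocyclic_area m x = angle_area m x (\<lambda>j. if j = i then pi else 0)"
    using horocyclic_area_HC[OF m] by blast
  then show ?thesis
    using False by (intro that[of "\<lambda>j. if j = i then pi else 0"] angle_sol_degenerate) (auto simp: D0_def)
qed

theorem corollary5p5:
  fixes n :: nat
  assumes "n \<ge> 3"
  shows "D0 n \<in> AC n \<rightarrow> {0<..} \<and>
    (\<exists>F :: (nat \<Rightarrow> real) \<Rightarrow> real.
       continuous_map (subtopology (nonneg_orthant n) (nonneg_orthant n closure_of AC n))
         euclideanreal F \<and>
       (\<forall>d\<in>AC n. F d = D0 n d) \<and>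
       (\<forall>m I. 2 < m \<and> m < n \<and> I \<in> Idx m n \<longrightarrow>
          (\<forall>x\<in>AC m \<union> HC m. phi I x \<in> nonneg_orthant n closure_of AC n \<and>
             F (phi I x) = D0 m x)) \<and>
       (\<forall>I\<in>Idx 2 n. \<forall>x\<in>Delta. phi I x \<in> nonneg_orthant n closure_of AC n \<and>
          F (phi I x) = 0))"
proof (intro conjI exI[of _ "extended_area n"] ballI allI impI)
  have n0: "0 < n" using assms by simp
  note cl = closure_of_AC[OF assms]
  show "D0 n \<in> AC n \<rightarrow> {0<..}"
  proof
    fix d assume d: "d \<in> AC n"
    then have "polygon_ineq n (half_sinh d)" using AC_subset_closed_AC by (auto simp: closed_AC_def)
    then obtain \<theta> where "angle_sol n (half_sinh d) \<theta>" using angle_sol_exists[OF n0] by blast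
    then show "D0 n d \<in> {0<..}" using cyclic_area_AC[OF assms d] d by (simp add: D0_def)
  qed
  have "closed_AC n \<subseteq> {d. (\<forall>i\<ge>n. d i = 0) \<and> (\<forall>i<n. 0 \<le> d i)}" by (auto simp: closed_AC_def polygon_ineq_def)
  then have "subtopology (nonneg_orthant n) (closed_AC n) = top_of_set (closed_AC n)"
    by (simp add: nonneg_orthant_eq subtopology_subtopology Int_absorb1)
  then show "continuous_map (subtopology (nonneg_orthant n) (nonneg_orthant n closure_of AC n)) euclideanreal (extended_area n)"
    using continuous_on_extended_area[OF n0] by (simp add: cl)
  show "extended_area n d = D0 n d" if d: "d \<in> AC n" for d
  proof -
    obtain \<theta> where "polygon_ineq n (half_sinh d)" "angle_sol n (half_sinh d) \<theta>" "D0 n d = angle_area n d \<theta>"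
      using D0_eq_angle_area[OF assms, of d] d by blast
    then show ?thesis using extended_area_eq[OF n0] by simp
  qed
  fix m I x assume mI: "2 < m \<and> m < n \<and> I \<in> Idx m n" and x: "x \<in> AC m \<union> HC m"
  then have m3: "m \<ge> 3" and I: "I \<in> Idx m n" by auto
  obtain \<theta> where \<theta>: "polygon_ineq m (half_sinh x)" "angle_sol m (half_sinh x) \<theta>" "D0 m x = angle_area m x \<theta>"
    using D0_eq_angle_area[OF m3 x] by blast
  show "phi I x \<in> nonneg_orthant n closure_of AC n" "extended_area n (phi I x) = D0 m x"
    using extended_area_phi[OF n0 I \<theta>(1,2)] \<theta>(3) cl by auto
next
  have n0: "0 < n" using assms by simp
  note cl = closure_of_AC[OF assms]
  fix I x assume I: "I \<in> Idx 2 n" and x: "x \<in> Delta"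
  have x01: "0 \<le> x 0" "x 1 = x 0" using x by (auto simp: Delta_def)
  have less2: "i < 2 \<longleftrightarrow> i = 0 \<or> i = 1" for i :: nat by auto
  have set2: "{..<2::nat} - {0} = {1}" "{..<2::nat} - {1} = {0}" by auto
  have p: "polygon_ineq 2 (half_sinh x)"
    unfolding polygon_ineq_def less2 using x01 set2 by auto
  \<comment> \<open>With two equal sides each is the sum of the others, so the angles \<pi> and 0
    are admissible; \<open>angle_area_two\<close> then gives area 0.\<close>
  have sol: "angle_sol 2 (half_sinh x) (\<lambda>j. if j = 0 then pi else 0)"
    using x01 set2 by (intro angle_sol_degenerate[OF p]) auto
  have "angle_area 2 x (\<lambda>j. if j = 0 then pi else 0) = 0"
    using x01 by (intro angle_area_two[of 0 2 1]) auto
  then show "phi I x \<in> nonneg_orthant n closure_of AC n" "extended_area n (phi I x) = 0"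
    using extended_area_phi[OF n0 I p sol] cl by auto
qed

end
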